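(* Let $d,L\in\mathbb{N}$, $A,B_1,\dots,B_L\in\mathbb{R}^{d\times d}$ and, for $x\in\mathbb{R}^d$, let $(X_t(x))_{t\ge 0}$ be the unique strong solution of the Stratonovich SDE $$dX_t(x)=AX_t(x)\,dt+\sum_{j=1}^{L}B_jX_t(x)\circ dW_j(t),\quad t\ge 0,\qquad X_0(x)=x.$$ Assume that $\{A,B_1,\dots,B_L\}$ is simultaneously diagonalizable, i.e. there is an invertible $P\in\mathbb{C}^{d\times d}$ such that $$PAP^{-1}=\mathrm{diag}(\alpha_1,\dots,\alpha_d),\qquad PB_jP^{-1}=\mathrm{diag}(\beta_{1,j},\dots,\beta_{d,j})\quad\text{for all } j\in\{1,\dots,L\},$$ with possibly complex diagonal entries. Then for any $x\in\mathbb{R}^d$ and $t\ge 0$, $$\mathbb{E}[\|X_t(x)\|^2]=\sum_{i,k=1}^{d}\overline{y}_i\,\Gamma_{i,k}\,y_k\exp(tR_{i,k})\exp(\mathsf{i}\,t\,I_{i,k}),$$ where $\Gamma:=(P^{-1})^*P^{-1}$, $y:=Px$, and for $i,k\in\{1,\dots,d\}$ $$R_{i,k}:=\mathrm{Re}\Big(\overline{\alpha}_i+\alpha_k+\frac12\sum_{j=1}^{L}(\overline{\beta}_{i,j}+\beta_{k,j})^2\Big),\qquad I_{i,k}:=\mathrm{Im}\Big(\overline{\alpha}_i+\alpha_k+\frac12\sum_{j=1}^{L}(\overline{\beta}_{i,j}+\beta_{k,j})^2\Big).$$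
   Context: $W_1,\dots,W_L$ are independent standard one-dimensional Brownian motions on a filtered complete probability space satisfying the usual conditions, and $\circ$ denotes Stratonovich integration. $\|\cdot\|$ is the Euclidean norm, $M^*$ is the conjugate transpose of $M$, and $\mathsf{i}$ is the imaginary unit. *)

theory Defs
  imports "HOL-Probability.Probability"
begin

section \<open>Filtered probability spaces and Brownian motion\<close>

text \<open>
  The time index is \<^typ>\<open>real\<close>, but processes are only considered at times \<open>t \<ge> 0\<close>. The
  library locale \<^locale>\<open>filtration\<close> also provides \<open>\<sigma>\<close>-algebras at negative times; these carry
  no information, since a filtration on \<open>{0..}\<close> extends to negative times by \<open>F t = F 0\<close>.
\<close>

definition usual_conditions :: "'a measure \<Rightarrow> (real \<Rightarrow> 'a measure) \<Rightarrow> bool" where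
  "usual_conditions M F \<longleftrightarrow>
     complete_measure M \<and>
     filtration (space M) F \<and>
     (\<forall>t. subalgebra M (F t)) \<and>
     null_sets M \<subseteq> sets (F 0) \<and>
     (\<forall>t\<ge>0. sets (F t) = (\<Inter>u\<in>{t<..}. sets (F u)))"

definition adapted :: "(real \<Rightarrow> 'a measure) \<Rightarrow> (real \<Rightarrow> 'a \<Rightarrow> 'b::topological_space) \<Rightarrow> bool" where
  "adapted F X \<longleftrightarrow> (\<forall>t\<ge>0. X t \<in> borel_measurable (F t))"

definition continuous_paths :: "'a measure \<Rightarrow> (real \<Rightarrow> 'a \<Rightarrow> 'b::topological_space) \<Rightarrow> bool" where
  "continuous_paths M X \<longleftrightarrow> (AE \<omega> in M. continuous_on {0..} (\<lambda>t. X t \<omega>))"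

definition brownian_motion :: "'a measure \<Rightarrow> (real \<Rightarrow> 'a measure) \<Rightarrow> (real \<Rightarrow> 'a \<Rightarrow> real) \<Rightarrow> bool" where
  "brownian_motion M F W \<longleftrightarrow>
     adapted F W \<and> continuous_paths M W \<and> (AE \<omega> in M. W 0 \<omega> = 0) \<and>
     (\<forall>s t. 0 \<le> s \<and> s < t \<longrightarrow>
        distributed M lborel (\<lambda>\<omega>. W t \<omega> - W s \<omega>) (normal_density 0 (sqrt (t - s))) \<and>
        prob_space.indep_set M (sets (F s))
          (sets (vimage_algebra (space M) (\<lambda>\<omega>. W t \<omega> - W s \<omega>) borel)))"

text \<open>Independence of whole processes, viewed as random elements of the path space.\<close>

definition indep_processes ::
    "'a measure \<Rightarrow> ('l \<Rightarrow> real \<Rightarrow> 'a \<Rightarrow> real) \<Rightarrow> bool" where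
  "indep_processes M W \<longleftrightarrow>
     prob_space.indep_vars M (\<lambda>_. \<Pi>\<^sub>M t\<in>{0..}. borel) (\<lambda>j \<omega>. \<lambda>t\<in>{0..}. W j t \<omega>) UNIV"

section \<open>Continuous semimartingales\<close>

definition martingale :: "'a measure \<Rightarrow> (real \<Rightarrow> 'a measure) \<Rightarrow> (real \<Rightarrow> 'a \<Rightarrow> real) \<Rightarrow> bool" where
  "martingale M F N \<longleftrightarrow>
     adapted F N \<and> (\<forall>t\<ge>0. integrable M (N t)) \<and>
     (\<forall>s t. 0 \<le> s \<and> s \<le> t \<longrightarrow> (AE \<omega> in M. real_cond_exp M (F s) (N t) \<omega> = N s \<omega>))"

text \<open>
  Localizing sequences may be taken real-valued: replace \<open>\<tau> n\<close> by \<open>min (\<tau> n) n\<close>.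
\<close>

definition continuous_local_martingale ::
    "'a measure \<Rightarrow> (real \<Rightarrow> 'a measure) \<Rightarrow> (real \<Rightarrow> 'a \<Rightarrow> real) \<Rightarrow> bool" where
  "continuous_local_martingale M F N \<longleftrightarrow>
     adapted F N \<and> continuous_paths M N \<and>
     (\<exists>\<tau> :: nat \<Rightarrow> 'a \<Rightarrow> real.
        (\<forall>n. stopping_time F (\<tau> n) \<and> (\<forall>\<omega>\<in>space M. 0 \<le> \<tau> n \<omega>)) \<and>
        (AE \<omega> in M. incseq (\<lambda>n. \<tau> n \<omega>) \<and> filterlim (\<lambda>n. \<tau> n \<omega>) at_top sequentially) \<and>
        (\<forall>n. martingale M F (\<lambda>t \<omega>. N (min t (\<tau> n \<omega>)) \<omega> - N 0 \<omega>)))"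

text \<open>Partitions \<open>0 = p 0 \<le> p 1 \<le> \<dots> \<le> p n = t\<close> of the interval \<open>{0..t}\<close>.\<close>

definition is_partition :: "real \<Rightarrow> nat \<Rightarrow> (nat \<Rightarrow> real) \<Rightarrow> bool" where
  "is_partition t n p \<longleftrightarrow> p 0 = 0 \<and> p n = t \<and> (\<forall>i<n. p i \<le> p (Suc i))"

definition finite_variation :: "real \<Rightarrow> (real \<Rightarrow> real) \<Rightarrow> bool" where
  "finite_variation t f \<longleftrightarrow>
     (\<exists>C. \<forall>n p. is_partition t n p \<longrightarrow> (\<Sum>i<n. \<bar>f (p (Suc i)) - f (p i)\<bar>) \<le> C)"

definition continuous_semimartingale ::
    "'a measure \<Rightarrow> (real \<Rightarrow> 'a measure) \<Rightarrow> (real \<Rightarrow> 'a \<Rightarrow> real) \<Rightarrow> bool" where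
  "continuous_semimartingale M F X \<longleftrightarrow>
     (\<exists>N V. continuous_local_martingale M F N \<and>
            adapted F V \<and> continuous_paths M V \<and>
            (AE \<omega> in M. \<forall>t\<ge>0. finite_variation t (\<lambda>s. V s \<omega>)) \<and>
            (AE \<omega> in M. \<forall>t\<ge>0. X t \<omega> = N t \<omega> + V t \<omega>))"

section \<open>Stratonovich integrals and linear Stratonovich equations\<close>

text \<open>
  The Fisk--Stratonovich integral \<open>\<integral>\<^sub>0\<^sup>t Y \<circ> dW\<close>: the limit in probability, as the mesh tends to
  zero, of the Riemann sums which average the integrand over the two endpoints. For continuous
  semimartingales this limit exists and equals the Ito integral plus half the covariation of
  \<open>Y\<close> and \<open>W\<close>.
\<close>

definition stratonovich_sum ::
    "(real \<Rightarrow> 'a \<Rightarrow> 'b::real_vector) \<Rightarrow> (real \<Rightarrow> 'a \<Rightarrow> real) \<Rightarrow> nat \<Rightarrow> (nat \<Rightarrow> real) \<Rightarrow> 'a \<Rightarrow> 'b" where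
  "stratonovich_sum Y W n p \<omega> =
     (\<Sum>i<n. (W (p (Suc i)) \<omega> - W (p i) \<omega>) *\<^sub>R ((1/2) *\<^sub>R (Y (p i) \<omega> + Y (p (Suc i)) \<omega>)))"

definition has_stratonovich_integral ::
    "'a measure \<Rightarrow> (real \<Rightarrow> 'a \<Rightarrow> 'b::euclidean_space) \<Rightarrow> (real \<Rightarrow> 'a \<Rightarrow> real) \<Rightarrow> real \<Rightarrow> ('a \<Rightarrow> 'b) \<Rightarrow> bool" where
  "has_stratonovich_integral M Y W t S \<longleftrightarrow>
     S \<in> borel_measurable M \<and>
     (\<forall>\<epsilon>>0. \<forall>\<eta>>0. \<exists>\<delta>>0. \<forall>n p.
        is_partition t n p \<and> (\<forall>i<n. p (Suc i) - p i < \<delta>) \<longrightarrow>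
        measure M {\<omega>\<in>space M. norm (stratonovich_sum Y W n p \<omega> - S \<omega>) > \<epsilon>} < \<eta>)"

text \<open>
  \<open>X\<close> is a strong solution of \<open>dX = A X dt + (\<Sum>j. B j X \<circ> dW j)\<close>, \<open>X 0 = x\<close>, on the given filtered
  probability space and for the given Brownian motions. Being a continuous semimartingale is
  part of the notion, as it is what makes Stratonovich integrals of \<open>X\<close> meaningful.
\<close>

definition strong_solution ::
    "'a measure \<Rightarrow> (real \<Rightarrow> 'a measure) \<Rightarrow> ('l::finite \<Rightarrow> real \<Rightarrow> 'a \<Rightarrow> real) \<Rightarrow>
     real^'n^'n \<Rightarrow> ('l \<Rightarrow> real^'n^'n) \<Rightarrow> real^'n \<Rightarrow> (real \<Rightarrow> 'a \<Rightarrow> real^'n) \<Rightarrow> bool" where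
  "strong_solution M F W A B x X \<longleftrightarrow>
     adapted F X \<and> continuous_paths M X \<and>
     (\<forall>k. continuous_semimartingale M F (\<lambda>t \<omega>. X t \<omega> $ k)) \<and>
     (AE \<omega> in M. X 0 \<omega> = x) \<and>
     (\<forall>t\<ge>0. \<exists>S.
        (\<forall>j. has_stratonovich_integral M (\<lambda>s \<omega>. B j *v X s \<omega>) (W j) t (S j)) \<and>
        (AE \<omega> in M. X t \<omega> = x + integral {0..t} (\<lambda>s. A *v X s \<omega>) + (\<Sum>j\<in>UNIV. S j \<omega>)))"

section \<open>Complex matrices\<close>

definition complexify_vec :: "real^'n \<Rightarrow> complex^'n" where
  "complexify_vec x = (\<chi> i. complex_of_real (x $ i))"

abbreviation complexify_mat :: "real^'n^'m \<Rightarrow> complex^'n^'m" where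
  "complexify_mat A \<equiv> map_matrix complex_of_real A"

definition diag_matrix :: "('n \<Rightarrow> 'b::zero) \<Rightarrow> 'b^'n^'n" where
  "diag_matrix a = (\<chi> i k. if i = k then a i else 0)"

definition conjugate_transpose :: "complex^'n^'m \<Rightarrow> complex^'m^'n" where
  "conjugate_transpose A = (\<chi> i k. cnj (A $ k $ i))"

end

theory Submission
  imports Defs
begin

text \<open>
  In the diagonalizing basis each coordinate \<open>Z\<close> of \<open>X\<close> solves the scalar equation \<open>dZ = Z \<circ> dH\<close> with
  \<open>H t = \<alpha> t + (\<Sum>j. \<beta> j W j t)\<close>, whose only solution is \<open>Z t = Z 0 exp (H t)\<close>; the second moment is then
  a sum of Gaussian exponential moments.

  Uniqueness is proved on Riemann sums, without stochastic calculus. Let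
  \<open>E i = \<Delta>Z i - (Z i + Z (i + 1)) / 2 * \<Delta>H i\<close> be the error on the \<open>i\<close>-th interval of a partition. The
  Stratonovich sums converge uniformly over partitions, so refining only some of the intervals shows
  that all subset sums of \<open>E\<close> are small in probability; averaging over random signs gives
  \<open>\<Sum>i. \<bar>E i\<bar>\<^sup>2 \<longrightarrow> 0\<close>. Hence \<open>\<Delta>Z i = Z i * \<Delta>H i\<close> up to a square-summably small error, and an
  \<open>L\<^sup>2\<close> bound for martingale transforms gives \<open>\<Sum>i. exp (- H i) * E i \<longrightarrow> 0\<close>. Since the trapezoidal rule
  for \<open>exp (- H)\<close> has a cubic error, telescoping shows that \<open>Z * exp (- H)\<close> is constant in time.
\<close>

section \<open>Events of large probability\<close>

text \<open>The integrals are known only as limits in probability of trapezoidal sums, separately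
  for each end time, so neither an Ito formula nor a quadratic variation of \<open>Z\<close> is at
  hand; everything is read off from finite sums on equidistant grids. Two obstacles shape the
  argument. A partition with n intervals has 2^n subset sums of \<open>E\<close>, each small only
  off its own exceptional event, and a union bound over them is hopeless. But a fixed fraction of
  all sign patterns must produce a sum comparable to the root of the square sum, so exchanging the
  count of patterns with the probability costs only a constant factor. The other obstacle: a small
  square sum does not control a weighted sum of n errors, where cancellation is needed. It is found
  by subdividing every coarse interval. Fine Stratonovich sums reproduce the increments of
  \<open>Z\<close>, hence a coarse error is a difference between two levels, and the main part of
  this difference is a martingale transform whose integrand has the size of the oscillation of
  \<open>Z\<close> and \<open>H\<close> over one coarse interval.\<close>

context prob_space begin

text \<open>Phrased through a measurable witness, so that \<open>Q\<close> itself need not be measurable.\<close>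

definition likely :: "real \<Rightarrow> ('a \<Rightarrow> bool) \<Rightarrow> bool" where
  "likely \<eta> Q \<longleftrightarrow> (\<exists>G\<in>events. prob G \<ge> 1 - \<eta> \<and> (\<forall>\<omega>\<in>G. Q \<omega>))"

lemma likely_mono:
  assumes "likely a P" "\<And>\<omega>. \<omega> \<in> space M \<Longrightarrow> P \<omega> \<Longrightarrow> Q \<omega>" "a \<le> b"
  shows "likely b Q"
proof -
  from assms(1) obtain G where G: "G \<in> events" "prob G \<ge> 1 - a" "\<forall>\<omega>\<in>G. P \<omega>"
    unfolding likely_def by blast
  then show ?thesis
    unfolding likely_def using assms(2,3) sets.sets_into_space[OF G(1)] by (intro bexI[of _ G]) auto
qed

lemma likely_conj:
  assumes "likely a P" "likely b Q"
  shows "likely (a + b) (\<lambda>\<omega>. P \<omega> \<and> Q \<omega>)"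
proof -
  from assms(1) obtain G where G: "G \<in> events" "prob G \<ge> 1 - a" "\<forall>\<omega>\<in>G. P \<omega>"
    unfolding likely_def by blast
  from assms(2) obtain H where H: "H \<in> events" "prob H \<ge> 1 - b" "\<forall>\<omega>\<in>H. Q \<omega>"
    unfolding likely_def by blast
  have "space M - (G \<inter> H) = (space M - G) \<union> (space M - H)" by auto
  then have "prob (space M - (G \<inter> H)) \<le> prob (space M - G) + prob (space M - H)"
    using G H by (simp add: measure_Un_le)
  then have "prob (G \<inter> H) \<ge> 1 - (a + b)"
    using G H by (simp add: prob_compl)
  then show ?thesis
    unfolding likely_def using G H by (intro bexI[of _ "G \<inter> H"]) auto
qed

lemma likely_AE:
  assumes "AE \<omega> in M. Q \<omega>" "0 \<le> \<eta>"
  shows "likely \<eta> Q"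
proof -
  from assms(1) obtain S where "S \<subseteq> {\<omega>\<in>space M. Q \<omega>}" "S \<in> events" "prob S = 1"
    by (rule AE_E_prob)
  then show ?thesis
    unfolding likely_def using assms(2) by (intro bexI[of _ S]) auto
qed

lemma likely_ball:
  assumes "finite J" "\<And>j. j \<in> J \<Longrightarrow> likely \<eta> (Q j)"
  shows "likely (real (card J) * \<eta>) (\<lambda>\<omega>. \<forall>j\<in>J. Q j \<omega>)"
  using assms
proof (induction J rule: finite_induct)
  case empty
  show ?case by (simp add: likely_AE)
next
  case (insert j J)
  have "likely (\<eta> + real (card J) * \<eta>) (\<lambda>\<omega>. Q j \<omega> \<and> (\<forall>j\<in>J. Q j \<omega>))"
    by (rule likely_conj) (use insert in auto)
  then show ?case
    by (rule likely_mono) (use insert in \<open>auto simp: algebra_simps\<close>)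
qed

lemma likely_Collect:
  assumes "{\<omega>\<in>space M. \<not> Q \<omega>} \<in> events" "prob {\<omega>\<in>space M. \<not> Q \<omega>} \<le> \<eta>"
  shows "likely \<eta> Q"
proof -
  have "prob (space M - {\<omega>\<in>space M. \<not> Q \<omega>}) \<ge> 1 - \<eta>"
    using assms by (simp add: prob_compl)
  then show ?thesis
    unfolding likely_def using assms(1)
    by (intro bexI[of _ "space M - {\<omega>\<in>space M. \<not> Q \<omega>}"]) auto
qed

lemma likely_prob_le:
  assumes "likely \<eta> Q" "{\<omega>\<in>space M. \<not> Q \<omega>} \<in> events"
  shows "prob {\<omega>\<in>space M. \<not> Q \<omega>} \<le> \<eta>"
proof -
  from assms(1) obtain G where G: "G \<in> events" "prob G \<ge> 1 - \<eta>" "\<forall>\<omega>\<in>G. Q \<omega>"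
    unfolding likely_def by blast
  have "prob {\<omega>\<in>space M. \<not> Q \<omega>} \<le> prob (space M - G)"
    using G assms(2) by (intro finite_measure_mono) auto
  then show ?thesis using G by (simp add: prob_compl)
qed

lemma likely_Markov:
  assumes "integrable M f" "\<And>\<omega>. \<omega> \<in> space M \<Longrightarrow> 0 \<le> f \<omega>" "expectation f \<le> c * \<eta>" "0 < c"
  shows "likely \<eta> (\<lambda>\<omega>. f \<omega> \<le> c)"
proof (rule likely_Collect)
  have [measurable]: "f \<in> borel_measurable M" using assms(1) by auto
  show "{\<omega>\<in>space M. \<not> f \<omega> \<le> c} \<in> events" by measurable
  have "prob {\<omega>\<in>space M. \<not> f \<omega> \<le> c} \<le> prob {\<omega>\<in>space M. f \<omega> \<ge> c}"
    by (intro finite_measure_mono) auto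
  also have "\<dots> \<le> expectation f / c"
    using assms by (intro integral_Markov_inequality_measure[where A = "{}"]) auto
  also have "\<dots> \<le> \<eta>" using assms by (simp add: field_simps)
  finally show "prob {\<omega>\<in>space M. \<not> f \<omega> \<le> c} \<le> \<eta>" .
qed

text \<open>Continuity from below. This is how an almost sure qualitative property of paths, such as
  boundedness, becomes a deterministic constant off an event of small probability.\<close>

lemma likely_incseq:
  fixes A :: "nat \<Rightarrow> 'a set"
  assumes "\<And>m. A m \<in> events" "incseq A" "AE \<omega> in M. \<exists>m. \<omega> \<in> A m" "\<eta> > 0"
  shows "\<exists>m. likely \<eta> (\<lambda>\<omega>. \<omega> \<in> A m)"
proof -
  have "(\<lambda>m. prob (A m)) \<longlonglongrightarrow> prob (\<Union>m. A m)"
    using assms by (intro finite_Lim_measure_incseq) auto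
  moreover have "prob (\<Union>m. A m) = 1"
    using assms(1,3) by (subst prob_eq_1) auto
  ultimately have "\<forall>\<^sub>F m in sequentially. prob (A m) > 1 - \<eta>"
    using assms(4) by (intro order_tendstoD) auto
  then obtain m where "prob (A m) > 1 - \<eta>"
    using eventually_happens'[OF sequentially_bot] by blast
  then show ?thesis
    unfolding likely_def using assms(1) by (intro exI[of _ m] bexI[of _ "A m"]) auto
qed

text \<open>The modulus \<delta> is deterministic although each path has its own: the events
  \<open>A m\<close> on which 1/(m+1) works exhaust almost all paths. They test only a countable
  dense set of times, which makes them measurable; path continuity carries the bound over to all
  times.\<close>

lemma likely_uniformly_continuous:
  fixes Y :: "real \<Rightarrow> 'a \<Rightarrow> 'b::{metric_space,second_countable_topology}"
  assumes meas: "\<And>s. s \<ge> 0 \<Longrightarrow> Y s \<in> borel_measurable M"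
    and cont: "AE \<omega> in M. continuous_on {0..} (\<lambda>s. Y s \<omega>)"
    and "\<epsilon> > 0" "\<eta> > 0" "t \<ge> 0"
  shows "\<exists>\<delta>>0. likely \<eta> (\<lambda>\<omega>. \<forall>s\<in>{0..t}. \<forall>u\<in>{0..t}. \<bar>s - u\<bar> < \<delta> \<longrightarrow> dist (Y s \<omega>) (Y u \<omega>) \<le> \<epsilon>)"
proof -
  obtain D0 :: "real set" where D0: "countable D0" "D0 \<subseteq> {0..t}" "{0..t} \<subseteq> closure D0"
    by (rule separable)
  then have "D0 \<noteq> {}" using \<open>t \<ge> 0\<close> by auto
  define d where "d = from_nat_into D0"
  have d: "D0 = range d" unfolding d_def using \<open>D0 \<noteq> {}\<close> D0(1) by (simp add: range_from_nat_into)
  define D where "D = range d"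
  have D: "D \<subseteq> {0..t}" "{0..t} \<subseteq> closure D" using D0 d by (auto simp: D_def)
  define A where "A m = {\<omega>\<in>space M. \<forall>s\<in>D. \<forall>u\<in>D. \<bar>s - u\<bar> < inverse (real (Suc m)) \<longrightarrow>
    dist (Y s \<omega>) (Y u \<omega>) \<le> \<epsilon>}" for m
  have [measurable]: "Y (d k) \<in> borel_measurable M" for k
    using D(1) by (intro meas) (auto simp: D_def image_subset_iff)
  have "A m = {\<omega>\<in>space M. \<forall>k l. \<bar>d k - d l\<bar> < inverse (real (Suc m)) \<longrightarrow>
      dist (Y (d k) \<omega>) (Y (d l) \<omega>) \<le> \<epsilon>}" for m
    unfolding A_def D_def by blast
  moreover have "{\<omega>\<in>space M. c \<longrightarrow> dist (Y (d k) \<omega>) (Y (d l) \<omega>) \<le> \<epsilon>} \<in> events" for c k l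
    by (cases c) auto
  ultimately have "A m \<in> events" for m
    by (simp only:) (intro sets.sets_Collect_countable_All)
  moreover have "incseq A"
  proof (intro monoI)
    fix m m' :: nat
    assume "m \<le> m'"
    then have le: "inverse (real (Suc m')) \<le> inverse (real (Suc m))" by (intro le_imp_inverse_le) auto
    show "A m \<le> A m'" unfolding A_def
    proof safe
      fix \<omega> s u
      assume "\<forall>s\<in>D. \<forall>u\<in>D. \<bar>s - u\<bar> < inverse (real (Suc m)) \<longrightarrow> dist (Y s \<omega>) (Y u \<omega>) \<le> \<epsilon>"
        "s \<in> D" "u \<in> D" "\<bar>s - u\<bar> < inverse (real (Suc m'))"
      then show "dist (Y s \<omega>) (Y u \<omega>) \<le> \<epsilon>"
        using le order.strict_trans2 by blast
    qed
  qed
  moreover have "AE \<omega> in M. \<exists>m. \<omega> \<in> A m"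
    using cont
  proof (rule AE_mp, intro AE_I2 impI)
    fix \<omega>
    assume \<omega>: "\<omega> \<in> space M" "continuous_on {0..} (\<lambda>s. Y s \<omega>)"
    have "uniformly_continuous_on {0..t} (\<lambda>s. Y s \<omega>)"
      by (intro compact_uniformly_continuous continuous_on_subset[OF \<omega>(2)]) auto
    then obtain d where d: "d > 0" "\<And>s u. s \<in> {0..t} \<Longrightarrow> u \<in> {0..t} \<Longrightarrow> dist u s < d \<Longrightarrow> dist (Y u \<omega>) (Y s \<omega>) < \<epsilon>"
      using \<open>\<epsilon> > 0\<close> unfolding uniformly_continuous_on_def by meson
    obtain m where m: "inverse (real (Suc m)) < d"
      using reals_Archimedean d(1) by blast
    have "dist (Y s \<omega>) (Y u \<omega>) \<le> \<epsilon>" if "s \<in> D" "u \<in> D" "\<bar>s - u\<bar> < inverse (real (Suc m))" for s u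
      using d(2)[of u s] that D(1) m by (force simp: dist_real_def)
    then have "\<omega> \<in> A m"
      using \<omega> unfolding A_def by blast
    then show "\<exists>m. \<omega> \<in> A m" ..
  qed
  ultimately obtain m where m: "likely (\<eta>/2) (\<lambda>\<omega>. \<omega> \<in> A m)"
    using likely_incseq[of A "\<eta>/2"] \<open>\<eta> > 0\<close> by auto
  have "likely (\<eta>/2 + \<eta>/2) (\<lambda>\<omega>. \<omega> \<in> A m \<and> continuous_on {0..} (\<lambda>s. Y s \<omega>))"
    using \<open>\<eta> > 0\<close> by (intro likely_conj m likely_AE cont) auto
  then have "likely \<eta> (\<lambda>\<omega>. \<forall>s\<in>{0..t}. \<forall>u\<in>{0..t}. \<bar>s - u\<bar> < inverse (real (Suc m)) \<longrightarrow> dist (Y s \<omega>) (Y u \<omega>) \<le> \<epsilon>)"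
  proof (rule likely_mono, intro ballI impI)
    fix \<omega> s u
    assume \<omega>: "\<omega> \<in> A m \<and> continuous_on {0..} (\<lambda>s. Y s \<omega>)" and su: "s \<in> {0..t}" "u \<in> {0..t}"
      "\<bar>s - u\<bar> < inverse (real (Suc m))"
    obtain f where f: "\<And>k. f k \<in> D" "f \<longlonglongrightarrow> s"
      using su(1) D(2) closure_sequential[of s D] by blast
    obtain g where g: "\<And>k. g k \<in> D" "g \<longlonglongrightarrow> u"
      using su(2) D(2) closure_sequential[of u D] by blast
    have Yc: "(\<lambda>k. Y (h k) \<omega>) \<longlonglongrightarrow> Y v \<omega>" if "\<And>k. h k \<in> D" "h \<longlonglongrightarrow> v" "v \<in> {0..t}" for h v
      using \<omega> that subsetD[OF D(1) that(1)]
      by (intro continuous_on_tendsto_compose[of "{0..}" "\<lambda>s. Y s \<omega>"]) auto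
    \<comment> \<open>The premise is a strict inequality, so approximating times from the dense set
      inherit it; the conclusion is non-strict, so it survives the limit.\<close>
    have "(\<lambda>k. \<bar>f k - g k\<bar>) \<longlonglongrightarrow> \<bar>s - u\<bar>"
      using f g by (intro tendsto_intros)
    then have "\<forall>\<^sub>F k in sequentially. \<bar>f k - g k\<bar> < inverse (real (Suc m))"
      using su(3) by (rule order_tendstoD)
    then have "\<forall>\<^sub>F k in sequentially. dist (Y (f k) \<omega>) (Y (g k) \<omega>) \<le> \<epsilon>"
      by eventually_elim (use \<omega> f g in \<open>auto simp: A_def\<close>)
    moreover have "(\<lambda>k. dist (Y (f k) \<omega>) (Y (g k) \<omega>)) \<longlonglongrightarrow> dist (Y s \<omega>) (Y u \<omega>)"
      by (intro tendsto_intros Yc f g su)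
    ultimately show "dist (Y s \<omega>) (Y u \<omega>) \<le> \<epsilon>"
      by (intro tendsto_upperbound[of _ "dist (Y s \<omega>) (Y u \<omega>)"]) auto
  qed auto
  then show ?thesis by (intro exI[of _ "inverse (real (Suc m))"]) auto
qed

text \<open>Same scheme as for the modulus of continuity: the bound is tested on a dense sequence of
  times, and compactness of the time interval makes every continuous path bounded.\<close>

lemma likely_bounded:
  fixes Y :: "real \<Rightarrow> 'a \<Rightarrow> 'b::{real_normed_vector,second_countable_topology}"
  assumes meas: "\<And>s. s \<ge> 0 \<Longrightarrow> Y s \<in> borel_measurable M"
    and cont: "AE \<omega> in M. continuous_on {0..} (\<lambda>s. Y s \<omega>)"
    and "\<eta> > 0" "t \<ge> 0"
  shows "\<exists>K>0. likely \<eta> (\<lambda>\<omega>. \<forall>s\<in>{0..t}. norm (Y s \<omega>) \<le> K)"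
proof -
  obtain D0 :: "real set" where D0: "countable D0" "D0 \<subseteq> {0..t}" "{0..t} \<subseteq> closure D0"
    by (rule separable)
  then have "D0 \<noteq> {}" using \<open>t \<ge> 0\<close> by auto
  define d where "d = from_nat_into D0"
  have d: "D0 = range d" unfolding d_def using \<open>D0 \<noteq> {}\<close> D0(1) by (simp add: range_from_nat_into)
  define D where "D = range d"
  have D: "D \<subseteq> {0..t}" "{0..t} \<subseteq> closure D" using D0 d by (auto simp: D_def)
  define A where "A m = {\<omega>\<in>space M. \<forall>s\<in>D. norm (Y s \<omega>) \<le> real (Suc m)}" for m
  have [measurable]: "Y (d k) \<in> borel_measurable M" for k
    using D(1) by (intro meas) (auto simp: D_def image_subset_iff)
  have "A m = {\<omega>\<in>space M. \<forall>k. norm (Y (d k) \<omega>) \<le> real (Suc m)}" for m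
    unfolding A_def D_def by blast
  moreover have "{\<omega>\<in>space M. norm (Y (d k) \<omega>) \<le> c} \<in> events" for c k
    by measurable
  ultimately have "A m \<in> events" for m
    by (simp only:) (intro sets.sets_Collect_countable_All)
  moreover have "incseq A"
    by (intro monoI) (force simp: A_def)
  moreover have "AE \<omega> in M. \<exists>m. \<omega> \<in> A m"
    using cont
  proof (rule AE_mp, intro AE_I2 impI)
    fix \<omega>
    assume \<omega>: "\<omega> \<in> space M" "continuous_on {0..} (\<lambda>s. Y s \<omega>)"
    have "bounded ((\<lambda>s. Y s \<omega>) ` {0..t})"
      by (intro compact_imp_bounded compact_continuous_image continuous_on_subset[OF \<omega>(2)]) auto
    then obtain b where "\<forall>y\<in>(\<lambda>s. Y s \<omega>) ` {0..t}. norm y \<le> b"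
      unfolding bounded_iff ..
    then have b: "norm (Y s \<omega>) \<le> b" if "s \<in> {0..t}" for s
      using that by simp
    obtain m :: nat where "b \<le> real m" using real_arch_simple by blast
    then have "norm (Y s \<omega>) \<le> real (Suc m)" if "s \<in> D" for s
      using order_trans[OF b[OF subsetD[OF D(1) that]], of "real (Suc m)"] by linarith
    then have "\<omega> \<in> A m"
      using \<omega>(1) unfolding A_def by blast
    then show "\<exists>m. \<omega> \<in> A m" ..
  qed
  ultimately obtain m where m: "likely (\<eta>/2) (\<lambda>\<omega>. \<omega> \<in> A m)"
    using likely_incseq[of A "\<eta>/2"] \<open>\<eta> > 0\<close> by auto
  have "likely (\<eta>/2 + \<eta>/2) (\<lambda>\<omega>. \<omega> \<in> A m \<and> continuous_on {0..} (\<lambda>s. Y s \<omega>))"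
    using \<open>\<eta> > 0\<close> by (intro likely_conj m likely_AE cont) auto
  then have "likely \<eta> (\<lambda>\<omega>. \<forall>s\<in>{0..t}. norm (Y s \<omega>) \<le> real (Suc m))"
  proof (rule likely_mono, intro ballI)
    fix \<omega> s
    assume \<omega>: "\<omega> \<in> A m \<and> continuous_on {0..} (\<lambda>s. Y s \<omega>)" and s: "s \<in> {0..t}"
    obtain f where f: "\<And>k. f k \<in> D" "f \<longlonglongrightarrow> s"
      using s D(2) closure_sequential[of s D] by blast
    have "(\<lambda>k. Y (f k) \<omega>) \<longlonglongrightarrow> Y s \<omega>"
      using \<omega> f s subsetD[OF D(1) f(1)]
      by (intro continuous_on_tendsto_compose[of "{0..}" "\<lambda>s. Y s \<omega>"]) auto
    then have "(\<lambda>k. norm (Y (f k) \<omega>)) \<longlonglongrightarrow> norm (Y s \<omega>)"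
      by (rule tendsto_norm)
    then show "norm (Y s \<omega>) \<le> real (Suc m)"
      by (rule tendsto_upperbound) (use \<omega> f in \<open>auto simp: A_def\<close>)
  qed auto
  then show ?thesis by (intro exI[of _ "real (Suc m)"]) auto
qed

text \<open>The event that f exceeds 1/(m+1) has probability below every \<eta>, hence is null, and
  there are countably many m.\<close>

lemma AE_zero_if_likely:
  fixes f :: "'a \<Rightarrow> real"
  assumes [measurable]: "f \<in> borel_measurable M"
    and "\<And>\<epsilon> \<eta>. \<epsilon> > 0 \<Longrightarrow> \<eta> > 0 \<Longrightarrow> likely \<eta> (\<lambda>\<omega>. f \<omega> \<le> \<epsilon>)"
  shows "AE \<omega> in M. f \<omega> \<le> 0"
proof -
  have "AE \<omega> in M. f \<omega> \<le> inverse (real (Suc m))" for m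
  proof -
    have "prob {\<omega>\<in>space M. \<not> f \<omega> \<le> inverse (real (Suc m))} \<le> 0"
    proof (rule field_le_epsilon)
      fix e :: real assume "e > 0"
      show "prob {\<omega>\<in>space M. \<not> f \<omega> \<le> inverse (real (Suc m))} \<le> 0 + e"
        by (rule likely_prob_le) (use \<open>e > 0\<close> assms(2)[of "inverse (real (Suc m))" e] in auto)
    qed
    then have "prob {\<omega>\<in>space M. \<not> f \<omega> \<le> inverse (real (Suc m))} = 0"
      using measure_nonneg[of M] by (intro antisym) auto
    then show ?thesis
      by (subst (asm) prob_eq_0) auto
  qed
  then have "AE \<omega> in M. \<forall>m. f \<omega> \<le> inverse (real (Suc m))"
    by (simp add: AE_all_countable)
  then show ?thesis
  proof eventually_elim
    fix \<omega> assume "\<forall>m. f \<omega> \<le> inverse (real (Suc m))"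
    then show "f \<omega> \<le> 0"
      using reals_Archimedean[of "f \<omega>"] by (meson not_le)
  qed
qed

end

section \<open>Random signs\<close>

text \<open>Induction step for averages over signs: the fresh index carries either a minus or a
  plus.\<close>

lemma sum_Pow_insert:
  fixes f :: "'b set \<Rightarrow> 'c::comm_monoid_add"
  assumes "finite I" "i \<notin> I"
  shows "sum f (Pow (insert i I)) = (\<Sum>G\<in>Pow I. f G + f (insert i G))"
proof -
  have "inj_on (insert i) (Pow I)"
    using assms(2) by (auto simp: inj_on_def dest!: insert_ident[THEN iffD1, rotated -1])
  moreover have "Pow I \<inter> insert i ` Pow I = {}" using assms(2) by auto
  ultimately show ?thesis
    using assms(1) by (simp add: Pow_insert sum.union_disjoint sum.reindex sum.distrib)
qed

text \<open>A Rademacher sum. The sample space of the signs is \<open>Pow I\<close> with counting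
  measure, \<open>G\<close> being the set of positive signs, so expectations are finite sums over
  subsets.\<close>

definition sign_sum :: "'b set \<Rightarrow> ('b \<Rightarrow> 'c::real_inner) \<Rightarrow> 'b set \<Rightarrow> 'c" where
  "sign_sum I a G = (\<Sum>i\<in>I. if i \<in> G then a i else - a i)"

lemma sign_sum_insert:
  assumes "finite I" "i \<notin> I" "G \<subseteq> I"
  shows "sign_sum (insert i I) a G = sign_sum I a G - a i"
    and "sign_sum (insert i I) a (insert i G) = sign_sum I a G + a i"
proof -
  have "i \<notin> G" using assms by auto
  moreover have "(\<Sum>j\<in>I. if j = i \<or> j \<in> G then a j else - a j) = (\<Sum>j\<in>I. if j \<in> G then a j else - a j)"
    using assms by (intro sum.cong) auto
  ultimately show "sign_sum (insert i I) a G = sign_sum I a G - a i"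
    "sign_sum (insert i I) a (insert i G) = sign_sum I a G + a i"
    using assms by (simp_all add: sign_sum_def add.commute)
qed

text \<open>Orthogonality of the signs; the parallelogram law adds one index at a time.\<close>

lemma sum_norm2_sign_sum:
  assumes "finite I"
  shows "(\<Sum>G\<in>Pow I. (norm (sign_sum I a G))\<^sup>2) = 2 ^ card I * (\<Sum>i\<in>I. (norm (a i))\<^sup>2)"
  using assms
proof (induction I rule: finite_induct)
  case empty
  then show ?case by (simp add: sign_sum_def)
next
  case (insert i I)
  have "(norm (T - v))\<^sup>2 + (norm (T + v))\<^sup>2 = 2 * (norm T)\<^sup>2 + 2 * (norm v)\<^sup>2" for T v :: 'b
    by (simp add: power2_norm_eq_inner inner_simps)
  then have "(\<Sum>G\<in>Pow (insert i I). (norm (sign_sum (insert i I) a G))\<^sup>2) =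
      (\<Sum>G\<in>Pow I. 2 * (norm (sign_sum I a G))\<^sup>2 + 2 * (norm (a i))\<^sup>2)"
    using insert by (simp add: sum_Pow_insert sign_sum_insert)
  also have "\<dots> = 2 ^ card (insert i I) * (\<Sum>i\<in>insert i I. (norm (a i))\<^sup>2)"
    using insert by (simp add: sum.distrib sum_distrib_left[symmetric] card_Pow algebra_simps)
  finally show ?case .
qed

text \<open>Khintchine's inequality for the fourth moment, with the Gaussian constant 3. In the
  induction the values T - v and T + v together give 2 |T|^4 + 4 |T|^2 |v|^2 + 2 |v|^4 + 8 (T .
  v)^2, and Cauchy-Schwarz on the last term raises the middle coefficient to 12.\<close>

lemma sum_norm4_sign_sum:
  assumes "finite I"
  shows "(\<Sum>G\<in>Pow I. (norm (sign_sum I a G)) ^ 4) \<le> 3 * 2 ^ card I * (\<Sum>i\<in>I. (norm (a i))\<^sup>2)\<^sup>2"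
  using assms
proof (induction I rule: finite_induct)
  case empty
  then show ?case by (simp add: sign_sum_def)
next
  case (insert i I)
  define Q where "Q = (\<Sum>i\<in>I. (norm (a i))\<^sup>2)"
  define q where "q = (norm (a i))\<^sup>2"
  have le: "norm (T - a i) ^ 4 + norm (T + a i) ^ 4 \<le> 2 * norm T ^ 4 + 12 * q * (norm T)\<^sup>2 + 2 * q\<^sup>2" for T
  proof -
    have m: "(norm (T - a i))\<^sup>2 = (norm T)\<^sup>2 + q - 2 * (T \<bullet> a i)"
      and p: "(norm (T + a i))\<^sup>2 = (norm T)\<^sup>2 + q + 2 * (T \<bullet> a i)"
      unfolding q_def by (simp_all add: power2_norm_eq_inner inner_simps inner_commute)
    have "(T \<bullet> a i)\<^sup>2 \<le> (norm T)\<^sup>2 * q"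
      unfolding q_def by (metis Cauchy_Schwarz_ineq power2_norm_eq_inner)
    moreover have "(N + q - 2 * c)\<^sup>2 + (N + q + 2 * c)\<^sup>2 \<le> 2 * N\<^sup>2 + 12 * q * N + 2 * q\<^sup>2"
      if "c\<^sup>2 \<le> N * q" for c N :: real
      using that by (simp add: power2_eq_square algebra_simps)
    moreover have e4: "norm v ^ 4 = ((norm v)\<^sup>2)\<^sup>2" for v :: 'b by simp
    ultimately show ?thesis
      unfolding e4 m p by blast
  qed
  have "(\<Sum>G\<in>Pow (insert i I). norm (sign_sum (insert i I) a G) ^ 4) \<le>
      (\<Sum>G\<in>Pow I. 2 * norm (sign_sum I a G) ^ 4 + 12 * q * (norm (sign_sum I a G))\<^sup>2 + 2 * q\<^sup>2)"
    using insert le by (simp add: sum_Pow_insert sign_sum_insert sum_mono)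
  also have "\<dots> = 2 * (\<Sum>G\<in>Pow I. norm (sign_sum I a G) ^ 4) + 12 * q * (2 ^ card I * Q) + 2 ^ card I * (2 * q\<^sup>2)"
    using insert(1) sum_norm2_sign_sum[OF insert(1), of a]
    by (simp add: sum.distrib sum_distrib_left[symmetric] card_Pow Q_def)
  also have "\<dots> \<le> 2 * (3 * 2 ^ card I * Q\<^sup>2) + 12 * q * (2 ^ card I * Q) + 2 ^ card I * (2 * q\<^sup>2)"
    using insert.IH by (simp add: Q_def)
  also have "\<dots> \<le> 3 * 2 ^ Suc (card I) * (q + Q)\<^sup>2"
    by (simp add: power2_eq_square algebra_simps q_def)
  also have "\<dots> = 3 * 2 ^ card (insert i I) * (\<Sum>i\<in>insert i I. (norm (a i))\<^sup>2)\<^sup>2"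
    using insert by (simp add: Q_def q_def)
  finally show ?case .
qed

text \<open>A Paley-Zygmund inequality: a nonnegative variable with mean 1 and bounded second moment
  cannot be concentrated near 0. The normalised square \<open>s\<close> is such a variable by the
  second and fourth moments of sign sums.\<close>

lemma card_large_sign_sums:
  assumes "finite I" and Q: "(\<Sum>i\<in>I. (norm (a i))\<^sup>2) > 0"
  shows "2 ^ card I \<le> 12 * real (card {G\<in>Pow I. (norm (sign_sum I a G))\<^sup>2 > (\<Sum>i\<in>I. (norm (a i))\<^sup>2) / 2})"
proof -
  define Q where "Q = (\<Sum>i\<in>I. (norm (a i))\<^sup>2)"
  define s where "s G = (norm (sign_sum I a G))\<^sup>2 / Q" for G
  have "Q > 0" using Q by (simp add: Q_def)
  have s1: "(\<Sum>G\<in>Pow I. s G) = 2 ^ card I"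
    using sum_norm2_sign_sum[OF assms(1), of a] \<open>Q > 0\<close>
    unfolding s_def by (simp add: sum_divide_distrib[symmetric] Q_def)
  have "(\<Sum>G\<in>Pow I. (s G)\<^sup>2) = (\<Sum>G\<in>Pow I. norm (sign_sum I a G) ^ 4) / Q\<^sup>2"
    unfolding s_def by (simp add: sum_divide_distrib power_divide flip: power_mult)
  also have "\<dots> \<le> 3 * 2 ^ card I"
    using sum_norm4_sign_sum[OF assms(1), of a] \<open>Q > 0\<close> by (simp add: divide_le_eq Q_def)
  finally have s2: "(\<Sum>G\<in>Pow I. (s G)\<^sup>2) \<le> 3 * 2 ^ card I" .
  \<comment> \<open>A quadratic minorant of the indicator of x > 1/2; its maximum, at x = 6, is 5/6.
    For mean 1 and mean square at most 3 its average is at least (1 - 1/2 - 3/12) / 3 =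
    1/12.\<close>
  have pt: "(x - 1/2 - x\<^sup>2 / 12) / 3 \<le> (if x > 1/2 then 1 else 0)" for x :: real
  proof -
    have "0 \<le> (x - 6)\<^sup>2" "0 \<le> x\<^sup>2" by simp_all
    then have "x \<le> 3 + x\<^sup>2 / 12" "0 \<le> x\<^sup>2" by (simp_all add: power2_diff)
    then have "(x - 1/2 - x\<^sup>2 / 12) / 3 \<le> 1" "(x - 1/2 - x\<^sup>2 / 12) / 3 \<le> 0 \<or> x > 1/2"
      by (simp, argo)
    then show ?thesis by auto
  qed
  have "2 ^ card I / 12 \<le> (\<Sum>G\<in>Pow I. (s G - 1/2 - (s G)\<^sup>2 / 12) / 3)"
    using s1 s2 assms(1)
    by (simp add: sum_subtractf sum_divide_distrib[symmetric] card_Pow)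
  also have "\<dots> \<le> (\<Sum>G\<in>Pow I. if s G > 1/2 then 1 else 0)"
    by (intro sum_mono pt)
  also have "\<dots> = real (card {G\<in>Pow I. s G > 1/2})"
    using assms(1) by (subst sum.inter_filter[symmetric]) auto
  also have "{G\<in>Pow I. s G > 1/2} = {G\<in>Pow I. (norm (sign_sum I a G))\<^sup>2 > Q / 2}"
    using \<open>Q > 0\<close> by (auto simp: s_def field_simps)
  finally show ?thesis by (simp add: Q_def)
qed

section \<open>From small subset sums to a small sum of squares\<close>

context prob_space begin

text \<open>Where the square sum exceeds 8 \<epsilon>^2, at least 1/12 of all sign sums exceed 2
  \<epsilon>, while each single one does so with probability at most 2 \<eta>. Counting pairs of an
  outcome and a sign pattern in both orders gives the factor 12 * 2 = 24.\<close>

lemma likely_sum_norm2: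
  fixes E :: "'b \<Rightarrow> 'a \<Rightarrow> 'c::euclidean_space"
  assumes "finite I" and E[measurable]: "\<And>i. i \<in> I \<Longrightarrow> E i \<in> borel_measurable M"
    and small: "\<And>G. G \<subseteq> I \<Longrightarrow> likely \<eta> (\<lambda>\<omega>. norm (\<Sum>i\<in>G. E i \<omega>) \<le> \<epsilon>)"
    and "\<epsilon> > 0"
  shows "likely (24 * \<eta>) (\<lambda>\<omega>. (\<Sum>i\<in>I. (norm (E i \<omega>))\<^sup>2) \<le> 8 * \<epsilon>\<^sup>2)"
proof (rule likely_Collect)
  define T where "T G \<omega> = sign_sum I (\<lambda>i. E i \<omega>) G" for G \<omega>
  define Q where "Q \<omega> = (\<Sum>i\<in>I. (norm (E i \<omega>))\<^sup>2)" for \<omega>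
  have [measurable]: "Q \<in> borel_measurable M"
    unfolding Q_def by measurable
  have [measurable]: "T G \<in> borel_measurable M" for G
    unfolding T_def sign_sum_def by measurable
  show "{\<omega>\<in>space M. \<not> (\<Sum>i\<in>I. (norm (E i \<omega>))\<^sup>2) \<le> 8 * \<epsilon>\<^sup>2} \<in> events"
    unfolding Q_def[symmetric] by measurable
  \<comment> \<open>A sign sum is the subset sum over \<open>G\<close> minus the one over its
    complement, which doubles both \<epsilon> and \<eta>.\<close>
  have PT: "prob {\<omega>\<in>space M. \<not> norm (T G \<omega>) \<le> 2 * \<epsilon>} \<le> 2 * \<eta>" if "G \<in> Pow I" for G
  proof (rule likely_prob_le)
    have "likely (\<eta> + \<eta>) (\<lambda>\<omega>. norm (\<Sum>i\<in>G. E i \<omega>) \<le> \<epsilon> \<and> norm (\<Sum>i\<in>I - G. E i \<omega>) \<le> \<epsilon>)"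
      using that by (intro likely_conj small) auto
    then show "likely (2 * \<eta>) (\<lambda>\<omega>. norm (T G \<omega>) \<le> 2 * \<epsilon>)"
    proof (rule likely_mono)
      fix \<omega>
      assume *: "norm (\<Sum>i\<in>G. E i \<omega>) \<le> \<epsilon> \<and> norm (\<Sum>i\<in>I - G. E i \<omega>) \<le> \<epsilon>"
      have "T G \<omega> = (\<Sum>i\<in>I - G. - E i \<omega>) + (\<Sum>i\<in>G. E i \<omega>)"
        unfolding T_def sign_sum_def using that assms(1)
        by (subst sum.subset_diff[of G I]) (auto intro!: arg_cong2[where f = "(+)"] sum.cong)
      then have "T G \<omega> = (\<Sum>i\<in>G. E i \<omega>) - (\<Sum>i\<in>I - G. E i \<omega>)"
        by (simp add: sum_negf)
      then show "norm (T G \<omega>) \<le> 2 * \<epsilon>"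
        using * norm_triangle_ineq4[of "\<Sum>i\<in>G. E i \<omega>" "\<Sum>i\<in>I - G. E i \<omega>"] by simp
    qed simp
  qed measurable
  let ?A = "{\<omega>\<in>space M. \<not> Q \<omega> \<le> 8 * \<epsilon>\<^sup>2}"
  let ?B = "\<lambda>G. {\<omega>\<in>space M. \<not> norm (T G \<omega>) \<le> 2 * \<epsilon>}"
  have "2 ^ card I * prob ?A = expectation (\<lambda>\<omega>. 2 ^ card I * indicator ?A \<omega>)"
    by simp
  also have "\<dots> \<le> expectation (\<lambda>\<omega>. 12 * (\<Sum>G\<in>Pow I. indicator (?B G) \<omega>))"
  proof (rule integral_mono)
    fix \<omega> assume "\<omega> \<in> space M"
    show "2 ^ card I * indicator ?A \<omega> \<le> 12 * (\<Sum>G\<in>Pow I. indicator (?B G) \<omega> :: real)"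
    proof (cases "\<omega> \<in> ?A")
      case True
      then have q: "8 * \<epsilon>\<^sup>2 < Q \<omega>" by simp
      moreover have "0 < 8 * \<epsilon>\<^sup>2" using \<open>\<epsilon> > 0\<close> by simp
      ultimately have "Q \<omega> > 0" by linarith
      then have "2 ^ card I \<le> 12 * real (card {G\<in>Pow I. (norm (T G \<omega>))\<^sup>2 > Q \<omega> / 2})"
        using card_large_sign_sums[OF assms(1), of "\<lambda>i. E i \<omega>"] by (simp add: T_def Q_def)
      also have "\<dots> = 12 * (\<Sum>G\<in>Pow I. if (norm (T G \<omega>))\<^sup>2 > Q \<omega> / 2 then 1 else 0)"
        using assms(1) by (subst sum.inter_filter[symmetric]) auto
      also have "\<dots> \<le> 12 * (\<Sum>G\<in>Pow I. indicator (?B G) \<omega>)"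
      proof (intro mult_left_mono sum_mono)
        fix G assume "G \<in> Pow I"
        have "norm (T G \<omega>) > 2 * \<epsilon>" if "(norm (T G \<omega>))\<^sup>2 > Q \<omega> / 2"
        proof (rule power2_less_imp_less)
          show "(2 * \<epsilon>)\<^sup>2 < (norm (T G \<omega>))\<^sup>2" using that q by (simp add: power_mult_distrib)
        qed simp
        then show "(if (norm (T G \<omega>))\<^sup>2 > Q \<omega> / 2 then 1 else 0) \<le> (indicator (?B G) \<omega> :: real)"
          using \<open>\<omega> \<in> space M\<close> by (auto simp: indicator_def)
      qed simp
      finally show ?thesis using True by simp
    qed (auto intro!: sum_nonneg)
  qed (auto intro!: integrable_mult_right Bochner_Integration.integrable_sum integrable_real_indicator simp: less_top[symmetric])
  also have "\<dots> = 12 * (\<Sum>G\<in>Pow I. prob (?B G))"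
  proof -
    have "integrable M (indicat_real (?B G))" for G
      by (intro integrable_real_indicator) (auto simp: less_top[symmetric])
    moreover have "expectation (indicat_real (?B G)) = prob (?B G)" for G by simp
    ultimately show ?thesis
      by (simp only: integral_mult_right_zero Bochner_Integration.integral_sum)
  qed
  also have "\<dots> \<le> 12 * (\<Sum>G\<in>Pow I. 2 * \<eta>)"
    by (intro mult_left_mono sum_mono PT) auto
  also have "\<dots> = 2 ^ card I * (24 * \<eta>)"
    using assms(1) by (simp add: card_Pow)
  finally show "prob {\<omega>\<in>space M. \<not> (\<Sum>i\<in>I. (norm (E i \<omega>))\<^sup>2) \<le> 8 * \<epsilon>\<^sup>2} \<le> 24 * \<eta>"
    by (simp add: Q_def)
qed

end

section \<open>Martingale transforms of Brownian motion\<close>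

locale brownian_filtration = prob_space M
  for M :: "'a measure" and F :: "real \<Rightarrow> 'a measure" and W :: "'l::finite \<Rightarrow> real \<Rightarrow> 'a \<Rightarrow> real" +
  assumes filt: "filtration (space M) F"
    and sub: "\<And>t. subalgebra M (F t)"
    and BM: "\<And>j. brownian_motion M F (W j)"
begin

lemma space_filt [simp]: "space (F t) = space M"
  using sub[of t] by (simp add: subalgebra_def)

lemma measurable_filt_mono:
  assumes "f \<in> borel_measurable (F s)" "s \<le> u"
  shows "f \<in> borel_measurable (F u)"
proof -
  have "subalgebra (F u) (F s)"
    using filtration.sets_F_mono[OF filt assms(2)] by (simp add: subalgebra_def)
  then show ?thesis using assms(1) by (rule measurable_from_subalg)
qed

lemma measurable_filt: "f \<in> borel_measurable (F s) \<Longrightarrow> f \<in> borel_measurable M"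
  by (rule measurable_from_subalg[OF sub])

lemma W_adapted: "s \<ge> 0 \<Longrightarrow> W j s \<in> borel_measurable (F s)"
  using BM[of j] by (simp add: brownian_motion_def adapted_def)

lemma W_measurable [measurable]: "s \<ge> 0 \<Longrightarrow> W j s \<in> borel_measurable M"
  by (rule measurable_filt[OF W_adapted])

lemma W_increment_distributed:
  assumes "0 \<le> s" "s < u"
  shows "distributed M lborel (\<lambda>\<omega>. W j u \<omega> - W j s \<omega>) (normal_density 0 (sqrt (u - s)))"
  using BM[of j] assms by (simp add: brownian_motion_def)

lemma W_increment_moments:
  assumes "0 \<le> s" "s \<le> u"
  shows "integrable M (\<lambda>\<omega>. W j u \<omega> - W j s \<omega>)"
    and "expectation (\<lambda>\<omega>. W j u \<omega> - W j s \<omega>) = 0"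
    and "integrable M (\<lambda>\<omega>. (W j u \<omega> - W j s \<omega>)\<^sup>2)"
    and "expectation (\<lambda>\<omega>. (W j u \<omega> - W j s \<omega>)\<^sup>2) = u - s"
proof -
  have "integrable M (\<lambda>\<omega>. W j u \<omega> - W j s \<omega>) \<and> expectation (\<lambda>\<omega>. W j u \<omega> - W j s \<omega>) = 0 \<and>
    integrable M (\<lambda>\<omega>. (W j u \<omega> - W j s \<omega>)\<^sup>2) \<and> expectation (\<lambda>\<omega>. (W j u \<omega> - W j s \<omega>)\<^sup>2) = u - s"
  \<comment> \<open>Partitions may repeat points, so increments over intervals of length 0 have to
    be included; the defining normal law covers only s < u.\<close>
  proof (cases "s = u")
    case False
    then have "s < u" using assms by simp
    then have \<sigma>: "sqrt (u - s) > 0" by simp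
    note D = W_increment_distributed[OF assms(1) \<open>s < u\<close>, of j]
    have nn: "0 \<le> normal_density 0 (sqrt (u - s)) x" for x by (rule normal_density_nonneg)
    have "integrable M (\<lambda>\<omega>. W j u \<omega> - W j s \<omega>)"
      using integrable_normal_moment[OF \<sigma>, of 0 1]
      by (subst distributed_integrable[OF D, where g = "\<lambda>x. x", symmetric]) (auto simp: nn)
    moreover have "integrable M (\<lambda>\<omega>. (W j u \<omega> - W j s \<omega>)\<^sup>2)"
      using integrable_normal_moment[OF \<sigma>, of 0 2]
      by (subst distributed_integrable[OF D, where g = "\<lambda>x. x\<^sup>2", symmetric]) (auto simp: nn)
    moreover note normal_distributed_expectation[OF \<sigma> D] normal_distributed_variance[OF \<sigma> D]
    ultimately show ?thesis using \<open>s < u\<close> by simp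
  qed simp
  then show "integrable M (\<lambda>\<omega>. W j u \<omega> - W j s \<omega>)"
    and "expectation (\<lambda>\<omega>. W j u \<omega> - W j s \<omega>) = 0"
    and "integrable M (\<lambda>\<omega>. (W j u \<omega> - W j s \<omega>)\<^sup>2)"
    and "expectation (\<lambda>\<omega>. (W j u \<omega> - W j s \<omega>)\<^sup>2) = u - s"
    by blast+
qed

text \<open>The definition of Brownian motion states independence of \<sigma>-algebras; the one
  generated by \<xi> is contained in that of \<open>F s\<close>, which gives independence of random
  variables.\<close>

lemma indep_W_increment:
  assumes "0 \<le> s" "s < u" "\<xi> \<in> borel_measurable (F s)"
  shows "indep_var borel \<xi> borel (\<lambda>\<omega>. W j u \<omega> - W j s \<omega>)"
proof -
  let ?D = "\<lambda>\<omega>. W j u \<omega> - W j s \<omega>"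
  have [measurable]: "?D \<in> borel_measurable M" using assms by (intro borel_measurable_diff W_measurable) auto
  have "indep_set (sets (F s)) (sets (vimage_algebra (space M) ?D borel))"
    using BM[of j] assms by (simp add: brownian_motion_def)
  moreover have "{\<xi> -` A \<inter> space M |A. A \<in> sets borel} \<subseteq> sets (F s)"
    using measurable_sets[OF assms(3)] by auto
  then have "sigma_sets (space M) {\<xi> -` A \<inter> space M |A. A \<in> sets borel} \<subseteq> sets (F s)"
    using sets.sigma_sets_subset[of _ "F s"] by simp
  moreover have "sigma_sets (space M) {?D -` A \<inter> space M |A. A \<in> sets borel} = sets (vimage_algebra (space M) ?D borel)"
    by (simp add: sets_vimage_algebra)
  ultimately have "indep_set (sigma_sets (space M) {\<xi> -` A \<inter> space M |A. A \<in> sets borel})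
      (sigma_sets (space M) {?D -` A \<inter> space M |A. A \<in> sets borel})"
    unfolding indep_set_def by (elim indep_sets_mono_sets) (auto split: bool.split)
  then show ?thesis
    unfolding indep_var_eq using measurable_filt[OF assms(3)] by simp
qed

lemma expectation_mult_W_increment:
  assumes "0 \<le> s" "s \<le> u" "\<xi> \<in> borel_measurable (F s)" "integrable M \<xi>"
  shows "integrable M (\<lambda>\<omega>. \<xi> \<omega> * (W j u \<omega> - W j s \<omega>))"
    and "expectation (\<lambda>\<omega>. \<xi> \<omega> * (W j u \<omega> - W j s \<omega>)) = 0"
proof -
  have "integrable M (\<lambda>\<omega>. \<xi> \<omega> * (W j u \<omega> - W j s \<omega>)) \<and> expectation (\<lambda>\<omega>. \<xi> \<omega> * (W j u \<omega> - W j s \<omega>)) = 0"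
  proof (cases "s = u")
    case False
    then have "s < u" using assms(2) by simp
    note I = indep_W_increment[OF assms(1) this assms(3), of j]
    show ?thesis
      using indep_var_integrable[OF I assms(4)] indep_var_lebesgue_integral[OF I assms(4)]
        W_increment_moments[OF assms(1,2), of j] by simp
  qed simp
  then show "integrable M (\<lambda>\<omega>. \<xi> \<omega> * (W j u \<omega> - W j s \<omega>))"
    and "expectation (\<lambda>\<omega>. \<xi> \<omega> * (W j u \<omega> - W j s \<omega>)) = 0" by blast+
qed

text \<open>One half of the discrete Ito isometry: an increment is centred and independent of the
  past, so cross terms vanish and at most \<kappa>^2 times the total length remains. The conjuncts
  on measurability, time and integrability are what the induction needs in order to append one more
  interval.\<close>

lemma martingale_transform_L2:
  fixes \<xi> :: "nat \<Rightarrow> 'a \<Rightarrow> complex" and p :: "nat \<Rightarrow> real" and j :: 'l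
  assumes p: "0 \<le> p 0" "\<And>l. l < m \<Longrightarrow> p l \<le> p (Suc l)"
    and \<xi>: "\<And>l. l < m \<Longrightarrow> \<xi> l \<in> borel_measurable (F (p l))"
      "\<And>l \<omega>. l < m \<Longrightarrow> \<omega> \<in> space M \<Longrightarrow> norm (\<xi> l \<omega>) \<le> \<kappa>"
    and "0 \<le> \<kappa>"
  defines "T \<equiv> \<lambda>m \<omega>. \<Sum>l<m. \<xi> l \<omega> * (W j (p (Suc l)) \<omega> - W j (p l) \<omega>)"
  shows "T m \<in> borel_measurable (F (p m)) \<and> 0 \<le> p m \<and> integrable M (\<lambda>\<omega>. (norm (T m \<omega>))\<^sup>2) \<and>
    expectation (\<lambda>\<omega>. (norm (T m \<omega>))\<^sup>2) \<le> \<kappa>\<^sup>2 * (p m - p 0)"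
  using p(2) \<xi>
proof (induction m)
  case 0
  show ?case using p(1) by (simp add: T_def)
next
  case (Suc m)
  then have IH: "T m \<in> borel_measurable (F (p m))" "0 \<le> p m" "integrable M (\<lambda>\<omega>. (norm (T m \<omega>))\<^sup>2)"
    "expectation (\<lambda>\<omega>. (norm (T m \<omega>))\<^sup>2) \<le> \<kappa>\<^sup>2 * (p m - p 0)"
    by auto
  have pm: "p m \<le> p (Suc m)" and [measurable]: "\<xi> m \<in> borel_measurable (F (p m))" "T m \<in> borel_measurable (F (p m))"
    and \<kappa>: "\<And>\<omega>. \<omega> \<in> space M \<Longrightarrow> norm (\<xi> m \<omega>) \<le> \<kappa>"
    using Suc.prems IH by auto
  \<comment> \<open>The real part of cnj (T m) times \<xi> m: the cross term of |T m + \<xi> m *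
    D|^2 is 2 R D, and R is known at time \<open>p m\<close>.\<close>
  define R where "R \<omega> = Re (T m \<omega>) * Re (\<xi> m \<omega>) + Im (T m \<omega>) * Im (\<xi> m \<omega>)" for \<omega>
  have R: "R \<in> borel_measurable (F (p m))" unfolding R_def by measurable
  have [measurable]: "\<xi> m \<in> borel_measurable M" "T m \<in> borel_measurable M"
    by (auto intro: measurable_filt[of _ "p m"])
  define D where "D \<omega> = W j (p (Suc m)) \<omega> - W j (p m) \<omega>" for \<omega>
  have D: "integrable M (\<lambda>\<omega>. (D \<omega>)\<^sup>2)" "expectation (\<lambda>\<omega>. (D \<omega>)\<^sup>2) = p (Suc m) - p m"
    unfolding D_def using W_increment_moments[OF IH(2) pm] by auto
  have [measurable]: "D \<in> borel_measurable M"
    unfolding D_def using IH(2) pm by (intro borel_measurable_diff W_measurable) auto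
  have iR: "integrable M R"
  proof (rule Bochner_Integration.integrable_bound)
    show "integrable M (\<lambda>\<omega>. \<kappa> * ((norm (T m \<omega>))\<^sup>2 + 1))"
      using IH(3) by auto
    show "R \<in> borel_measurable M" by (rule measurable_filt[OF R])
    show "AE \<omega> in M. norm (R \<omega>) \<le> norm (\<kappa> * ((norm (T m \<omega>))\<^sup>2 + 1))"
    proof (intro AE_I2)
      fix \<omega> assume "\<omega> \<in> space M"
      \<comment> \<open>Only the square of \<open>T m\<close> is known to be integrable; x \<le> x^2
        + 1 makes its product with the bounded \<xi> integrable.\<close>
      have "0 \<le> (norm (T m \<omega>) - 1)\<^sup>2" by simp
      then have "norm (T m \<omega>) \<le> (norm (T m \<omega>))\<^sup>2 + 1"
        by (simp add: power2_diff) (smt (verit) norm_ge_zero)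
      have "norm (R \<omega>) \<le> norm (T m \<omega>) * norm (\<xi> m \<omega>)"
        using abs_Re_le_cmod[of "cnj (T m \<omega>) * \<xi> m \<omega>"] by (simp add: R_def norm_mult)
      also have "\<dots> \<le> ((norm (T m \<omega>))\<^sup>2 + 1) * \<kappa>"
        using \<kappa>[OF \<open>\<omega> \<in> space M\<close>] \<open>norm (T m \<omega>) \<le> (norm (T m \<omega>))\<^sup>2 + 1\<close> by (intro mult_mono) auto
      finally show "norm (R \<omega>) \<le> norm (\<kappa> * ((norm (T m \<omega>))\<^sup>2 + 1))"
        using \<open>0 \<le> \<kappa>\<close> by (simp add: mult.commute)
    qed
  qed
  note RD = expectation_mult_W_increment[OF IH(2) pm R iR, of j, folded D_def]
  have iX: "integrable M (\<lambda>\<omega>. (norm (\<xi> m \<omega>))\<^sup>2 * (D \<omega>)\<^sup>2)"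
  proof (rule Bochner_Integration.integrable_bound)
    show "integrable M (\<lambda>\<omega>. \<kappa>\<^sup>2 * (D \<omega>)\<^sup>2)" using D by auto
    show "AE \<omega> in M. norm ((norm (\<xi> m \<omega>))\<^sup>2 * (D \<omega>)\<^sup>2) \<le> norm (\<kappa>\<^sup>2 * (D \<omega>)\<^sup>2)"
      using \<kappa> by (intro AE_I2) (auto intro!: mult_right_mono power_mono)
  qed measurable
  have eX: "expectation (\<lambda>\<omega>. (norm (\<xi> m \<omega>))\<^sup>2 * (D \<omega>)\<^sup>2) \<le> \<kappa>\<^sup>2 * (p (Suc m) - p m)"
  proof -
    have "expectation (\<lambda>\<omega>. (norm (\<xi> m \<omega>))\<^sup>2 * (D \<omega>)\<^sup>2) \<le> expectation (\<lambda>\<omega>. \<kappa>\<^sup>2 * (D \<omega>)\<^sup>2)"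
      using iX D \<kappa> by (intro integral_mono) (auto intro!: mult_right_mono power_mono)
    then show ?thesis using D by simp
  qed
  have T: "T (Suc m) \<omega> = T m \<omega> + \<xi> m \<omega> * D \<omega>" for \<omega>
    by (simp add: T_def D_def)
  have sq: "(norm (T (Suc m) \<omega>))\<^sup>2 = (norm (T m \<omega>))\<^sup>2 + 2 * (R \<omega> * D \<omega>) + (norm (\<xi> m \<omega>))\<^sup>2 * (D \<omega>)\<^sup>2" for \<omega>
    unfolding T R_def cmod_power2 by (simp add: power2_eq_square algebra_simps)
  have "T (Suc m) \<in> borel_measurable (F (p (Suc m)))"
  proof -
    have [measurable]: "T m \<in> borel_measurable (F (p (Suc m)))" "\<xi> m \<in> borel_measurable (F (p (Suc m)))"
      "W j (p m) \<in> borel_measurable (F (p (Suc m)))" "W j (p (Suc m)) \<in> borel_measurable (F (p (Suc m)))"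
      using W_adapted pm IH(2) by (auto intro: measurable_filt_mono[OF _ pm])
    show ?thesis unfolding T D_def by measurable
  qed
  moreover have "integrable M (\<lambda>\<omega>. (norm (T (Suc m) \<omega>))\<^sup>2)"
    unfolding sq using IH(3) RD(1) iX by (intro Bochner_Integration.integrable_add integrable_mult_right) auto
  moreover have "expectation (\<lambda>\<omega>. (norm (T (Suc m) \<omega>))\<^sup>2) \<le> \<kappa>\<^sup>2 * (p (Suc m) - p 0)"
  proof -
    have "expectation (\<lambda>\<omega>. (norm (T (Suc m) \<omega>))\<^sup>2) =
      expectation (\<lambda>\<omega>. (norm (T m \<omega>))\<^sup>2) + 2 * expectation (\<lambda>\<omega>. R \<omega> * D \<omega>) + expectation (\<lambda>\<omega>. (norm (\<xi> m \<omega>))\<^sup>2 * (D \<omega>)\<^sup>2)"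
      unfolding sq using IH(3) RD(1) iX by simp
    then show ?thesis using RD(2) IH(4) eX by (simp add: algebra_simps)
  qed
  ultimately show ?case using pm IH(2) by auto
qed

text \<open>Chebyshev's inequality for the transform. The bound on \<xi> holds only off a small
  event, hence the truncation \<zeta>: it preserves adaptedness, makes the bound hold everywhere,
  and changes nothing on the good event.\<close>

lemma likely_martingale_transform:
  fixes \<xi> :: "nat \<Rightarrow> 'a \<Rightarrow> complex" and p :: "nat \<Rightarrow> real"
  assumes p: "p 0 = 0" "p m \<le> t" "\<And>l. l < m \<Longrightarrow> p l \<le> p (Suc l)"
    and \<xi>: "\<And>l. l < m \<Longrightarrow> \<xi> l \<in> borel_measurable (F (p l))"
      "likely \<eta>\<^sub>1 (\<lambda>\<omega>. \<forall>l<m. norm (\<xi> l \<omega>) \<le> \<kappa>)"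
    and "0 < \<kappa>" "0 < \<epsilon>" "\<kappa>\<^sup>2 * t \<le> \<epsilon>\<^sup>2 * \<eta>\<^sub>2"
  shows "likely (\<eta>\<^sub>1 + \<eta>\<^sub>2) (\<lambda>\<omega>. norm (\<Sum>l<m. \<xi> l \<omega> * (W j (p (Suc l)) \<omega> - W j (p l) \<omega>)) \<le> \<epsilon>)"
proof -
  define \<zeta> where "\<zeta> l \<omega> = (if norm (\<xi> l \<omega>) \<le> \<kappa> then \<xi> l \<omega> else 0)" for l \<omega>
  let ?T = "\<lambda>\<omega>. \<Sum>l<m. \<zeta> l \<omega> * (W j (p (Suc l)) \<omega> - W j (p l) \<omega>)"
  have "\<zeta> l \<in> borel_measurable (F (p l))" if "l < m" for l
  proof -
    have [measurable]: "\<xi> l \<in> borel_measurable (F (p l))" using \<xi> that by auto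
    show ?thesis unfolding \<zeta>_def by measurable
  qed
  then have T: "integrable M (\<lambda>\<omega>. (norm (?T \<omega>))\<^sup>2)" "expectation (\<lambda>\<omega>. (norm (?T \<omega>))\<^sup>2) \<le> \<kappa>\<^sup>2 * (p m - p 0)"
    using martingale_transform_L2[of p m \<zeta> \<kappa> j] p \<open>0 < \<kappa>\<close> by (auto simp: \<zeta>_def)
  have "\<kappa>\<^sup>2 * (p m - p 0) \<le> \<kappa>\<^sup>2 * t" using p by (intro mult_left_mono) auto
  then have "expectation (\<lambda>\<omega>. (norm (?T \<omega>))\<^sup>2) \<le> \<epsilon>\<^sup>2 * \<eta>\<^sub>2"
    using T(2) assms(8) by (meson order_trans)
  then have "likely \<eta>\<^sub>2 (\<lambda>\<omega>. (norm (?T \<omega>))\<^sup>2 \<le> \<epsilon>\<^sup>2)"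
    using T(1) \<open>0 < \<epsilon>\<close> by (intro likely_Markov) auto
  with \<xi>(2) have "likely (\<eta>\<^sub>1 + \<eta>\<^sub>2) (\<lambda>\<omega>. (\<forall>l<m. norm (\<xi> l \<omega>) \<le> \<kappa>) \<and> (norm (?T \<omega>))\<^sup>2 \<le> \<epsilon>\<^sup>2)"
    by (rule likely_conj)
  then show ?thesis
  proof (rule likely_mono)
    fix \<omega> assume *: "(\<forall>l<m. norm (\<xi> l \<omega>) \<le> \<kappa>) \<and> (norm (?T \<omega>))\<^sup>2 \<le> \<epsilon>\<^sup>2"
    have "?T \<omega> = (\<Sum>l<m. \<xi> l \<omega> * (W j (p (Suc l)) \<omega> - W j (p l) \<omega>))"
    proof (rule sum.cong[OF refl])
      fix l assume "l \<in> {..<m}"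
      then have "\<zeta> l \<omega> = \<xi> l \<omega>" using * by (simp add: \<zeta>_def)
      then show "\<zeta> l \<omega> * (W j (p (Suc l)) \<omega> - W j (p l) \<omega>) = \<xi> l \<omega> * (W j (p (Suc l)) \<omega> - W j (p l) \<omega>)"
        by simp
    qed
    moreover have "norm (?T \<omega>) \<le> \<epsilon>"
      using *[THEN conjunct2] by (rule power2_le_imp_le) (use \<open>0 < \<epsilon>\<close> in simp)
    ultimately show "norm (\<Sum>l<m. \<xi> l \<omega> * (W j (p (Suc l)) \<omega> - W j (p l) \<omega>)) \<le> \<epsilon>"
      by simp
  qed simp
qed

end

section \<open>Partitions and their refinements\<close>

text \<open>The summand 1 in the denominator of the witness spares the case C = 0.\<close>

lemma small_factor: "C \<ge> 0 \<Longrightarrow> \<epsilon> > 0 \<Longrightarrow> \<exists>\<kappa>>0. C * \<kappa> \<le> (\<epsilon>::real)"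
  by (intro exI[of _ "\<epsilon> / (C + 1)"]) (auto simp: field_simps)

lemma sum_mult_norm_le:
  fixes a b :: "nat \<Rightarrow> complex"
  assumes "(\<Sum>i<n. (norm (a i))\<^sup>2) \<le> r\<^sup>2" "(\<Sum>i<n. (norm (b i))\<^sup>2) \<le> s\<^sup>2" "0 \<le> r" "0 \<le> s"
  shows "(\<Sum>i<n. norm (a i) * norm (b i)) \<le> r * s"
proof -
  have "(\<Sum>i<n. norm (a i) * norm (b i)) \<le> L2_set (\<lambda>i. norm (a i)) {..<n} * L2_set (\<lambda>i. norm (b i)) {..<n}"
    using L2_set_mult_ineq[of "\<lambda>i. norm (a i)" "\<lambda>i. norm (b i)" "{..<n}"] by simp
  also have "\<dots> \<le> r * s"
    using assms by (intro mult_mono) (auto simp: L2_set_def real_le_lsqrt sum_nonneg)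
  finally show ?thesis .
qed

lemma sum_nat_blocks:
  fixes f :: "nat \<Rightarrow> 'b::comm_monoid_add"
  shows "(\<Sum>l<n * N. f l) = (\<Sum>i<n. \<Sum>r<N. f (i * N + r))"
proof -
  have "(\<Sum>r<N. f (i * N + r)) = sum f {i * N..<i * N + N}" for i
    by (rule sum.reindex_bij_witness[of _ "\<lambda>l. l - i * N" "\<lambda>r. i * N + r"]) auto
  then show ?thesis by (simp add: sum.nat_group)
qed

definition grid :: "real \<Rightarrow> nat \<Rightarrow> nat \<Rightarrow> real" where
  "grid t n i = t * real i / real n"

lemma grid_0 [simp]: "grid t n 0 = 0"
  by (simp add: grid_def)

lemma grid_self [simp]: "n > 0 \<Longrightarrow> grid t n n = t"
  by (simp add: grid_def)

lemma grid_nonneg [simp]: "t \<ge> 0 \<Longrightarrow> 0 \<le> grid t n i"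
  by (simp add: grid_def)

lemma grid_mono: "t \<ge> 0 \<Longrightarrow> i \<le> j \<Longrightarrow> grid t n i \<le> grid t n j"
  by (simp add: grid_def divide_right_mono mult_left_mono)

lemma grid_le [simp]: "t \<ge> 0 \<Longrightarrow> i \<le> n \<Longrightarrow> grid t n i \<le> t"
  by (cases "n = 0") (auto simp: grid_def pos_divide_le_eq mult_left_mono)

lemma grid_step: "grid t n (Suc i) - grid t n i = t / real n"
  by (simp add: grid_def diff_divide_distrib[symmetric] algebra_simps)

lemma grid_refine: "N > 0 \<Longrightarrow> grid t (n * N) (i * N) = grid t n i"
  by (simp add: grid_def)

lemma grid_refine_diff: "N > 0 \<Longrightarrow> r \<le> N \<Longrightarrow> t \<ge> 0 \<Longrightarrow> \<bar>grid t (n * N) (i * N + r) - grid t n i\<bar> \<le> t / real n"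
proof -
  assume "N > 0" "r \<le> N" "t \<ge> 0"
  have "grid t (n * N) (i * N + r) - grid t n i = t / real n * (real r / real N)"
    using \<open>N > 0\<close> by (simp add: grid_def add_divide_distrib distrib_left)
  moreover have "t / real n * (real r / real N) \<le> t / real n * 1"
    using \<open>N > 0\<close> \<open>r \<le> N\<close> \<open>t \<ge> 0\<close> by (intro mult_left_mono) auto
  moreover have "0 \<le> t / real n * (real r / real N)"
    using \<open>t \<ge> 0\<close> by simp
  ultimately show ?thesis by linarith
qed

text \<open>Intervals with index in \<open>R\<close> are cut into \<open>N\<close> pieces, the
  others are kept whole. To give every \<open>R\<close> the same \<open>n * N\<close> steps, a whole
  interval is crossed in the first step of its block, followed by \<open>N - 1\<close> steps of
  length 0, which \<open>is_partition\<close> permits.\<close>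

definition partial_refinement :: "real \<Rightarrow> nat \<Rightarrow> nat \<Rightarrow> nat set \<Rightarrow> nat \<Rightarrow> real" where
  "partial_refinement t n N R l =
     (if l div N \<in> R \<or> l mod N = 0 then grid t (n * N) l else grid t n (Suc (l div N)))"

lemma partial_refinement_fine:
  assumes "i \<in> R" "r \<le> N" "N > 0"
  shows "partial_refinement t n N R (i * N + r) = grid t (n * N) (i * N + r)"
  \<comment> \<open>The right end r = N is the start of the next block, where the value is the same
    whether or not that block is refined.\<close>
  using assms by (cases "r = N") (auto simp: partial_refinement_def)

lemma partial_refinement_start:
  "N > 0 \<Longrightarrow> partial_refinement t n N R (i * N) = grid t n i"
  by (auto simp: partial_refinement_def grid_refine)

lemma partial_refinement_coarse:
  assumes "i \<notin> R" "r \<le> N" "r > 0"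
  shows "partial_refinement t n N R (i * N + r) = grid t n (Suc i)"
proof (cases "r = N")
  case True
  then show ?thesis using partial_refinement_start[of N t n R "Suc i"] assms by (simp add: add.commute)
qed (use assms in \<open>auto simp: partial_refinement_def\<close>)

text \<open>The mesh bound t / n holds for all \<open>N\<close> and \<open>R\<close>, so one
  \<delta> from the definition of the integral serves every subset of intervals.\<close>

lemma partial_refinement_step:
  assumes "N > 0" "t \<ge> 0"
  shows "partial_refinement t n N R l \<le> partial_refinement t n N R (Suc l)"
    and "partial_refinement t n N R (Suc l) - partial_refinement t n N R l \<le> t / real n"
proof -
  define i r where "i = l div N" and "r = l mod N"
  have l: "l = i * N + r" and r: "r < N" using assms by (auto simp: i_def r_def)
  have "0 \<le> t / real n" using assms by simp
  have "t / real (n * N) \<le> t / real n"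
    using assms by (cases "n = 0") (auto simp: field_simps mult_le_cancel_left1)
  show "partial_refinement t n N R l \<le> partial_refinement t n N R (Suc l)"
    "partial_refinement t n N R (Suc l) - partial_refinement t n N R l \<le> t / real n"
  proof -
    consider "i \<in> R" | "i \<notin> R" "r = 0" | "i \<notin> R" "r > 0" by blast
    then have "partial_refinement t n N R l \<le> partial_refinement t n N R (Suc l) \<and>
      partial_refinement t n N R (Suc l) - partial_refinement t n N R l \<le> t / real n"
    proof cases
      case 1
      then show ?thesis
        using partial_refinement_fine[OF 1, of r N t n] partial_refinement_fine[OF 1, of "Suc r" N t n]
          grid_step[of t "n * N" l] grid_mono[of t l "Suc l" "n * N"] assms r
          \<open>t / real (n * N) \<le> t / real n\<close> l by simp
    next
      case 2
      then show ?thesis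
        using partial_refinement_start[of N t n R i] partial_refinement_coarse[of i R "Suc r" N t n]
          grid_step[of t n i] grid_mono[of t i "Suc i" n] assms r l by simp
    next
      case 3
      then show ?thesis
        using partial_refinement_coarse[of i R r N t n] partial_refinement_coarse[of i R "Suc r" N t n]
          assms r l \<open>0 \<le> t / real n\<close> by simp
    qed
    then show "partial_refinement t n N R l \<le> partial_refinement t n N R (Suc l)"
      "partial_refinement t n N R (Suc l) - partial_refinement t n N R l \<le> t / real n" by auto
  qed
qed

definition linear_driver ::
    "complex \<Rightarrow> ('l::finite \<Rightarrow> complex) \<Rightarrow> ('l \<Rightarrow> real \<Rightarrow> 'a \<Rightarrow> real) \<Rightarrow> real \<Rightarrow> 'a \<Rightarrow> complex" where
  "linear_driver \<alpha> \<beta> W s \<omega> = complex_of_real s * \<alpha> + (\<Sum>j\<in>UNIV. \<beta> j * complex_of_real (W j s \<omega>))"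

section \<open>Uniqueness for the scalar equation\<close>

locale scalar_linear_sde = brownian_filtration M F W
  for M :: "'a measure" and F :: "real \<Rightarrow> 'a measure" and W :: "'l::finite \<Rightarrow> real \<Rightarrow> 'a \<Rightarrow> real" +
  fixes \<alpha> :: complex and \<beta> :: "'l \<Rightarrow> complex" and Z :: "real \<Rightarrow> 'a \<Rightarrow> complex" and t :: real
  assumes Z_adapted: "\<And>s. s \<ge> 0 \<Longrightarrow> Z s \<in> borel_measurable (F s)"
    and Z_continuous: "AE \<omega> in M. continuous_on {0..} (\<lambda>s. Z s \<omega>)"
    and stratonovich: "\<And>s \<epsilon> \<eta>. 0 \<le> s \<Longrightarrow> 0 < \<epsilon> \<Longrightarrow> 0 < \<eta> \<Longrightarrow>
      \<exists>\<delta>>0. \<forall>n p. is_partition s n p \<and> (\<forall>i<n. p (Suc i) - p i < \<delta>) \<longrightarrow>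
        likely \<eta> (\<lambda>\<omega>. norm ((\<Sum>i<n. (Z (p i) \<omega> + Z (p (Suc i)) \<omega>) / 2 *
          (linear_driver \<alpha> \<beta> W (p (Suc i)) \<omega> - linear_driver \<alpha> \<beta> W (p i) \<omega>)) - (Z s \<omega> - Z 0 \<omega>)) \<le> \<epsilon>)"
    and t_pos: "0 < t"
begin

abbreviation H :: "real \<Rightarrow> 'a \<Rightarrow> complex" where
  "H \<equiv> linear_driver \<alpha> \<beta> W"

abbreviation g :: "nat \<Rightarrow> nat \<Rightarrow> real" where
  "g \<equiv> grid t"

definition dZ :: "nat \<Rightarrow> nat \<Rightarrow> 'a \<Rightarrow> complex" where
  "dZ n i \<omega> = Z (g n (Suc i)) \<omega> - Z (g n i) \<omega>"

definition dH :: "nat \<Rightarrow> nat \<Rightarrow> 'a \<Rightarrow> complex" where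
  "dH n i \<omega> = H (g n (Suc i)) \<omega> - H (g n i) \<omega>"

definition strat_term :: "nat \<Rightarrow> nat \<Rightarrow> 'a \<Rightarrow> complex" where
  "strat_term n i \<omega> = (Z (g n i) \<omega> + Z (g n (Suc i)) \<omega>) / 2 * dH n i \<omega>"

definition strat_error :: "nat \<Rightarrow> nat \<Rightarrow> 'a \<Rightarrow> complex" where
  "strat_error n i \<omega> = dZ n i \<omega> - strat_term n i \<omega>"

text \<open>Besides \<open>strat_error\<close> this contains the second order product
  \<open>dZ * dH / 2\<close>; hence only its square sum, not its sum, is expected to be
  small.\<close>

definition euler_error :: "nat \<Rightarrow> nat \<Rightarrow> 'a \<Rightarrow> complex" where
  "euler_error n i \<omega> = dZ n i \<omega> - Z (g n i) \<omega> * dH n i \<omega>"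

definition admissible_mesh :: "real \<Rightarrow> real \<Rightarrow> real \<Rightarrow> real \<Rightarrow> bool" where
  "admissible_mesh s \<epsilon> \<eta> \<delta> \<longleftrightarrow> (\<forall>n p. is_partition s n p \<and> (\<forall>i<n. p (Suc i) - p i < \<delta>) \<longrightarrow>
    likely \<eta> (\<lambda>\<omega>. norm ((\<Sum>i<n. (Z (p i) \<omega> + Z (p (Suc i)) \<omega>) / 2 * (H (p (Suc i)) \<omega> - H (p i) \<omega>)) - (Z s \<omega> - Z 0 \<omega>)) \<le> \<epsilon>))"

lemma admissible_meshE:
  assumes "0 \<le> s" "0 < \<epsilon>" "0 < \<eta>"
  obtains \<delta> where "\<delta> > 0" "admissible_mesh s \<epsilon> \<eta> \<delta>"
  using stratonovich[OF assms] unfolding admissible_mesh_def[symmetric] by (elim exE conjE)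

lemma admissible_meshD:
  assumes "admissible_mesh s \<epsilon> \<eta> \<delta>" "is_partition s n p" "\<forall>i<n. p (Suc i) - p i < \<delta>"
  shows "likely \<eta> (\<lambda>\<omega>. norm ((\<Sum>i<n. (Z (p i) \<omega> + Z (p (Suc i)) \<omega>) / 2 * (H (p (Suc i)) \<omega> - H (p i) \<omega>)) - (Z s \<omega> - Z 0 \<omega>)) \<le> \<epsilon>)"
  using assms(1)[unfolded admissible_mesh_def, THEN spec[of _ n], THEN spec[of _ p], THEN mp, OF conjI[OF assms(2,3)]] .

section \<open>Measurability and estimates uniform in the grid\<close>

lemma Z_measurable [measurable]: "s \<ge> 0 \<Longrightarrow> Z s \<in> borel_measurable M"
  by (rule measurable_filt[OF Z_adapted])

lemma H_adapted: "s \<ge> 0 \<Longrightarrow> H s \<in> borel_measurable (F s)"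
  unfolding linear_driver_def using W_adapted[measurable] by measurable

lemma H_measurable [measurable]: "s \<ge> 0 \<Longrightarrow> H s \<in> borel_measurable M"
  by (rule measurable_filt[OF H_adapted])

lemma H_continuous: "AE \<omega> in M. continuous_on {0..} (\<lambda>s. H s \<omega>)"
proof -
  have "AE \<omega> in M. \<forall>j\<in>UNIV. continuous_on {0..} (\<lambda>s. W j s \<omega>)"
    using BM by (intro AE_finite_allI) (auto simp: brownian_motion_def continuous_paths_def)
  then show ?thesis
    by eventually_elim (auto simp: linear_driver_def intro!: continuous_intros)
qed

lemma g_measurable [measurable]:
  "Z (g n i) \<in> borel_measurable M" "H (g n i) \<in> borel_measurable M"
  using t_pos by (auto intro!: Z_measurable H_measurable)

lemma increments_measurable [measurable]:
  "dZ n i \<in> borel_measurable M" "dH n i \<in> borel_measurable M"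
  "strat_term n i \<in> borel_measurable M" "strat_error n i \<in> borel_measurable M"
proof -
  show [measurable]: "dZ n i \<in> borel_measurable M" "dH n i \<in> borel_measurable M" for n i
    unfolding dZ_def dH_def by measurable
  show [measurable]: "strat_term n i \<in> borel_measurable M" for n i
    unfolding strat_term_def by measurable
  show "strat_error n i \<in> borel_measurable M"
    unfolding strat_error_def by measurable
qed

text \<open>The distance t / n itself is allowed, since neighbouring grid points attain it.\<close>

lemma likely_increments_small:
  fixes Y :: "real \<Rightarrow> 'a \<Rightarrow> complex"
  assumes "\<And>s. s \<ge> 0 \<Longrightarrow> Y s \<in> borel_measurable M" "AE \<omega> in M. continuous_on {0..} (\<lambda>s. Y s \<omega>)"
    and "\<kappa> > 0" "\<eta> > 0"
  shows "\<forall>\<^sub>F n in sequentially. likely \<eta> (\<lambda>\<omega>. \<forall>s\<in>{0..t}. \<forall>u\<in>{0..t}. \<bar>s - u\<bar> \<le> t / real n \<longrightarrow> norm (Y s \<omega> - Y u \<omega>) \<le> \<kappa>)"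
proof -
  obtain \<delta> where \<delta>: "\<delta> > 0"
    "likely \<eta> (\<lambda>\<omega>. \<forall>s\<in>{0..t}. \<forall>u\<in>{0..t}. \<bar>s - u\<bar> < \<delta> \<longrightarrow> dist (Y s \<omega>) (Y u \<omega>) \<le> \<kappa>)"
    using likely_uniformly_continuous[of Y \<kappa> \<eta> t] assms t_pos by auto
  have "(\<lambda>n. t / real n) \<longlonglongrightarrow> 0" by (rule lim_const_over_n)
  then have "\<forall>\<^sub>F n in sequentially. t / real n < \<delta>"
    using \<delta>(1) by (rule order_tendstoD)
  then show ?thesis
  proof eventually_elim
    fix n assume "t / real n < \<delta>"
    then show "likely \<eta> (\<lambda>\<omega>. \<forall>s\<in>{0..t}. \<forall>u\<in>{0..t}. \<bar>s - u\<bar> \<le> t / real n \<longrightarrow> norm (Y s \<omega> - Y u \<omega>) \<le> \<kappa>)"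
      by (intro likely_mono[OF \<delta>(2)]) (auto simp: dist_norm)
  qed
qed

text \<open>The expected sum of squares is t on every grid, so Markov's inequality gives a bound
  uniform in n; tightness is all that is asked of the quadratic variation.\<close>

lemma likely_W_quadratic_sum:
  assumes "\<eta> > 0" "n > 0"
  shows "likely \<eta> (\<lambda>\<omega>. (\<Sum>i<n. (W j (g n (Suc i)) \<omega> - W j (g n i) \<omega>)\<^sup>2) \<le> t / \<eta>)"
proof (rule likely_Markov)
  have le: "0 \<le> g n i" "g n i \<le> g n (Suc i)" for i
    using t_pos grid_mono[of t i "Suc i" n] by auto
  note mom = W_increment_moments[OF le, of j]
  show "integrable M (\<lambda>\<omega>. \<Sum>i<n. (W j (g n (Suc i)) \<omega> - W j (g n i) \<omega>)\<^sup>2)"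
    using mom by auto
  show "expectation (\<lambda>\<omega>. \<Sum>i<n. (W j (g n (Suc i)) \<omega> - W j (g n i) \<omega>)\<^sup>2) \<le> t / \<eta> * \<eta>"
    using mom assms by (simp add: grid_step)
qed (use assms t_pos in \<open>auto intro: sum_nonneg\<close>)

lemma likely_dH_quadratic_sum:
  assumes "\<eta> > 0"
  shows "\<exists>K>0. \<forall>n>0. likely \<eta> (\<lambda>\<omega>. (\<Sum>i<n. (norm (dH n i \<omega>))\<^sup>2) \<le> K\<^sup>2)"
proof -
  define c where "c = real CARD('l)"
  have c: "c > 0" by (simp add: c_def)
  \<comment> \<open>The drift summand comes from (a + b)^2 \<le> 2 a^2 + 2 b^2 and n (t/n)^2 \<le>
    t^2. In the other, the factor c is Cauchy-Schwarz over the drivers, and t / (\<eta>/c) is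
    Markov's bound at level \<eta>/c, so that the union over c Brownian motions costs
    \<eta>.\<close>
  define S where "S = 2 * (norm \<alpha>)\<^sup>2 * t\<^sup>2 + 2 * c * (\<Sum>j\<in>UNIV. (norm (\<beta> j))\<^sup>2 * (t / (\<eta> / c)))"
  have S0: "S \<ge> 0"
    unfolding S_def using c assms t_pos by (intro add_nonneg_nonneg mult_nonneg_nonneg sum_nonneg) auto
  have L: "likely \<eta> (\<lambda>\<omega>. (\<Sum>i<n. (norm (dH n i \<omega>))\<^sup>2) \<le> S)" if "n > 0" for n
  proof -
    have "likely (c * (\<eta> / c)) (\<lambda>\<omega>. \<forall>j\<in>UNIV. (\<Sum>i<n. (W j (g n (Suc i)) \<omega> - W j (g n i) \<omega>)\<^sup>2) \<le> t / (\<eta> / c))"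
      unfolding c_def using assms that
      by (intro likely_ball likely_W_quadratic_sum) auto
    then show ?thesis
    proof (rule likely_mono)
      fix \<omega> assume *: "\<forall>j\<in>UNIV. (\<Sum>i<n. (W j (g n (Suc i)) \<omega> - W j (g n i) \<omega>)\<^sup>2) \<le> t / (\<eta> / c)"
      let ?D = "\<lambda>j i. W j (g n (Suc i)) \<omega> - W j (g n i) \<omega>"
      have pt: "(norm (dH n i \<omega>))\<^sup>2 \<le> 2 * (norm \<alpha>)\<^sup>2 * (t / n)\<^sup>2 + 2 * c * (\<Sum>j\<in>UNIV. (norm (\<beta> j))\<^sup>2 * (?D j i)\<^sup>2)" for i
      proof -
        have "dH n i \<omega> = complex_of_real (g n (Suc i) - g n i) * \<alpha> + (\<Sum>j\<in>UNIV. \<beta> j * complex_of_real (?D j i))"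
          by (simp add: dH_def linear_driver_def algebra_simps sum_subtractf)
        then have "norm (dH n i \<omega>) \<le> norm \<alpha> * (t / n) + (\<Sum>j\<in>UNIV. norm (\<beta> j) * \<bar>?D j i\<bar>)"
          using t_pos unfolding grid_step
          by (auto intro!: norm_triangle_le add_mono sum_norm_le simp: norm_mult norm_divide mult.commute simp del: of_real_diff)
        then have "(norm (dH n i \<omega>))\<^sup>2 \<le> (norm \<alpha> * (t / n) + (\<Sum>j\<in>UNIV. norm (\<beta> j) * \<bar>?D j i\<bar>))\<^sup>2"
          by (intro power_mono) auto
        also have "\<dots> \<le> 2 * (norm \<alpha> * (t / n))\<^sup>2 + 2 * (\<Sum>j\<in>UNIV. norm (\<beta> j) * \<bar>?D j i\<bar>)\<^sup>2"
          using sum_squares_bound[of "norm \<alpha> * (t / n)" "\<Sum>j\<in>UNIV. norm (\<beta> j) * \<bar>?D j i\<bar>"]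
          by (simp add: power2_sum)
        also have "(\<Sum>j\<in>UNIV. norm (\<beta> j) * \<bar>?D j i\<bar>)\<^sup>2 \<le> (\<Sum>j\<in>UNIV. (norm (\<beta> j) * \<bar>?D j i\<bar>)\<^sup>2) * c"
          unfolding c_def by (rule sum_squared_le_sum_of_squares)
        finally show ?thesis by (simp add: power_mult_distrib power_divide algebra_simps)
      qed
      have swap: "(\<Sum>i<n. \<Sum>j\<in>UNIV. (norm (\<beta> j))\<^sup>2 * (?D j i)\<^sup>2) = (\<Sum>j\<in>UNIV. (norm (\<beta> j))\<^sup>2 * (\<Sum>i<n. (?D j i)\<^sup>2))"
        by (subst sum.swap) (simp add: sum_distrib_left)
      have "(\<Sum>i<n. (norm (dH n i \<omega>))\<^sup>2) \<le>
          (\<Sum>i<n. 2 * (norm \<alpha>)\<^sup>2 * (t / n)\<^sup>2 + 2 * c * (\<Sum>j\<in>UNIV. (norm (\<beta> j))\<^sup>2 * (?D j i)\<^sup>2))"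
        by (intro sum_mono pt)
      also have "\<dots> = 2 * (norm \<alpha>)\<^sup>2 * (real n * (t / n)\<^sup>2) +
          2 * c * (\<Sum>j\<in>UNIV. (norm (\<beta> j))\<^sup>2 * (\<Sum>i<n. (?D j i)\<^sup>2))"
        by (simp add: sum.distrib sum_distrib_left[symmetric] swap)
      also have "\<dots> \<le> S"
        unfolding S_def
      proof (intro add_mono mult_left_mono sum_mono)
        show "real n * (t / real n)\<^sup>2 \<le> t\<^sup>2"
        proof -
          have "real n * (t / real n)\<^sup>2 = t\<^sup>2 / real n"
            using \<open>n > 0\<close> by (simp add: power2_eq_square)
          also have "\<dots> \<le> t\<^sup>2 / 1" using \<open>n > 0\<close> by (intro divide_left_mono) auto
          finally show ?thesis by simp
        qed
      qed (use * c in auto)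
      finally show "(\<Sum>i<n. (norm (dH n i \<omega>))\<^sup>2) \<le> S" .
    qed (use c in simp)
  qed
  \<comment> \<open>Adding 1 keeps the root positive even if S = 0.\<close>
  have "likely \<eta> (\<lambda>\<omega>. (\<Sum>i<n. (norm (dH n i \<omega>))\<^sup>2) \<le> (sqrt (S + 1))\<^sup>2)" if "n > 0" for n
    using L[OF that] by (rule likely_mono) (use S0 in simp_all)
  moreover have "sqrt (S + 1) > 0" using S0 by simp
  ultimately show ?thesis by blast
qed

text \<open>The coarse level n is fixed while N grows, so only n + 1 end times occur; each receives
  the share \<eta> / (n + 1) and a union bound suffices.\<close>

lemma likely_fine_sums:
  assumes "\<epsilon> > 0" "\<eta> > 0" "n > 0"
  shows "\<forall>\<^sub>F N in sequentially. N > 0 \<and> likely \<eta> (\<lambda>\<omega>. \<forall>i\<in>{..n}.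
    norm ((\<Sum>l<i * N. strat_term (n * N) l \<omega>) - (Z (g n i) \<omega> - Z 0 \<omega>)) \<le> \<epsilon>)"
proof -
  have "\<forall>\<^sub>F N in sequentially. likely (\<eta> / (n + 1)) (\<lambda>\<omega>.
      norm ((\<Sum>l<i * N. strat_term (n * N) l \<omega>) - (Z (g n i) \<omega> - Z 0 \<omega>)) \<le> \<epsilon>)" for i
  proof -
    have "\<eta> / (n + 1) > 0" "0 \<le> g n i" using assms t_pos by auto
    obtain \<delta> where \<delta>: "\<delta> > 0" "admissible_mesh (g n i) \<epsilon> (\<eta> / (n + 1)) \<delta>"
      by (rule admissible_meshE[OF \<open>0 \<le> g n i\<close> assms(1) \<open>\<eta> / (n + 1) > 0\<close>])
    have "(\<lambda>N. t / real N) \<longlonglongrightarrow> 0" by (rule lim_const_over_n)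
    then have "\<forall>\<^sub>F N in sequentially. t / real N < \<delta>"
      using \<delta>(1) by (rule order_tendstoD)
    then show ?thesis
      using eventually_gt_at_top[of 0]
    proof eventually_elim
      fix N :: nat assume N: "t / real N < \<delta>" "N > 0"
      have "t / real (n * N) \<le> t / real N"
        using assms(3) N(2) t_pos by (auto simp: field_simps mult_le_cancel_left1)
      then have "\<forall>l<i * N. g (n * N) (Suc l) - g (n * N) l < \<delta>"
        using N(1) by (simp add: grid_step)
      moreover have "is_partition (g n i) (i * N) (g (n * N))"
        using N(2) t_pos by (auto simp: is_partition_def grid_refine intro: grid_mono)
      ultimately show "likely (\<eta> / (n + 1)) (\<lambda>\<omega>.
          norm ((\<Sum>l<i * N. strat_term (n * N) l \<omega>) - (Z (g n i) \<omega> - Z 0 \<omega>)) \<le> \<epsilon>)"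
        unfolding strat_term_def dH_def by (intro admissible_meshD[OF \<delta>(2)])
    qed
  qed
  then have "\<forall>\<^sub>F N in sequentially. \<forall>i\<in>{..n}. likely (\<eta> / (n + 1)) (\<lambda>\<omega>.
      norm ((\<Sum>l<i * N. strat_term (n * N) l \<omega>) - (Z (g n i) \<omega> - Z 0 \<omega>)) \<le> \<epsilon>)"
    by (intro eventually_ball_finite) auto
  then show ?thesis
    using eventually_gt_at_top[of 0]
  proof eventually_elim
    fix N :: nat
    assume *: "\<forall>i\<in>{..n}. likely (\<eta> / (n + 1)) (\<lambda>\<omega>.
      norm ((\<Sum>l<i * N. strat_term (n * N) l \<omega>) - (Z (g n i) \<omega> - Z 0 \<omega>)) \<le> \<epsilon>)" and "0 < N"
    have "likely (real (card {..n}) * (\<eta> / (n + 1))) (\<lambda>\<omega>. \<forall>i\<in>{..n}.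
        norm ((\<Sum>l<i * N. strat_term (n * N) l \<omega>) - (Z (g n i) \<omega> - Z 0 \<omega>)) \<le> \<epsilon>)"
      by (rule likely_ball) (use * in auto)
    then have "likely \<eta> (\<lambda>\<omega>. \<forall>i\<in>{..n}.
        norm ((\<Sum>l<i * N. strat_term (n * N) l \<omega>) - (Z (g n i) \<omega> - Z 0 \<omega>)) \<le> \<epsilon>)"
      by (rule likely_mono) (auto simp: field_simps)
    then show "0 < N \<and> likely \<eta> (\<lambda>\<omega>. \<forall>i\<in>{..n}.
        norm ((\<Sum>l<i * N. strat_term (n * N) l \<omega>) - (Z (g n i) \<omega> - Z 0 \<omega>)) \<le> \<epsilon>)"
      using \<open>0 < N\<close> by blast
  qed
qed

text \<open>A block is the difference of two initial segments, each with error at most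
  \<epsilon>.\<close>

lemma norm_block_error:
  assumes "\<forall>i\<in>{..n}. norm ((\<Sum>l<i * N. strat_term (n * N) l \<omega>) - (Z (g n i) \<omega> - Z 0 \<omega>)) \<le> \<epsilon>" "i < n"
  shows "norm ((\<Sum>r<N. strat_term (n * N) (i * N + r) \<omega>) - dZ n i \<omega>) \<le> 2 * \<epsilon>"
proof -
  let ?S = "\<lambda>i. (\<Sum>l<i * N. strat_term (n * N) l \<omega>) - (Z (g n i) \<omega> - Z 0 \<omega>)"
  have "(\<Sum>r<N. strat_term (n * N) (i * N + r) \<omega>) - dZ n i \<omega> = ?S (Suc i) - ?S i"
    unfolding sum_nat_blocks by (simp add: dZ_def)
  also have "norm \<dots> \<le> norm (?S (Suc i)) + norm (?S i)"
    by (rule norm_triangle_ineq4)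
  also have "\<dots> \<le> \<epsilon> + \<epsilon>"
    by (intro add_mono bspec[OF assms(1)]) (use assms(2) in auto)
  finally show ?thesis by simp
qed

text \<open>The intervals outside \<open>G\<close> are subdivided so finely that their Stratonovich
  sums equal the increments of \<open>Z\<close> up to a negligible error. The sum over this mixed
  partition still approximates Z t - Z 0, and subtracting leaves exactly the errors on
  \<open>G\<close>. As the mesh bound involves only n, the threshold for n is the same for all
  \<open>G\<close>.\<close>

lemma likely_subset_strat_errors:
  assumes "\<epsilon> > 0" "\<eta> > 0"
  shows "\<forall>\<^sub>F n in sequentially. \<forall>G\<subseteq>{..<n}. likely \<eta> (\<lambda>\<omega>. norm (\<Sum>i\<in>G. strat_error n i \<omega>) \<le> \<epsilon>)"
proof -
  have "0 \<le> t" "\<eta> / 2 > 0" using assms t_pos by auto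
  obtain \<delta> where \<delta>: "\<delta> > 0" "admissible_mesh t (\<epsilon> / 3) (\<eta> / 2) \<delta>"
    by (rule admissible_meshE[of t "\<epsilon> / 3" "\<eta> / 2"]) (use assms t_pos in auto)
  have "(\<lambda>n. t / real n) \<longlonglongrightarrow> 0" by (rule lim_const_over_n)
  then have "\<forall>\<^sub>F n in sequentially. t / real n < \<delta>"
    using \<delta>(1) by (rule order_tendstoD)
  then show ?thesis
    using eventually_gt_at_top[of 0]
  proof (eventually_elim, intro allI impI)
    fix n :: nat and G assume n: "t / real n < \<delta>" "n > 0" and G: "G \<subseteq> {..<n}"
    \<comment> \<open>The refined blocks contribute at most n * 2 \<epsilon> / (3 n) = 2 \<epsilon>
      / 3; the remaining third is for the sum over the mixed partition.\<close>
    have "\<epsilon> / (3 * n) > 0" using assms n by simp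
    from eventually_happens'[OF sequentially_bot likely_fine_sums[OF this \<open>\<eta> / 2 > 0\<close> n(2)]]
    obtain N where N: "N > 0" "likely (\<eta> / 2) (\<lambda>\<omega>. \<forall>i\<in>{..n}.
        norm ((\<Sum>l<i * N. strat_term (n * N) l \<omega>) - (Z (g n i) \<omega> - Z 0 \<omega>)) \<le> \<epsilon> / (3 * n))"
      by blast
    define R where "R = {..<n} - G"
    define q where "q = partial_refinement t n N R"
    let ?f = "\<lambda>\<omega> l. (Z (q l) \<omega> + Z (q (Suc l)) \<omega>) / 2 * (H (q (Suc l)) \<omega> - H (q l) \<omega>)"
    have "is_partition t (n * N) q"
      unfolding is_partition_def q_def
      using partial_refinement_start[of N t n R 0] partial_refinement_start[of N t n R n] N(1) n(2)
        partial_refinement_step(1)[OF N(1) \<open>0 \<le> t\<close>] by auto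
    moreover have "\<forall>l<n * N. q (Suc l) - q l < \<delta>"
      unfolding q_def using partial_refinement_step(2)[OF N(1) \<open>0 \<le> t\<close>] n(1) by (meson order.strict_trans1)
    ultimately have "likely (\<eta> / 2) (\<lambda>\<omega>. norm ((\<Sum>l<n * N. ?f \<omega> l) - (Z t \<omega> - Z 0 \<omega>)) \<le> \<epsilon> / 3)"
      by (rule admissible_meshD[OF \<delta>(2)])
    from likely_conj[OF this N(2)]
    show "likely \<eta> (\<lambda>\<omega>. norm (\<Sum>i\<in>G. strat_error n i \<omega>) \<le> \<epsilon>)"
    proof (rule likely_mono)
      fix \<omega>
      assume "norm ((\<Sum>l<n * N. ?f \<omega> l) - (Z t \<omega> - Z 0 \<omega>)) \<le> \<epsilon> / 3 \<and> (\<forall>i\<in>{..n}.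
        norm ((\<Sum>l<i * N. strat_term (n * N) l \<omega>) - (Z (g n i) \<omega> - Z 0 \<omega>)) \<le> \<epsilon> / (3 * n))"
      then have 1: "norm ((\<Sum>l<n * N. ?f \<omega> l) - (Z t \<omega> - Z 0 \<omega>)) \<le> \<epsilon> / 3"
        and 2: "\<And>i. i < n \<Longrightarrow> norm ((\<Sum>r<N. strat_term (n * N) (i * N + r) \<omega>) - dZ n i \<omega>) \<le> 2 * (\<epsilon> / (3 * n))"
        using norm_block_error by blast+
      have fine: "(\<Sum>r<N. ?f \<omega> (i * N + r)) = (\<Sum>r<N. strat_term (n * N) (i * N + r) \<omega>)" if "i \<in> R" for i
      proof (rule sum.cong[OF refl])
        fix r assume "r \<in> {..<N}"
        then show "?f \<omega> (i * N + r) = strat_term (n * N) (i * N + r) \<omega>"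
          using partial_refinement_fine[OF that, of r N t n] partial_refinement_fine[OF that, of "Suc r" N t n] N(1)
          by (simp add: q_def strat_term_def dH_def)
      qed
      have coarse: "(\<Sum>r<N. ?f \<omega> (i * N + r)) = strat_term n i \<omega>" if "i \<notin> R" for i
      proof -
        \<comment> \<open>In an unrefined block only the first step moves; later terms vanish with
          their increments of \<open>H\<close>.\<close>
        have "(\<Sum>r<N. ?f \<omega> (i * N + r)) = (\<Sum>r<N. if r = 0 then strat_term n i \<omega> else 0)"
        proof (rule sum.cong[OF refl])
          fix r assume "r \<in> {..<N}"
          then show "?f \<omega> (i * N + r) = (if r = 0 then strat_term n i \<omega> else 0)"
            using partial_refinement_coarse[OF that, of r N t n] partial_refinement_coarse[OF that, of "Suc r" N t n]
              partial_refinement_start[OF N(1), of t n R i]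
            by (auto simp: q_def strat_term_def dH_def)
        qed
        then show ?thesis using N(1) by simp
      qed
      have tel: "(\<Sum>i<n. dZ n i \<omega>) = Z t \<omega> - Z 0 \<omega>"
        using sum_lessThan_telescope[of "\<lambda>i. Z (g n i) \<omega>" n] n(2) by (simp add: dZ_def)
      have split: "sum f {..<n} = sum f G + sum f R" for f :: "nat \<Rightarrow> complex"
        unfolding R_def using sum.subset_diff[OF G, of f] by (simp add: add.commute)
      have "(\<Sum>l<n * N. ?f \<omega> l) - (Z t \<omega> - Z 0 \<omega>) =
          (\<Sum>i\<in>G. strat_term n i \<omega> - dZ n i \<omega>) + (\<Sum>i\<in>R. (\<Sum>r<N. strat_term (n * N) (i * N + r) \<omega>) - dZ n i \<omega>)"
        unfolding sum_nat_blocks tel[symmetric] split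
        using fine coarse G by (auto simp: sum_subtractf R_def intro!: arg_cong2[where f = "(+)"] sum.cong)
      then have "(\<Sum>i\<in>G. strat_error n i \<omega>) =
          (\<Sum>i\<in>R. (\<Sum>r<N. strat_term (n * N) (i * N + r) \<omega>) - dZ n i \<omega>) - ((\<Sum>l<n * N. ?f \<omega> l) - (Z t \<omega> - Z 0 \<omega>))"
        by (simp add: strat_error_def sum_subtractf)
      then have "norm (\<Sum>i\<in>G. strat_error n i \<omega>) \<le> norm (\<Sum>i\<in>R. (\<Sum>r<N. strat_term (n * N) (i * N + r) \<omega>) - dZ n i \<omega>) +
          norm ((\<Sum>l<n * N. ?f \<omega> l) - (Z t \<omega> - Z 0 \<omega>))"
        by (simp only: norm_triangle_ineq4)
      moreover have "norm (\<Sum>i\<in>R. (\<Sum>r<N. strat_term (n * N) (i * N + r) \<omega>) - dZ n i \<omega>) \<le> real (card R) * (2 * (\<epsilon> / (3 * n)))"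
        by (rule sum_norm_bound) (use 2 in \<open>auto simp: R_def\<close>)
      moreover have "real (card R) * (2 * (\<epsilon> / (3 * n))) \<le> real n * (2 * (\<epsilon> / (3 * n)))"
        using assms card_mono[of "{..<n}" R] by (intro mult_right_mono) (auto simp: R_def)
      moreover have "real n * (2 * (\<epsilon> / (3 * n))) = 2 * (\<epsilon> / 3)" using n(2) by simp
      ultimately show "norm (\<Sum>i\<in>G. strat_error n i \<omega>) \<le> \<epsilon>" using 1 by linarith
    qed simp
  qed
qed

lemma likely_strat_errors_small:
  assumes "\<theta> > 0" "\<eta> > 0"
  shows "\<forall>\<^sub>F n in sequentially. likely \<eta> (\<lambda>\<omega>. (\<Sum>i<n. (norm (strat_error n i \<omega>))\<^sup>2) \<le> \<theta>\<^sup>2)"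
proof -
  \<comment> \<open>8 (\<theta>/3)^2 = 8/9 \<theta>^2, and the passage from subset sums to square
    sums multiplies the probability by 24.\<close>
  have "\<theta> / 3 > 0" "\<eta> / 24 > 0" using assms by auto
  from likely_subset_strat_errors[OF this] show ?thesis
  proof eventually_elim
    fix n assume *: "\<forall>G\<subseteq>{..<n}. likely (\<eta> / 24) (\<lambda>\<omega>. norm (\<Sum>i\<in>G. strat_error n i \<omega>) \<le> \<theta> / 3)"
    have "likely (24 * (\<eta> / 24)) (\<lambda>\<omega>. (\<Sum>i<n. (norm (strat_error n i \<omega>))\<^sup>2) \<le> 8 * (\<theta> / 3)\<^sup>2)"
      by (rule likely_sum_norm2) (use * assms in auto)
    then show "likely \<eta> (\<lambda>\<omega>. (\<Sum>i<n. (norm (strat_error n i \<omega>))\<^sup>2) \<le> \<theta>\<^sup>2)"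
      by (rule likely_mono) (use zero_le_power2[of \<theta>] in \<open>simp_all add: power_divide, linarith\<close>)
  qed
qed

end

section \<open>Elementary estimates for the complex exponential\<close>

lemma norm_exp_minus_1_le:
  assumes "norm (h::complex) \<le> 1"
  shows "norm (exp (- h) - 1) \<le> 3 * norm h"
proof -
  have "\<bar>Re (- h)\<bar> \<le> 1" using abs_Re_le_cmod[of h] assms by simp
  then have "exp \<bar>Re (- h)\<bar> \<le> 3" using exp_le by (meson exp_le_cancel_iff order_trans)
  moreover have "norm (exp (- h) - 1) \<le> exp \<bar>Re (- h)\<bar> * norm h"
    using Taylor_exp[of "- h" 0] by simp
  ultimately show ?thesis
    by (meson mult_right_mono norm_ge_zero order_trans)
qed

text \<open>The trapezoidal rule for y' = - y is exact through second order: \<open>?a\<close> and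
  \<open>?b\<close> are the Taylor remainders after the quadratic and the linear term, and the
  quadratic terms of \<open>?a\<close> and \<open>?b * (h / 2)\<close> cancel. The bound |h| \<le> 1
  replaces the exponential factor of the remainders by 3.\<close>

lemma norm_exp_trapezoid_le:
  assumes "norm (h::complex) \<le> 1"
  shows "norm (exp (- h) - 1 + (1 + exp (- h)) / 2 * h) \<le> 3 * norm h ^ 3"
proof -
  have "\<bar>Re (- h)\<bar> \<le> 1" using abs_Re_le_cmod[of h] assms by simp
  then have e3: "exp \<bar>Re (- h)\<bar> \<le> 3" using exp_le by (meson exp_le_cancel_iff order_trans)
  let ?a = "exp (- h) - (1 - h + h\<^sup>2 / 2)" and ?b = "exp (- h) - (1 - h)"
  have "norm ?a \<le> exp \<bar>Re (- h)\<bar> * (norm h ^ 3 / 2)"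
    using Taylor_exp[of "- h" 2] by (simp add: atMost_nat_numeral algebra_simps power3_eq_cube power2_eq_square)
  also have "\<dots> \<le> 3 * (norm h ^ 3 / 2)" using e3 by (intro mult_right_mono) auto
  finally have a: "norm ?a \<le> 3 * (norm h ^ 3 / 2)" .
  have "norm ?b \<le> exp \<bar>Re (- h)\<bar> * (norm h)\<^sup>2"
    using Taylor_exp[of "- h" 1] by (simp add: algebra_simps power2_eq_square)
  also have "\<dots> \<le> 3 * (norm h)\<^sup>2" using e3 by (intro mult_right_mono) auto
  finally have b: "norm ?b \<le> 3 * (norm h)\<^sup>2" .
  have "exp (- h) - 1 + (1 + exp (- h)) / 2 * h = ?a + ?b * (h / 2)"
    by (simp add: field_simps power2_eq_square)
  also have "norm \<dots> \<le> norm ?a + norm ?b * (norm h / 2)"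
    by (rule order_trans[OF norm_triangle_ineq]) (simp add: norm_mult norm_divide)
  also have "\<dots> \<le> 3 * (norm h ^ 3 / 2) + 3 * (norm h)\<^sup>2 * (norm h / 2)"
    using a b by (intro add_mono mult_right_mono) auto
  finally show ?thesis by (simp add: power3_eq_cube power2_eq_square)
qed

lemma norm_sum_le_const:
  fixes f :: "nat \<Rightarrow> complex"
  assumes "\<And>i. i < n \<Longrightarrow> norm (f i) \<le> b i" "sum b {..<n} \<le> c"
  shows "norm (sum f {..<n}) \<le> c"
proof -
  have "norm (sum f {..<n}) \<le> sum b {..<n}"
    by (rule sum_norm_le) (use assms(1) in auto)
  then show ?thesis using assms(2) by linarith
qed

section \<open>Euler errors, the integrating factor, and cancellation in the weighted error
  sum\<close>

context scalar_linear_sde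
begin

lemma likely_Z_increments_small:
  assumes "\<kappa> > 0" "\<eta> > 0"
  shows "\<forall>\<^sub>F n in sequentially. likely \<eta> (\<lambda>\<omega>. \<forall>s\<in>{0..t}. \<forall>u\<in>{0..t}. \<bar>s - u\<bar> \<le> t / real n \<longrightarrow> norm (Z s \<omega> - Z u \<omega>) \<le> \<kappa>)"
  by (rule likely_increments_small[OF Z_measurable Z_continuous assms])

lemma likely_H_increments_small:
  assumes "\<kappa> > 0" "\<eta> > 0"
  shows "\<forall>\<^sub>F n in sequentially. likely \<eta> (\<lambda>\<omega>. \<forall>s\<in>{0..t}. \<forall>u\<in>{0..t}. \<bar>s - u\<bar> \<le> t / real n \<longrightarrow> norm (H s \<omega> - H u \<omega>) \<le> \<kappa>)"
  by (rule likely_increments_small[OF H_measurable H_continuous assms])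

text \<open>The difference to \<open>strat_error\<close> is dZ dH / 2: one factor is uniformly small
  by path continuity, the other has a bounded square sum.\<close>

lemma likely_euler_errors_small:
  assumes "\<theta> > 0" "\<eta> > 0"
  shows "\<forall>\<^sub>F n in sequentially. likely \<eta> (\<lambda>\<omega>. (\<Sum>i<n. (norm (euler_error n i \<omega>))\<^sup>2) \<le> \<theta>\<^sup>2)"
proof -
  have \<eta>3: "\<eta> / 3 > 0" and \<theta>2: "\<theta> / 2 > 0" using assms by auto
  obtain K where K: "K > 0" "\<And>n. n > 0 \<Longrightarrow> likely (\<eta> / 3) (\<lambda>\<omega>. (\<Sum>i<n. (norm (dH n i \<omega>))\<^sup>2) \<le> K\<^sup>2)"
    using likely_dH_quadratic_sum[OF \<eta>3] by blast
  obtain \<kappa> where \<kappa>: "\<kappa> > 0" "K * \<kappa> \<le> \<theta>"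
    using small_factor[of K \<theta>] K(1) assms(1) by auto
  show ?thesis
    using likely_strat_errors_small[OF \<theta>2 \<eta>3]
      likely_Z_increments_small[OF \<kappa>(1) \<eta>3]
      eventually_gt_at_top[of 0]
  proof eventually_elim
    fix n :: nat
    assume E: "likely (\<eta> / 3) (\<lambda>\<omega>. (\<Sum>i<n. (norm (strat_error n i \<omega>))\<^sup>2) \<le> (\<theta> / 2)\<^sup>2)"
      and Z: "likely (\<eta> / 3) (\<lambda>\<omega>. \<forall>s\<in>{0..t}. \<forall>u\<in>{0..t}. \<bar>s - u\<bar> \<le> t / real n \<longrightarrow> norm (Z s \<omega> - Z u \<omega>) \<le> \<kappa>)"
      and "0 < n"
    from likely_conj[OF E likely_conj[OF Z K(2)[OF \<open>0 < n\<close>]]]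
    show "likely \<eta> (\<lambda>\<omega>. (\<Sum>i<n. (norm (euler_error n i \<omega>))\<^sup>2) \<le> \<theta>\<^sup>2)"
    proof (rule likely_mono, elim conjE)
      fix \<omega>
      assume E: "(\<Sum>i<n. (norm (strat_error n i \<omega>))\<^sup>2) \<le> (\<theta> / 2)\<^sup>2"
        and Z: "\<forall>s\<in>{0..t}. \<forall>u\<in>{0..t}. \<bar>s - u\<bar> \<le> t / real n \<longrightarrow> norm (Z s \<omega> - Z u \<omega>) \<le> \<kappa>"
        and H: "(\<Sum>i<n. (norm (dH n i \<omega>))\<^sup>2) \<le> K\<^sup>2"
      have pt: "(norm (euler_error n i \<omega>))\<^sup>2 \<le> 2 * (norm (strat_error n i \<omega>))\<^sup>2 + \<kappa>\<^sup>2 / 2 * (norm (dH n i \<omega>))\<^sup>2" if "i < n" for i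
      proof -
        have "norm (dZ n i \<omega>) \<le> \<kappa>"
          unfolding dZ_def using Z[THEN bspec[of _ _ "g n (Suc i)"], THEN bspec[of _ _ "g n i"]] that t_pos
          by (simp add: grid_step)
        moreover have "euler_error n i \<omega> = strat_error n i \<omega> + dZ n i \<omega> / 2 * dH n i \<omega>"
          by (simp add: euler_error_def strat_error_def strat_term_def dZ_def field_simps)
        ultimately have "norm (euler_error n i \<omega>) \<le> norm (strat_error n i \<omega>) + \<kappa> / 2 * norm (dH n i \<omega>)"
          by (auto intro!: norm_triangle_le add_mono mult_right_mono simp: norm_mult norm_divide)
        then have "(norm (euler_error n i \<omega>))\<^sup>2 \<le> (norm (strat_error n i \<omega>) + \<kappa> / 2 * norm (dH n i \<omega>))\<^sup>2"
          by (intro power_mono) auto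
        also have "\<dots> \<le> 2 * (norm (strat_error n i \<omega>))\<^sup>2 + 2 * (\<kappa> / 2 * norm (dH n i \<omega>))\<^sup>2"
          using sum_squares_bound[of "norm (strat_error n i \<omega>)" "\<kappa> / 2 * norm (dH n i \<omega>)"]
          by (simp add: power2_sum)
        finally show ?thesis by (simp add: power_mult_distrib power_divide)
      qed
      have "(\<Sum>i<n. (norm (euler_error n i \<omega>))\<^sup>2) \<le>
          (\<Sum>i<n. 2 * (norm (strat_error n i \<omega>))\<^sup>2 + \<kappa>\<^sup>2 / 2 * (norm (dH n i \<omega>))\<^sup>2)"
        by (intro sum_mono pt) simp
      also have "\<dots> = 2 * (\<Sum>i<n. (norm (strat_error n i \<omega>))\<^sup>2) + \<kappa>\<^sup>2 / 2 * (\<Sum>i<n. (norm (dH n i \<omega>))\<^sup>2)"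
        by (simp only: sum.distrib sum_distrib_left)
      also have "\<dots> \<le> 2 * (\<theta> / 2)\<^sup>2 + \<kappa>\<^sup>2 / 2 * K\<^sup>2"
        using E H by (intro add_mono mult_left_mono) auto
      also have "\<dots> = \<theta>\<^sup>2 / 2 + (K * \<kappa>)\<^sup>2 / 2"
        by (simp add: power_divide power_mult_distrib)
      also have "\<dots> \<le> \<theta>\<^sup>2 / 2 + \<theta>\<^sup>2 / 2"
        using \<kappa> K assms by (intro add_mono divide_right_mono power_mono) auto
      finally show "(\<Sum>i<n. (norm (euler_error n i \<omega>))\<^sup>2) \<le> \<theta>\<^sup>2" by simp
    qed simp
  qed
qed

text \<open>The integrating factor: \<open>Z * U\<close> is the quantity shown to be
  constant.\<close>

definition U :: "real \<Rightarrow> 'a \<Rightarrow> complex" where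
  "U s \<omega> = exp (- H s \<omega>)"

lemma U_adapted: "s \<ge> 0 \<Longrightarrow> U s \<in> borel_measurable (F s)"
  unfolding U_def using H_adapted[measurable] by measurable

lemma U_measurable [measurable]: "s \<ge> 0 \<Longrightarrow> U s \<in> borel_measurable M"
  by (rule measurable_filt[OF U_adapted])

lemma U_continuous: "AE \<omega> in M. continuous_on {0..} (\<lambda>s. U s \<omega>)"
  using H_continuous by eventually_elim (auto simp: U_def intro!: continuous_intros)

text \<open>For the fine step l: the increment of \<open>Z\<close> since the start of the
  surrounding coarse block minus its first order prediction, weighted by the integrating factor at
  that start. Evaluated no later than the left end of the step, it is adapted; built from increments
  within one block, it is small.\<close>

definition transform_integrand :: "nat \<Rightarrow> nat \<Rightarrow> nat \<Rightarrow> 'a \<Rightarrow> complex" where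
  "transform_integrand n N l \<omega> =
     U (g n (l div N)) \<omega> * ((Z (g (n * N) l) \<omega> - Z (g n (l div N)) \<omega>) -
       Z (g n (l div N)) \<omega> * (H (g (n * N) l) \<omega> - H (g n (l div N)) \<omega>))"

text \<open>
  Up to terms that are small in absolute value, the two levels of the partition differ by a
  sum with the small adapted integrand \<open>transform_integrand\<close>, because
  \<open>(\<Sum>r. h r)\<^sup>2 = \<Sum>r. (h r)\<^sup>2 + 2 * (\<Sum>q<r. h q) * h r\<close>.
\<close>

lemma block_error_expansion:
  assumes "N > 0"
  shows "U (g n i) \<omega> * ((\<Sum>r<N. strat_term (n * N) (i * N + r) \<omega>) - strat_term n i \<omega>) =
    (\<Sum>r<N. transform_integrand n N (i * N + r) \<omega> * dH (n * N) (i * N + r) \<omega>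
      + U (g n i) \<omega> * ((Z (g (n * N) (i * N + r)) \<omega> - Z (g n i) \<omega>) / 2 * (dH (n * N) (i * N + r) \<omega>)\<^sup>2)
      + U (g n i) \<omega> * (euler_error (n * N) (i * N + r) \<omega> / 2 * dH (n * N) (i * N + r) \<omega>))
    - U (g n i) \<omega> * (euler_error n i \<omega> / 2 * dH n i \<omega>)"
proof -
  let ?Z = "\<lambda>r. Z (g (n * N) (i * N + r)) \<omega>" and ?H = "\<lambda>r. H (g (n * N) (i * N + r)) \<omega>"
  let ?dH = "\<lambda>r. dH (n * N) (i * N + r) \<omega>" and ?e = "\<lambda>r. euler_error (n * N) (i * N + r) \<omega>"
  let ?u = "U (g n i) \<omega>" and ?z = "Z (g n i) \<omega>" and ?h = "H (g n i) \<omega>"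
  \<comment> \<open>The value at the right end is eliminated through Z (r+1) = Z r + Z r * dH + e;
    apart from e, the coefficients of dH and of its square are then known at the left end.\<close>
  have fine: "strat_term (n * N) (i * N + r) \<omega> = ?Z r * ?dH r + ?Z r / 2 * (?dH r)\<^sup>2 + ?e r / 2 * ?dH r" for r
    by (simp add: strat_term_def euler_error_def dZ_def field_simps power2_eq_square)
  have coarse: "strat_term n i \<omega> = ?z * dH n i \<omega> + ?z / 2 * (dH n i \<omega>)\<^sup>2 + euler_error n i \<omega> / 2 * dH n i \<omega>"
    by (simp add: strat_term_def euler_error_def dZ_def field_simps power2_eq_square)
  have H0: "H (g (n * N) (i * N)) \<omega> = ?h" using grid_refine[OF assms] by simp
  have tel: "?H r - ?h = (\<Sum>q<r. ?dH q)" for r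
    using sum_lessThan_telescope[of ?H r] by (simp add: dH_def H0)
  have HN: "dH n i \<omega> = (\<Sum>r<N. ?dH r)"
    using tel[of N] grid_refine[OF assms, of t n "Suc i"] by (simp add: dH_def add.commute)
  \<comment> \<open>A discrete Ito formula: the left-point sum goes into the martingale part, the
    squares pair with those of the fine level.\<close>
  have "(?H r - ?h)\<^sup>2 = (\<Sum>q<r. (?dH q)\<^sup>2 + 2 * (?H q - ?h) * ?dH q)" for r
  proof (induction r)
    case (Suc r)
    have "(?H (Suc r) - ?h)\<^sup>2 = (?H r - ?h)\<^sup>2 + ((?dH r)\<^sup>2 + 2 * (?H r - ?h) * ?dH r)"
      by (simp add: dH_def power2_eq_square algebra_simps)
    then show ?case by (simp only: Suc.IH sum.lessThan_Suc)
  qed (simp add: H0)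
  from this[of N] have sq: "(dH n i \<omega>)\<^sup>2 = (\<Sum>r<N. (?dH r)\<^sup>2 + 2 * (?H r - ?h) * ?dH r)"
    unfolding HN tel[symmetric] .
  have "?u * ((\<Sum>r<N. strat_term (n * N) (i * N + r) \<omega>) - strat_term n i \<omega>) =
    ?u * ((\<Sum>r<N. ?Z r * ?dH r + ?Z r / 2 * (?dH r)\<^sup>2 + ?e r / 2 * ?dH r)
      - (\<Sum>r<N. ?z * ?dH r) - (\<Sum>r<N. ?z / 2 * ((?dH r)\<^sup>2 + 2 * (?H r - ?h) * ?dH r)))
      - ?u * (euler_error n i \<omega> / 2 * dH n i \<omega>)"
    unfolding fine coarse sq sum_distrib_left[symmetric] HN[symmetric] by (simp add: algebra_simps)
  also have "\<dots> = (\<Sum>r<N. ?u * (?Z r * ?dH r + ?Z r / 2 * (?dH r)\<^sup>2 + ?e r / 2 * ?dH r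
      - ?z * ?dH r - ?z / 2 * ((?dH r)\<^sup>2 + 2 * (?H r - ?h) * ?dH r)))
      - ?u * (euler_error n i \<omega> / 2 * dH n i \<omega>)"
    by (simp only: sum_subtractf[symmetric] sum_distrib_left)
  also have "(\<Sum>r<N. ?u * (?Z r * ?dH r + ?Z r / 2 * (?dH r)\<^sup>2 + ?e r / 2 * ?dH r
      - ?z * ?dH r - ?z / 2 * ((?dH r)\<^sup>2 + 2 * (?H r - ?h) * ?dH r))) =
    (\<Sum>r<N. transform_integrand n N (i * N + r) \<omega> * ?dH r + ?u * ((?Z r - ?z) / 2 * (?dH r)\<^sup>2) + ?u * (?e r / 2 * ?dH r))"
    by (rule sum.cong) (auto simp: transform_integrand_def field_simps)
  finally show ?thesis .
qed

text \<open>\<open>dH\<close> splits into drift and Brownian increments. The drift part is bounded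
  termwise over steps of total length t; each Brownian part is a martingale transform. The event
  bounding the integrand is charged once for the drift and again for every driver.\<close>

lemma likely_transform_sum:
  assumes "N > 0" "n > 0" "\<kappa> > 0" "\<epsilon> > 0" "\<eta>\<^sub>1 > 0" "\<eta>\<^sub>2 > 0"
    and small: "likely \<eta>\<^sub>1 (\<lambda>\<omega>. \<forall>l<n * N. norm (transform_integrand n N l \<omega>) \<le> \<kappa>)"
    and \<kappa>: "\<kappa>\<^sup>2 * t \<le> \<epsilon>\<^sup>2 * \<eta>\<^sub>2"
  shows "likely (\<eta>\<^sub>1 + real CARD('l) * (\<eta>\<^sub>1 + \<eta>\<^sub>2)) (\<lambda>\<omega>. norm (\<Sum>l<n * N. transform_integrand n N l \<omega> * dH (n * N) l \<omega>)
    \<le> norm \<alpha> * t * \<kappa> + (\<Sum>j\<in>UNIV. norm (\<beta> j)) * \<epsilon>)"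
proof -
  let ?\<xi> = "transform_integrand n N" and ?m = "n * N"
  have m: "?m > 0" using assms by simp
  have adapted: "?\<xi> l \<in> borel_measurable (F (g ?m l))" for l
  proof -
    have 0: "0 \<le> g n (l div N)" "0 \<le> g ?m l" using t_pos by auto
    \<comment> \<open>The coarse left end precedes the fine one, so all ingredients are known at the
      fine left end.\<close>
    have le: "g n (l div N) \<le> g ?m l"
      using grid_mono[of t "l div N * N" l ?m] grid_refine[OF assms(1), of t n "l div N"] t_pos
      by (simp add: div_times_less_eq_dividend)
    note [measurable] = measurable_filt_mono[OF U_adapted[OF 0(1)] le] measurable_filt_mono[OF Z_adapted[OF 0(1)] le]
      measurable_filt_mono[OF H_adapted[OF 0(1)] le] Z_adapted[OF 0(2)] H_adapted[OF 0(2)]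
    show ?thesis unfolding transform_integrand_def by measurable
  qed
  have "likely (\<eta>\<^sub>1 + \<eta>\<^sub>2) (\<lambda>\<omega>. norm (\<Sum>l<?m. ?\<xi> l \<omega> * (W j (g ?m (Suc l)) \<omega> - W j (g ?m l) \<omega>)) \<le> \<epsilon>)" for j
    by (rule likely_martingale_transform[where t = t and \<kappa> = \<kappa>])
      (use t_pos m assms adapted in \<open>auto intro: grid_mono\<close>)
  then have "likely (real CARD('l) * (\<eta>\<^sub>1 + \<eta>\<^sub>2)) (\<lambda>\<omega>. \<forall>j\<in>UNIV. norm (\<Sum>l<?m. ?\<xi> l \<omega> * (W j (g ?m (Suc l)) \<omega> - W j (g ?m l) \<omega>)) \<le> \<epsilon>)"
    by (intro likely_ball) auto
  from likely_conj[OF small this] show ?thesis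
  proof (rule likely_mono, elim conjE)
    fix \<omega>
    assume \<xi>: "\<forall>l<?m. norm (?\<xi> l \<omega>) \<le> \<kappa>"
      and W: "\<forall>j\<in>UNIV. norm (\<Sum>l<?m. ?\<xi> l \<omega> * (W j (g ?m (Suc l)) \<omega> - W j (g ?m l) \<omega>)) \<le> \<epsilon>"
    have dH: "dH ?m l \<omega> = complex_of_real (t / ?m) * \<alpha> + (\<Sum>j\<in>UNIV. \<beta> j * (W j (g ?m (Suc l)) \<omega> - W j (g ?m l) \<omega>))" for l
    proof -
      have "complex_of_real (t / ?m) = complex_of_real (g ?m (Suc l)) - complex_of_real (g ?m l)"
        by (simp only: grid_step[of t ?m l, symmetric] of_real_diff)
      then show ?thesis
        by (simp only: dH_def linear_driver_def) (simp add: algebra_simps sum_subtractf)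
    qed
    have "(\<Sum>l<?m. ?\<xi> l \<omega> * dH ?m l \<omega>) =
      (\<Sum>l<?m. ?\<xi> l \<omega> * (complex_of_real (t / ?m) * \<alpha>)) +
      (\<Sum>l<?m. \<Sum>j\<in>UNIV. ?\<xi> l \<omega> * (\<beta> j * (W j (g ?m (Suc l)) \<omega> - W j (g ?m l) \<omega>)))"
      unfolding dH by (simp only: distrib_left sum.distrib sum_distrib_left)
    also have "(\<Sum>l<?m. \<Sum>j\<in>UNIV. ?\<xi> l \<omega> * (\<beta> j * (W j (g ?m (Suc l)) \<omega> - W j (g ?m l) \<omega>))) =
      (\<Sum>j\<in>UNIV. \<beta> j * (\<Sum>l<?m. ?\<xi> l \<omega> * (W j (g ?m (Suc l)) \<omega> - W j (g ?m l) \<omega>)))"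
      by (subst sum.swap) (simp only: sum_distrib_left mult.left_commute)
    finally have eq: "(\<Sum>l<?m. ?\<xi> l \<omega> * dH ?m l \<omega>) =
      (\<Sum>l<?m. ?\<xi> l \<omega> * (complex_of_real (t / ?m) * \<alpha>)) +
      (\<Sum>j\<in>UNIV. \<beta> j * (\<Sum>l<?m. ?\<xi> l \<omega> * (W j (g ?m (Suc l)) \<omega> - W j (g ?m l) \<omega>)))" .
    have "norm (\<Sum>l<?m. ?\<xi> l \<omega> * (complex_of_real (t / ?m) * \<alpha>)) \<le> norm \<alpha> * t * \<kappa>"
    proof (rule norm_sum_le_const[where b = "\<lambda>l. \<kappa> * (t / ?m * norm \<alpha>)"])
      show "norm (?\<xi> l \<omega> * (complex_of_real (t / ?m) * \<alpha>)) \<le> \<kappa> * (t / ?m * norm \<alpha>)" if "l < ?m" for l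
        unfolding norm_mult norm_of_real using \<xi> that t_pos assms(3) by (intro mult_mono) auto
      show "(\<Sum>l<?m. \<kappa> * (t / ?m * norm \<alpha>)) \<le> norm \<alpha> * t * \<kappa>"
        using m by simp
    qed
    moreover have "norm (\<Sum>j\<in>UNIV. \<beta> j * (\<Sum>l<?m. ?\<xi> l \<omega> * (W j (g ?m (Suc l)) \<omega> - W j (g ?m l) \<omega>))) \<le>
        (\<Sum>j\<in>UNIV. norm (\<beta> j) * \<epsilon>)"
      by (rule sum_norm_le) (unfold norm_mult, use W in \<open>auto intro!: mult_left_mono\<close>)
    ultimately show "norm (\<Sum>l<?m. ?\<xi> l \<omega> * dH ?m l \<omega>) \<le> norm \<alpha> * t * \<kappa> + (\<Sum>j\<in>UNIV. norm (\<beta> j)) * \<epsilon>"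
      unfolding eq sum_distrib_right by (intro norm_triangle_le add_mono)
  qed simp
qed

text \<open>Order of choices: the bounds K, C, S precede \<kappa> and \<theta>, these precede n, and
  N comes last, depending on n. The coarse mesh makes the integrand small; the fine mesh makes
  Stratonovich sums agree with the increments of \<open>Z\<close>.\<close>

lemma likely_weighted_strat_errors_small:
  assumes "\<epsilon> > 0" "\<eta> > 0"
  shows "\<forall>\<^sub>F n in sequentially. likely \<eta> (\<lambda>\<omega>. norm (\<Sum>i<n. U (g n i) \<omega> * strat_error n i \<omega>) \<le> \<epsilon>)"
proof -
  define L where "L = real CARD('l)"
  have "L > 0" by (simp add: L_def)
  define \<eta>\<^sub>1 where "\<eta>\<^sub>1 = \<eta> / (13 + 5 * L)"
  have \<eta>1: "\<eta>\<^sub>1 > 0" and "\<eta>\<^sub>1 * (13 + 5 * L) = \<eta>"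
    using assms \<open>L > 0\<close> by (simp_all add: \<eta>\<^sub>1_def)
  \<comment> \<open>The final intersection takes 4 + 5 L shares for the transform, 4 for
    \<open>reg\<close>, 1 for the fine sums, and 2 each for the square sums of \<open>dH\<close> and
    of the Euler errors, which are used on both levels.\<close>
  then have \<eta>_eq: "13 * \<eta>\<^sub>1 + 5 * L * \<eta>\<^sub>1 = \<eta>" by (simp add: algebra_simps)
  obtain K where K: "K > 0" and bU: "likely \<eta>\<^sub>1 (\<lambda>\<omega>. \<forall>s\<in>{0..t}. norm (U s \<omega>) \<le> K)"
    using likely_bounded[OF U_measurable U_continuous \<eta>1, of t] t_pos by auto
  obtain C where C: "C > 0" and bZ: "likely \<eta>\<^sub>1 (\<lambda>\<omega>. \<forall>s\<in>{0..t}. norm (Z s \<omega>) \<le> C)"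
    using likely_bounded[OF Z_measurable Z_continuous \<eta>1, of t] t_pos by auto
  obtain S where S: "S > 0" and bH: "\<And>n. n > 0 \<Longrightarrow> likely \<eta>\<^sub>1 (\<lambda>\<omega>. (\<Sum>i<n. (norm (dH n i \<omega>))\<^sup>2) \<le> S\<^sup>2)"
    using likely_dH_quadratic_sum[OF \<eta>1] by blast
  define B where "B = (\<Sum>j\<in>UNIV. norm (\<beta> j))"
  have "B \<ge> 0" unfolding B_def by (intro sum_nonneg) auto
  obtain \<epsilon>\<^sub>1 where e1: "\<epsilon>\<^sub>1 > 0" "B * \<epsilon>\<^sub>1 \<le> \<epsilon> / 4"
    using small_factor[OF \<open>B \<ge> 0\<close>, of "\<epsilon> / 4"] assms by auto
  \<comment> \<open>|U| (|\<Delta>Z| + |Z| |\<Delta>H|) \<le> K (\<kappa> + C \<kappa>) bounds the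
    integrand.\<close>
  define A where "A = K * (1 + C)"
  have "A > 0" using K C by (simp add: A_def)
  obtain \<kappa>\<^sub>1 where k1: "\<kappa>\<^sub>1 > 0" "(norm \<alpha> * t * A + K * S\<^sup>2 / 2) * \<kappa>\<^sub>1 \<le> \<epsilon> / 4"
    using small_factor[of "norm \<alpha> * t * A + K * S\<^sup>2 / 2" "\<epsilon> / 4"] assms \<open>A > 0\<close> K t_pos by auto
  obtain \<kappa>\<^sub>2 where k2: "\<kappa>\<^sub>2 > 0" "(A * sqrt t) * \<kappa>\<^sub>2 \<le> \<epsilon>\<^sub>1 * sqrt \<eta>\<^sub>1"
    using small_factor[of "A * sqrt t" "\<epsilon>\<^sub>1 * sqrt \<eta>\<^sub>1"] \<open>A > 0\<close> t_pos e1 \<eta>1 by auto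
  define \<kappa> where "\<kappa> = min \<kappa>\<^sub>1 \<kappa>\<^sub>2"
  have "\<kappa> > 0" using k1 k2 by (simp add: \<kappa>_def)
  have k3: "(norm \<alpha> * t * A + K * S\<^sup>2 / 2) * \<kappa> \<le> \<epsilon> / 4"
  proof -
    have "(norm \<alpha> * t * A + K * S\<^sup>2 / 2) * \<kappa> \<le> (norm \<alpha> * t * A + K * S\<^sup>2 / 2) * \<kappa>\<^sub>1"
      using \<open>A > 0\<close> K t_pos by (intro mult_left_mono) (auto simp: \<kappa>_def)
    then show ?thesis using k1 by linarith
  qed
  \<comment> \<open>The requirement of Chebyshev's inequality for the transform; \<open>k2\<close>
    is its square root.\<close>
  have k4: "(A * \<kappa>)\<^sup>2 * t \<le> \<epsilon>\<^sub>1\<^sup>2 * \<eta>\<^sub>1"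
  proof -
    have "(A * sqrt t) * \<kappa> \<le> (A * sqrt t) * \<kappa>\<^sub>2"
      using \<open>A > 0\<close> t_pos by (intro mult_left_mono) (auto simp: \<kappa>_def)
    then have "A * sqrt t * \<kappa> \<le> \<epsilon>\<^sub>1 * sqrt \<eta>\<^sub>1" using k2(2) by linarith
    then have "(A * sqrt t * \<kappa>)\<^sup>2 \<le> (\<epsilon>\<^sub>1 * sqrt \<eta>\<^sub>1)\<^sup>2"
      using \<open>A > 0\<close> \<open>\<kappa> > 0\<close> t_pos by (intro power_mono) auto
    then show ?thesis
      using t_pos \<eta>1 by (simp add: power_mult_distrib mult.commute mult.left_commute)
  qed
  obtain \<theta> where \<theta>: "\<theta> > 0" "(K * S) * \<theta> \<le> \<epsilon> / 4"
    using small_factor[of "K * S" "\<epsilon> / 4"] assms K S by auto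
  obtain n\<^sub>0 where n0: "\<And>n. n \<ge> n\<^sub>0 \<Longrightarrow> likely \<eta>\<^sub>1 (\<lambda>\<omega>. (\<Sum>i<n. (norm (euler_error n i \<omega>))\<^sup>2) \<le> \<theta>\<^sup>2)"
    using likely_euler_errors_small[OF \<theta>(1) \<eta>1] unfolding eventually_sequentially by blast
  show ?thesis
    using likely_Z_increments_small[OF \<open>\<kappa> > 0\<close> \<eta>1] likely_H_increments_small[OF \<open>\<kappa> > 0\<close> \<eta>1]
      eventually_ge_at_top[of n\<^sub>0] eventually_gt_at_top[of 0]
  proof eventually_elim
    fix n :: nat
    assume oZ: "likely \<eta>\<^sub>1 (\<lambda>\<omega>. \<forall>s\<in>{0..t}. \<forall>u\<in>{0..t}. \<bar>s - u\<bar> \<le> t / real n \<longrightarrow> norm (Z s \<omega> - Z u \<omega>) \<le> \<kappa>)"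
      and oH: "likely \<eta>\<^sub>1 (\<lambda>\<omega>. \<forall>s\<in>{0..t}. \<forall>u\<in>{0..t}. \<bar>s - u\<bar> \<le> t / real n \<longrightarrow> norm (H s \<omega> - H u \<omega>) \<le> \<kappa>)"
      and "n\<^sub>0 \<le> n" "0 < n"
    \<comment> \<open>n blocks with weight at most K and error 2 \<epsilon>' add up to \<epsilon> /
      4.\<close>
    define \<epsilon>' where "\<epsilon>' = \<epsilon> / (8 * K * n)"
    have "\<epsilon>' > 0" using assms K \<open>0 < n\<close> by (simp add: \<epsilon>'_def)
    from eventually_happens'[OF sequentially_bot likely_fine_sums[OF this \<eta>1 \<open>0 < n\<close>]]
    obtain N where "N > 0" and fine: "likely \<eta>\<^sub>1 (\<lambda>\<omega>. \<forall>i\<in>{..n}.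
        norm ((\<Sum>l<i * N. strat_term (n * N) l \<omega>) - (Z (g n i) \<omega> - Z 0 \<omega>)) \<le> \<epsilon>')"
      by blast
    \<comment> \<open>The Euler errors must be small at the levels n and n N; a threshold serves
      both because n N \<ge> n.\<close>
    have m: "n * N > 0" "n\<^sub>0 \<le> n * N"
      using \<open>0 < n\<close> \<open>N > 0\<close> \<open>n\<^sub>0 \<le> n\<close> by (auto intro: order_trans[of _ n])
    define reg where "reg \<omega> \<longleftrightarrow> (\<forall>s\<in>{0..t}. norm (U s \<omega>) \<le> K) \<and> (\<forall>s\<in>{0..t}. norm (Z s \<omega>) \<le> C) \<and>
      (\<forall>s\<in>{0..t}. \<forall>u\<in>{0..t}. \<bar>s - u\<bar> \<le> t / real n \<longrightarrow> norm (Z s \<omega> - Z u \<omega>) \<le> \<kappa>) \<and>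
      (\<forall>s\<in>{0..t}. \<forall>u\<in>{0..t}. \<bar>s - u\<bar> \<le> t / real n \<longrightarrow> norm (H s \<omega> - H u \<omega>) \<le> \<kappa>)" for \<omega>
    have reg: "likely (4 * \<eta>\<^sub>1) reg"
      using likely_conj[OF bU likely_conj[OF bZ likely_conj[OF oZ oH]]] unfolding reg_def
      by (rule likely_mono) auto
    have near: "g (n * N) l \<in> {0..t}" "g n (l div N) \<in> {0..t}" "\<bar>g (n * N) l - g n (l div N)\<bar> \<le> t / real n"
      if "l < n * N" for l
    proof -
      have "l div N < n" using that by (simp add: less_mult_imp_div_less)
      then show "g (n * N) l \<in> {0..t}" "g n (l div N) \<in> {0..t}"
        using that t_pos by auto
      show "\<bar>g (n * N) l - g n (l div N)\<bar> \<le> t / real n"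
        using grid_refine_diff[OF \<open>N > 0\<close>, of "l mod N" t n "l div N"] \<open>N > 0\<close> t_pos by simp
    qed
    have "likely (4 * \<eta>\<^sub>1) (\<lambda>\<omega>. \<forall>l<n * N. norm (transform_integrand n N l \<omega>) \<le> A * \<kappa>)"
      using reg
    proof (rule likely_mono, intro allI impI)
      fix \<omega> l assume "reg \<omega>" "l < n * N"
      note near = near[OF \<open>l < n * N\<close>]
      have dz: "norm (Z (g (n * N) l) \<omega> - Z (g n (l div N)) \<omega>) \<le> \<kappa>"
        and dh: "norm (H (g (n * N) l) \<omega> - H (g n (l div N)) \<omega>) \<le> \<kappa>"
        and z: "norm (Z (g n (l div N)) \<omega>) \<le> C" and u: "norm (U (g n (l div N)) \<omega>) \<le> K"
        using \<open>reg \<omega>\<close> near unfolding reg_def by blast+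
      have "norm (Z (g n (l div N)) \<omega> * (H (g (n * N) l) \<omega> - H (g n (l div N)) \<omega>)) \<le> C * \<kappa>"
        unfolding norm_mult using z dh C by (intro mult_mono) auto
      then have "norm ((Z (g (n * N) l) \<omega> - Z (g n (l div N)) \<omega>) -
          Z (g n (l div N)) \<omega> * (H (g (n * N) l) \<omega> - H (g n (l div N)) \<omega>)) \<le> \<kappa> + C * \<kappa>"
        by (rule order_trans[OF norm_triangle_ineq4 add_mono[OF dz]])
      with u have "norm (transform_integrand n N l \<omega>) \<le> K * (\<kappa> + C * \<kappa>)"
        unfolding transform_integrand_def norm_mult[of "U (g n (l div N)) \<omega>"] using K by (intro mult_mono) auto
      then show "norm (transform_integrand n N l \<omega>) \<le> A * \<kappa>"
        by (simp add: A_def algebra_simps)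
    qed simp
    then have "likely (4 * \<eta>\<^sub>1 + real CARD('l) * (4 * \<eta>\<^sub>1 + \<eta>\<^sub>1)) (\<lambda>\<omega>.
        norm (\<Sum>l<n * N. transform_integrand n N l \<omega> * dH (n * N) l \<omega>) \<le> norm \<alpha> * t * (A * \<kappa>) + B * \<epsilon>\<^sub>1)"
      unfolding B_def
      by (intro likely_transform_sum \<open>N > 0\<close> \<open>0 < n\<close> e1 k4) (use \<open>A > 0\<close> \<open>\<kappa> > 0\<close> \<eta>1 in auto)
    from likely_conj[OF this likely_conj[OF reg likely_conj[OF fine
      likely_conj[OF likely_conj[OF bH[OF m(1)] bH[OF \<open>0 < n\<close>]] likely_conj[OF n0[OF m(2)] n0[OF \<open>n\<^sub>0 \<le> n\<close>]]]]]]
    show "likely \<eta> (\<lambda>\<omega>. norm (\<Sum>i<n. U (g n i) \<omega> * strat_error n i \<omega>) \<le> \<epsilon>)"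
    proof (rule likely_mono, elim conjE)
      fix \<omega>
      let ?dH = "\<lambda>l. dH (n * N) l \<omega>" and ?e = "\<lambda>l. euler_error (n * N) l \<omega>" and ?u = "\<lambda>l. U (g n (l div N)) \<omega>"
      let ?D = "\<lambda>l. (Z (g (n * N) l) \<omega> - Z (g n (l div N)) \<omega>) / 2"
      let ?fine = "\<lambda>i. \<Sum>r<N. strat_term (n * N) (i * N + r) \<omega>"
      assume T: "norm (\<Sum>l<n * N. transform_integrand n N l \<omega> * ?dH l) \<le> norm \<alpha> * t * (A * \<kappa>) + B * \<epsilon>\<^sub>1"
        and reg: "reg \<omega>"
        and fine: "\<forall>i\<in>{..n}. norm ((\<Sum>l<i * N. strat_term (n * N) l \<omega>) - (Z (g n i) \<omega> - Z 0 \<omega>)) \<le> \<epsilon>'"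
        and H1: "(\<Sum>l<n * N. (norm (?dH l))\<^sup>2) \<le> S\<^sup>2" and H2: "(\<Sum>i<n. (norm (dH n i \<omega>))\<^sup>2) \<le> S\<^sup>2"
        and e1: "(\<Sum>l<n * N. (norm (?e l))\<^sup>2) \<le> \<theta>\<^sup>2" and e2: "(\<Sum>i<n. (norm (euler_error n i \<omega>))\<^sup>2) \<le> \<theta>\<^sup>2"
      have Ui: "norm (U (g n i) \<omega>) \<le> K" if "i < n" for i
        using reg that t_pos unfolding reg_def by auto
      have b1: "norm (\<Sum>i<n. U (g n i) \<omega> * (dZ n i \<omega> - ?fine i)) \<le> \<epsilon> / 4"
      proof (rule norm_sum_le_const)
        fix i assume "i < n"
        have "norm (dZ n i \<omega> - ?fine i) \<le> 2 * \<epsilon>'"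
          using norm_block_error[OF fine \<open>i < n\<close>] by (simp add: norm_minus_commute)
        then show "norm (U (g n i) \<omega> * (dZ n i \<omega> - ?fine i)) \<le> K * (2 * \<epsilon>')"
          unfolding norm_mult using Ui[OF \<open>i < n\<close>] K by (intro mult_mono) auto
      next
        show "(\<Sum>i<n. K * (2 * \<epsilon>')) \<le> \<epsilon> / 4"
          using K \<open>0 < n\<close> by (simp add: \<epsilon>'_def)
      qed
      have b2: "norm (\<Sum>l<n * N. ?u l * (?D l * (?dH l)\<^sup>2)) \<le> K * \<kappa> / 2 * S\<^sup>2"
      proof (rule norm_sum_le_const)
        fix l assume l: "l < n * N"
        have "norm (?u l) \<le> K" "norm (?D l) \<le> \<kappa> / 2"
          using reg near[OF l] unfolding reg_def by (auto simp: norm_divide)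
        then have "norm (?u l) * (norm (?D l) * (norm (?dH l))\<^sup>2) \<le> K * (\<kappa> / 2 * (norm (?dH l))\<^sup>2)"
          using K \<open>\<kappa> > 0\<close> by (intro mult_mono) auto
        then show "norm (?u l * (?D l * (?dH l)\<^sup>2)) \<le> K * \<kappa> / 2 * (norm (?dH l))\<^sup>2"
          by (simp add: norm_mult norm_power)
      next
        show "(\<Sum>l<n * N. K * \<kappa> / 2 * (norm (?dH l))\<^sup>2) \<le> K * \<kappa> / 2 * S\<^sup>2"
          unfolding sum_distrib_left[symmetric] using H1 K \<open>\<kappa> > 0\<close> by (intro mult_left_mono) auto
      qed
      have b3: "norm (\<Sum>l<n * N. ?u l * (?e l / 2 * ?dH l)) \<le> K / 2 * (\<theta> * S)"
      proof (rule norm_sum_le_const)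
        fix l assume l: "l < n * N"
        have "norm (?u l) \<le> K"
          using reg near[OF l] unfolding reg_def by auto
        then have "norm (?u l) * (norm (?e l) / 2 * norm (?dH l)) \<le> K * (norm (?e l) / 2 * norm (?dH l))"
          by (intro mult_right_mono) auto
        then show "norm (?u l * (?e l / 2 * ?dH l)) \<le> K / 2 * (norm (?e l) * norm (?dH l))"
          by (simp add: norm_mult norm_divide)
      next
        show "(\<Sum>l<n * N. K / 2 * (norm (?e l) * norm (?dH l))) \<le> K / 2 * (\<theta> * S)"
          unfolding sum_distrib_left[symmetric] using sum_mult_norm_le[OF e1 H1] K \<theta> S by (intro mult_left_mono) auto
      qed
      have b4: "norm (\<Sum>i<n. U (g n i) \<omega> * (euler_error n i \<omega> / 2 * dH n i \<omega>)) \<le> K / 2 * (\<theta> * S)"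
      proof (rule norm_sum_le_const)
        fix i assume i: "i < n"
        have "norm (U (g n i) \<omega>) * (norm (euler_error n i \<omega>) / 2 * norm (dH n i \<omega>)) \<le> K * (norm (euler_error n i \<omega>) / 2 * norm (dH n i \<omega>))"
          using Ui[OF i] by (intro mult_right_mono) auto
        then show "norm (U (g n i) \<omega> * (euler_error n i \<omega> / 2 * dH n i \<omega>)) \<le> K / 2 * (norm (euler_error n i \<omega>) * norm (dH n i \<omega>))"
          by (simp add: norm_mult norm_divide)
      next
        show "(\<Sum>i<n. K / 2 * (norm (euler_error n i \<omega>) * norm (dH n i \<omega>))) \<le> K / 2 * (\<theta> * S)"
          unfolding sum_distrib_left[symmetric] using sum_mult_norm_le[OF e2 H2] K \<theta> S by (intro mult_left_mono) auto
      qed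
      have blocks: "(\<Sum>i<n. \<Sum>r<N. transform_integrand n N (i * N + r) \<omega> * ?dH (i * N + r)
          + U (g n i) \<omega> * ((Z (g (n * N) (i * N + r)) \<omega> - Z (g n i) \<omega>) / 2 * (?dH (i * N + r))\<^sup>2)
          + U (g n i) \<omega> * (?e (i * N + r) / 2 * ?dH (i * N + r))) =
        (\<Sum>l<n * N. transform_integrand n N l \<omega> * ?dH l + ?u l * (?D l * (?dH l)\<^sup>2) + ?u l * (?e l / 2 * ?dH l))"
        unfolding sum_nat_blocks by (intro sum.cong refl) simp
      have "(\<Sum>i<n. U (g n i) \<omega> * strat_error n i \<omega>) =
        (\<Sum>i<n. U (g n i) \<omega> * (dZ n i \<omega> - ?fine i)) + (\<Sum>i<n. U (g n i) \<omega> * (?fine i - strat_term n i \<omega>))"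
        unfolding sum.distrib[symmetric] by (intro sum.cong refl) (simp add: strat_error_def algebra_simps)
      also have "\<dots> = (\<Sum>i<n. U (g n i) \<omega> * (dZ n i \<omega> - ?fine i)) +
        ((\<Sum>l<n * N. transform_integrand n N l \<omega> * ?dH l) + (\<Sum>l<n * N. ?u l * (?D l * (?dH l)\<^sup>2)) +
          (\<Sum>l<n * N. ?u l * (?e l / 2 * ?dH l)) - (\<Sum>i<n. U (g n i) \<omega> * (euler_error n i \<omega> / 2 * dH n i \<omega>)))"
        unfolding block_error_expansion[OF \<open>N > 0\<close>] sum_subtractf blocks by (simp only: sum.distrib)
      finally have eq: "(\<Sum>i<n. U (g n i) \<omega> * strat_error n i \<omega>) = (\<Sum>i<n. U (g n i) \<omega> * (dZ n i \<omega> - ?fine i)) +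
        ((\<Sum>l<n * N. transform_integrand n N l \<omega> * ?dH l) + (\<Sum>l<n * N. ?u l * (?D l * (?dH l)\<^sup>2)) +
          (\<Sum>l<n * N. ?u l * (?e l / 2 * ?dH l)) - (\<Sum>i<n. U (g n i) \<omega> * (euler_error n i \<omega> / 2 * dH n i \<omega>)))" .
      have tri: "norm (a + (b + c + d - e)) \<le> norm a + norm b + norm c + norm d + norm e" for a b c d e :: complex
        using norm_triangle_ineq[of a "b + c + d - e"] norm_triangle_ineq4[of "b + c + d" e]
          norm_triangle_ineq[of "b + c" d] norm_triangle_ineq[of b c] by linarith
      have "norm (\<Sum>i<n. U (g n i) \<omega> * strat_error n i \<omega>) \<le> \<epsilon> / 4 + (norm \<alpha> * t * (A * \<kappa>) + B * \<epsilon>\<^sub>1) +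
        K * \<kappa> / 2 * S\<^sup>2 + K / 2 * (\<theta> * S) + K / 2 * (\<theta> * S)"
        unfolding eq using b1 T b2 b3 b4 by (intro order_trans[OF tri] add_mono)
      \<comment> \<open>Four quarters: the replacement of dZ, the terms linear in \<kappa>, the
        Brownian part of the transform, and the Euler products of both levels.\<close>
      also have "\<dots> = \<epsilon> / 4 + (norm \<alpha> * t * A + K * S\<^sup>2 / 2) * \<kappa> + B * \<epsilon>\<^sub>1 + (K * S) * \<theta>"
        by (simp add: algebra_simps)
      also have "\<dots> \<le> \<epsilon>"
        using k3 \<open>B * \<epsilon>\<^sub>1 \<le> \<epsilon> / 4\<close> \<theta>(2) by linarith
      finally show "norm (\<Sum>i<n. U (g n i) \<omega> * strat_error n i \<omega>) \<le> \<epsilon>" .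
    qed (use \<eta>_eq in \<open>simp add: L_def algebra_simps\<close>)
  qed
qed

text \<open>Product rule with averaged factors: the increment of Z U is the mean of U times
  \<Delta>Z plus the mean of Z times \<Delta>U. Inserting \<Delta>Z = (mean of Z) dH + E leaves the
  mean of U times E, and the mean of Z times the trapezoidal defect of U. The weighted error sum is
  known for left end weights only, so the mean of U is written U + \<Delta>U / 2, and Cauchy-Schwarz
  handles \<Delta>U times E.\<close>

lemma likely_ZU_close:
  assumes "\<epsilon> > 0" "\<eta> > 0"
  shows "likely \<eta> (\<lambda>\<omega>. norm (Z t \<omega> * U t \<omega> - Z 0 \<omega> * U 0 \<omega>) \<le> \<epsilon>)"
proof -
  have \<eta>6: "\<eta> / 6 > 0" and \<epsilon>3: "\<epsilon> / 3 > 0" using assms by auto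
  obtain K where K: "K > 0" and bU: "likely (\<eta> / 6) (\<lambda>\<omega>. \<forall>s\<in>{0..t}. norm (U s \<omega>) \<le> K)"
    using likely_bounded[OF U_measurable U_continuous \<eta>6, of t] t_pos by auto
  obtain C where C: "C > 0" and bZ: "likely (\<eta> / 6) (\<lambda>\<omega>. \<forall>s\<in>{0..t}. norm (Z s \<omega>) \<le> C)"
    using likely_bounded[OF Z_measurable Z_continuous \<eta>6, of t] t_pos by auto
  obtain S where S: "S > 0" and bH: "\<And>n. n > 0 \<Longrightarrow> likely (\<eta> / 6) (\<lambda>\<omega>. (\<Sum>i<n. (norm (dH n i \<omega>))\<^sup>2) \<le> S\<^sup>2)"
    using likely_dH_quadratic_sum[OF \<eta>6] by blast
  obtain \<theta> where \<theta>: "\<theta> > 0" "(3 / 2 * K * S) * \<theta> \<le> \<epsilon> / 3"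
    using small_factor[of "3 / 2 * K * S" "\<epsilon> / 3"] assms K S by auto
  obtain \<kappa>\<^sub>1 where k1: "\<kappa>\<^sub>1 > 0" "(3 * C * K * S\<^sup>2) * \<kappa>\<^sub>1 \<le> \<epsilon> / 3"
    using small_factor[of "3 * C * K * S\<^sup>2" "\<epsilon> / 3"] assms K C by auto
  \<comment> \<open>The bound 1 is what the exponential estimates require of the increments of
    \<open>H\<close>.\<close>
  define \<kappa> where "\<kappa> = min \<kappa>\<^sub>1 1"
  have \<kappa>: "\<kappa> > 0" "\<kappa> \<le> 1" "\<kappa> \<le> \<kappa>\<^sub>1" using k1 by (auto simp: \<kappa>_def)
  have k2: "(3 * C * K * S\<^sup>2) * \<kappa> \<le> \<epsilon> / 3"
  proof -
    have "(3 * C * K * S\<^sup>2) * \<kappa> \<le> (3 * C * K * S\<^sup>2) * \<kappa>\<^sub>1"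
      using C K \<kappa>(3) by (intro mult_left_mono) auto
    then show ?thesis using k1(2) by linarith
  qed
  from likely_weighted_strat_errors_small[OF \<epsilon>3 \<eta>6] likely_strat_errors_small[OF \<theta>(1) \<eta>6]
    likely_H_increments_small[OF \<kappa>(1) \<eta>6] eventually_gt_at_top[of 0]
  have "\<forall>\<^sub>F n in sequentially. likely \<eta> (\<lambda>\<omega>. norm (Z t \<omega> * U t \<omega> - Z 0 \<omega> * U 0 \<omega>) \<le> \<epsilon>)"
  proof eventually_elim
    fix n :: nat
    assume WE: "likely (\<eta> / 6) (\<lambda>\<omega>. norm (\<Sum>i<n. U (g n i) \<omega> * strat_error n i \<omega>) \<le> \<epsilon> / 3)"
      and E: "likely (\<eta> / 6) (\<lambda>\<omega>. (\<Sum>i<n. (norm (strat_error n i \<omega>))\<^sup>2) \<le> \<theta>\<^sup>2)"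
      and oH: "likely (\<eta> / 6) (\<lambda>\<omega>. \<forall>s\<in>{0..t}. \<forall>u\<in>{0..t}. \<bar>s - u\<bar> \<le> t / real n \<longrightarrow> norm (H s \<omega> - H u \<omega>) \<le> \<kappa>)"
      and "0 < n"
    from likely_conj[OF likely_conj[OF WE E] likely_conj[OF likely_conj[OF oH bH[OF \<open>0 < n\<close>]] likely_conj[OF bU bZ]]]
    show "likely \<eta> (\<lambda>\<omega>. norm (Z t \<omega> * U t \<omega> - Z 0 \<omega> * U 0 \<omega>) \<le> \<epsilon>)"
    proof (rule likely_mono, elim conjE)
      fix \<omega>
      let ?U = "\<lambda>i. U (g n i) \<omega>" and ?Z = "\<lambda>i. Z (g n i) \<omega>" and ?h = "\<lambda>i. dH n i \<omega>" and ?E = "\<lambda>i. strat_error n i \<omega>"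
      assume WE: "norm (\<Sum>i<n. ?U i * ?E i) \<le> \<epsilon> / 3"
        and E: "(\<Sum>i<n. (norm (?E i))\<^sup>2) \<le> \<theta>\<^sup>2"
        and oH: "\<forall>s\<in>{0..t}. \<forall>u\<in>{0..t}. \<bar>s - u\<bar> \<le> t / real n \<longrightarrow> norm (H s \<omega> - H u \<omega>) \<le> \<kappa>"
        and h2: "(\<Sum>i<n. (norm (?h i))\<^sup>2) \<le> S\<^sup>2"
        and bU: "\<forall>s\<in>{0..t}. norm (U s \<omega>) \<le> K" and bZ: "\<forall>s\<in>{0..t}. norm (Z s \<omega>) \<le> C"
      have gin: "g n i \<in> {0..t}" if "i \<le> n" for i using that t_pos by auto
      have h: "norm (?h i) \<le> \<kappa>" if "i < n" for i
      proof -
        have "\<bar>g n (Suc i) - g n i\<bar> \<le> t / real n" unfolding grid_step using t_pos by simp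
        moreover have "g n (Suc i) \<in> {0..t}" "g n i \<in> {0..t}" using gin that by auto
        ultimately show ?thesis unfolding dH_def using oH by blast
      qed
      have Ustep: "?U (Suc i) = ?U i * exp (- ?h i)" for i
        by (simp add: U_def dH_def flip: exp_add)
      have b1: "norm (\<Sum>i<n. (?U (Suc i) - ?U i) / 2 * ?E i) \<le> 3 / 2 * K * (\<theta> * S)"
      proof (rule norm_sum_le_const)
        fix i assume i: "i < n"
        have "norm (?U (Suc i) - ?U i) = norm (?U i) * norm (exp (- ?h i) - 1)"
          unfolding Ustep norm_mult[symmetric] by (simp add: algebra_simps)
        also have "\<dots> \<le> K * (3 * norm (?h i))"
          using bU gin[of i] i h[OF i] \<kappa>(2) K by (intro mult_mono norm_exp_minus_1_le) auto
        finally have "norm (?U (Suc i) - ?U i) / 2 * norm (?E i) \<le> K * (3 * norm (?h i)) / 2 * norm (?E i)"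
          by (intro mult_right_mono divide_right_mono) auto
        then show "norm ((?U (Suc i) - ?U i) / 2 * ?E i) \<le> 3 / 2 * K * (norm (?E i) * norm (?h i))"
          by (simp add: norm_mult norm_divide mult.commute mult.left_commute)
      next
        show "(\<Sum>i<n. 3 / 2 * K * (norm (?E i) * norm (?h i))) \<le> 3 / 2 * K * (\<theta> * S)"
          unfolding sum_distrib_left[symmetric] using sum_mult_norm_le[OF E h2] K \<theta> S by (intro mult_left_mono) auto
      qed
      have b2: "norm (\<Sum>i<n. (?Z i + ?Z (Suc i)) / 2 * (?U (Suc i) - ?U i + (?U i + ?U (Suc i)) / 2 * ?h i)) \<le> 3 * C * K * \<kappa> * S\<^sup>2"
      proof (rule norm_sum_le_const)
        fix i assume i: "i < n"
        have "norm (?Z i) \<le> C" "norm (?Z (Suc i)) \<le> C" "norm (?U i) \<le> K"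
          using bZ bU gin[of i] gin[of "Suc i"] i by auto
        then have Zm: "norm ((?Z i + ?Z (Suc i)) / 2) \<le> C"
          using norm_triangle_ineq[of "?Z i" "?Z (Suc i)"] by (simp add: norm_divide)
        have "?U (Suc i) - ?U i + (?U i + ?U (Suc i)) / 2 * ?h i = ?U i * (exp (- ?h i) - 1 + (1 + exp (- ?h i)) / 2 * ?h i)"
          unfolding Ustep by (simp add: field_simps)
        then have "norm (?U (Suc i) - ?U i + (?U i + ?U (Suc i)) / 2 * ?h i) =
            norm (?U i) * norm (exp (- ?h i) - 1 + (1 + exp (- ?h i)) / 2 * ?h i)"
          by (simp only: norm_mult)
        also have "\<dots> \<le> K * (3 * norm (?h i) ^ 3)"
          using \<open>norm (?U i) \<le> K\<close> h[OF i] \<kappa>(2) K by (intro mult_mono norm_exp_trapezoid_le) auto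
        also have "\<dots> \<le> K * (3 * (\<kappa> * (norm (?h i))\<^sup>2))"
          using K mult_right_mono[OF h[OF i], of "(norm (?h i))\<^sup>2"]
          by (intro mult_left_mono) (auto simp: power3_eq_cube power2_eq_square mult.assoc)
        finally show "norm ((?Z i + ?Z (Suc i)) / 2 * (?U (Suc i) - ?U i + (?U i + ?U (Suc i)) / 2 * ?h i)) \<le> C * (K * (3 * (\<kappa> * (norm (?h i))\<^sup>2)))"
          unfolding norm_mult[of "(?Z i + ?Z (Suc i)) / 2"] using Zm C by (intro mult_mono) auto
      next
        show "(\<Sum>i<n. C * (K * (3 * (\<kappa> * (norm (?h i))\<^sup>2)))) \<le> 3 * C * K * \<kappa> * S\<^sup>2"
          unfolding sum_distrib_left[symmetric] using mult_left_mono[OF h2, of "3 * C * K * \<kappa>"] C K \<kappa> by (simp add: algebra_simps)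
      qed
      have "Z t \<omega> * U t \<omega> - Z 0 \<omega> * U 0 \<omega> = (\<Sum>i<n. ?Z (Suc i) * ?U (Suc i) - ?Z i * ?U i)"
        using sum_lessThan_telescope[of "\<lambda>i. ?Z i * ?U i" n] \<open>0 < n\<close> by simp
      also have "\<dots> = (\<Sum>i<n. ?U i * ?E i + (?U (Suc i) - ?U i) / 2 * ?E i +
          (?Z i + ?Z (Suc i)) / 2 * (?U (Suc i) - ?U i + (?U i + ?U (Suc i)) / 2 * ?h i))"
        by (intro sum.cong refl) (simp add: strat_error_def strat_term_def dZ_def field_simps)
      finally have eq: "Z t \<omega> * U t \<omega> - Z 0 \<omega> * U 0 \<omega> = (\<Sum>i<n. ?U i * ?E i) + (\<Sum>i<n. (?U (Suc i) - ?U i) / 2 * ?E i) +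
          (\<Sum>i<n. (?Z i + ?Z (Suc i)) / 2 * (?U (Suc i) - ?U i + (?U i + ?U (Suc i)) / 2 * ?h i))"
        by (simp only: sum.distrib)
      have "norm (Z t \<omega> * U t \<omega> - Z 0 \<omega> * U 0 \<omega>) \<le> \<epsilon> / 3 + 3 / 2 * K * (\<theta> * S) + 3 * C * K * \<kappa> * S\<^sup>2"
        unfolding eq using WE b1 b2 by (intro norm_triangle_le add_mono)
      then show "norm (Z t \<omega> * U t \<omega> - Z 0 \<omega> * U 0 \<omega>) \<le> \<epsilon>"
        using \<theta>(2) k2 by (simp add: algebra_simps)
    qed simp
  qed
  \<comment> \<open>The event does not depend on n, so a single good n suffices.\<close>
  then show ?thesis
    using eventually_happens'[OF sequentially_bot] by blast
qed

theorem scalar_solution: "AE \<omega> in M. Z t \<omega> = Z 0 \<omega> * exp (H t \<omega> - H 0 \<omega>)"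
proof -
  have [measurable]: "Z t \<in> borel_measurable M" "Z 0 \<in> borel_measurable M" "U t \<in> borel_measurable M" "U 0 \<in> borel_measurable M"
    using t_pos by auto
  have "AE \<omega> in M. norm (Z t \<omega> * U t \<omega> - Z 0 \<omega> * U 0 \<omega>) \<le> 0"
    by (rule AE_zero_if_likely) (use likely_ZU_close in auto)
  then show ?thesis
  proof eventually_elim
    fix \<omega> assume "norm (Z t \<omega> * U t \<omega> - Z 0 \<omega> * U 0 \<omega>) \<le> 0"
    then have "Z t \<omega> * U t \<omega> = Z 0 \<omega> * U 0 \<omega>" by simp
    then have "Z t \<omega> * U t \<omega> * exp (H t \<omega>) = Z 0 \<omega> * U 0 \<omega> * exp (H t \<omega>)" by simp
    then show "Z t \<omega> = Z 0 \<omega> * exp (H t \<omega> - H 0 \<omega>)"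
      by (simp add: U_def mult.assoc exp_diff exp_minus flip: exp_add) (simp add: field_simps)
  qed
qed

end

section \<open>Gaussian exponential moments\<close>

text \<open>The eigenvalues may be complex, hence so is c = a + i b. Shifting the density by a
  absorbs the real part and produces exp (a^2/2 + i a b); what remains is the characteristic
  function at b, and the exponents combine to c^2/2.\<close>

lemma std_normal_exp:
  fixes c :: complex
  shows "integrable lborel (\<lambda>x. std_normal_density x *\<^sub>R exp (c * of_real x))"
    and "(LINT x|lborel. std_normal_density x *\<^sub>R exp (c * of_real x)) = exp (c\<^sup>2 / 2)"
proof -
  define a b where "a = Re c" and "b = Im c"
  have c: "c = of_real a + \<i> * of_real b" by (simp add: a_def b_def complex_eq)
  define f where "f y = std_normal_density y *\<^sub>R iexp (b * y)" for y
  have intf: "integrable lborel f"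
    by (rule Bochner_Integration.integrable_bound[OF integrable_std_normal_moment[of 0]])
      (auto simp: f_def[abs_def])
  have valf: "integral\<^sup>L lborel f = complex_of_real (exp (- b\<^sup>2 / 2))"
  proof -
    have "char std_normal_distribution b = integral\<^sup>L lborel f"
      unfolding char_def f_def by (subst integral_density) (auto simp: normal_density_nonneg)
    then show ?thesis by (simp add: char_std_normal_distribution)
  qed
  have shift: "std_normal_density (a + 1 * x) *\<^sub>R exp (c * of_real (a + 1 * x)) = exp (of_real (a\<^sup>2 / 2) + \<i> * of_real (a * b)) * f x" for x
  proof -
    have "std_normal_density (a + x) * exp (a * (a + x)) = exp (a\<^sup>2 / 2) * std_normal_density x"
      by (simp add: normal_density_def power2_eq_square field_simps flip: exp_add)
    then have "complex_of_real (std_normal_density (a + x)) * exp (of_real (a * (a + x))) = exp (of_real (a\<^sup>2 / 2)) * of_real (std_normal_density x)"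
      by (metis exp_of_real of_real_mult)
    moreover have "exp (c * of_real (a + x)) = exp (of_real (a * (a + x))) * (exp (\<i> * of_real (a * b)) * iexp (b * x))"
      unfolding c by (simp add: algebra_simps flip: exp_add)
    ultimately show ?thesis
      by (simp add: f_def scaleR_conv_of_real exp_add mult.assoc mult.left_commute)
  qed
  let ?g = "\<lambda>x. std_normal_density x *\<^sub>R exp (c * of_real x)"
  have "integrable lborel (\<lambda>x. ?g (a + 1 * x))"
    unfolding shift by (intro integrable_mult_right intf)
  then show "integrable lborel ?g"
    using lborel_integrable_real_affine_iff[of 1 ?g a] by simp
  have "(LINT x|lborel. ?g x) = (LINT x|lborel. ?g (a + 1 * x))"
    using lborel_integral_real_affine[of 1 ?g a] by simp
  also have "\<dots> = exp (of_real (a\<^sup>2 / 2) + \<i> * of_real (a * b)) * exp (of_real (- b\<^sup>2 / 2))"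
    unfolding shift by (simp only: integral_mult_right_zero valf exp_of_real)
  also have "\<dots> = exp (c\<^sup>2 / 2)"
  proof -
    have "of_real (a\<^sup>2 / 2) + \<i> * of_real (a * b) + of_real (- b\<^sup>2 / 2) = c\<^sup>2 / 2"
      unfolding c by (simp add: power2_eq_square field_simps)
    then show ?thesis by (simp only: exp_add[symmetric])
  qed
  finally show "(LINT x|lborel. ?g x) = exp (c\<^sup>2 / 2)" .
qed

section \<open>Exponential moments of Brownian motion at a fixed time\<close>

context brownian_filtration
begin

lemma W_0: "AE \<omega> in M. W j 0 \<omega> = 0"
  using BM[of j] by (simp add: brownian_motion_def)

text \<open>Brownian motion starts at 0 only almost surely, so the law is taken from the increment
  since time 0; at s = 0 that law is degenerate and is treated apart.\<close>

lemma expectation_exp_W: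
  fixes c :: complex
  assumes "s \<ge> 0"
  shows "integrable M (\<lambda>\<omega>. exp (c * of_real (W j s \<omega>)))"
    and "expectation (\<lambda>\<omega>. exp (c * of_real (W j s \<omega>))) = exp (c\<^sup>2 * of_real s / 2)"
proof -
  have [measurable]: "W j s \<in> borel_measurable M" "W j 0 \<in> borel_measurable M" using assms by auto
  let ?X = "\<lambda>\<omega>. W j s \<omega> - W j 0 \<omega>"
  have AE: "AE \<omega> in M. exp (c * of_real (?X \<omega>)) = exp (c * of_real (W j s \<omega>))"
    using W_0[of j] by eventually_elim simp
  have "integrable M (\<lambda>\<omega>. exp (c * of_real (?X \<omega>))) \<and> expectation (\<lambda>\<omega>. exp (c * of_real (?X \<omega>))) = exp (c\<^sup>2 * of_real s / 2)"
  proof (cases "s = 0")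
    case True
    then show ?thesis by (simp add: prob_space)
  next
    case False
    with assms have "s > 0" by simp
    let ?G = "\<lambda>\<omega>. ?X \<omega> / sqrt s" and ?c = "c * of_real (sqrt s)"
    have D: "distributed M lborel ?G std_normal_density"
      using normal_standard_normal_convert[of "sqrt s" ?X 0] W_increment_distributed[of 0 s j] \<open>s > 0\<close> by simp
    have [measurable]: "?G \<in> measurable M lborel" by (rule distributed_measurable[OF D])
    have dist: "distr M lborel ?G = density lborel std_normal_density"
      by (rule distributed_distr_eq_density[OF D])
    have eq: "exp (c * of_real (?X \<omega>)) = exp (?c * of_real (?G \<omega>))" for \<omega>
      using \<open>s > 0\<close> by (simp flip: of_real_mult)
    have "integrable (distr M lborel ?G) (\<lambda>x. exp (?c * of_real x))"
      unfolding dist using std_normal_exp(1)[of ?c]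
      by (subst integrable_density) (auto simp: normal_density_nonneg)
    then have "integrable M (\<lambda>\<omega>. exp (?c * of_real (?G \<omega>)))"
      by (subst (asm) integrable_distr_eq) auto
    moreover have "expectation (\<lambda>\<omega>. exp (?c * of_real (?G \<omega>))) = (LINT x|distr M lborel ?G. exp (?c * of_real x))"
      by (rule integral_distr[symmetric]) auto
    moreover have "\<dots> = exp (?c\<^sup>2 / 2)"
      unfolding dist using std_normal_exp(2)[of ?c]
      by (subst integral_density) (auto simp: normal_density_nonneg)
    moreover have "?c\<^sup>2 = c\<^sup>2 * of_real s"
      using \<open>s > 0\<close> by (simp add: power_mult_distrib flip: of_real_power)
    ultimately show ?thesis by (simp only: eq)
  qed
  moreover have "integrable M (\<lambda>\<omega>. exp (c * of_real (?X \<omega>))) \<longleftrightarrow> integrable M (\<lambda>\<omega>. exp (c * of_real (W j s \<omega>)))"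
    by (rule integrable_cong_AE[OF _ _ AE]) measurable
  moreover have "expectation (\<lambda>\<omega>. exp (c * of_real (?X \<omega>))) = expectation (\<lambda>\<omega>. exp (c * of_real (W j s \<omega>)))"
    by (rule integral_cong_AE[OF _ _ AE]) measurable
  ultimately show "integrable M (\<lambda>\<omega>. exp (c * of_real (W j s \<omega>)))"
    and "expectation (\<lambda>\<omega>. exp (c * of_real (W j s \<omega>))) = exp (c\<^sup>2 * of_real s / 2)" by auto
qed

text \<open>Independence of the whole paths is evaluated at the single time s, after which the
  expectation of the product factorises.\<close>

lemma expectation_exp_sum_W:
  fixes c :: "'l \<Rightarrow> complex"
  assumes "indep_processes M W" "s \<ge> 0"
  shows "integrable M (\<lambda>\<omega>. exp (\<Sum>j\<in>UNIV. c j * of_real (W j s \<omega>)))"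
    and "expectation (\<lambda>\<omega>. exp (\<Sum>j\<in>UNIV. c j * of_real (W j s \<omega>))) = exp (of_real s * (\<Sum>j\<in>UNIV. (c j)\<^sup>2) / 2)"
proof -
  have "indep_vars (\<lambda>_. borel) (\<lambda>j \<omega>. exp (c j * of_real ((\<lambda>t\<in>{0..}. W j t \<omega>) s))) UNIV"
    using assms(1) unfolding indep_processes_def
  proof (rule indep_vars_compose2)
    fix j :: 'l
    have [measurable]: "(\<lambda>f. f s) \<in> measurable (\<Pi>\<^sub>M t\<in>{0..}. borel) (borel :: real measure)"
      using assms(2) by (intro measurable_component_singleton) auto
    show "(\<lambda>f. exp (c j * of_real (f s))) \<in> measurable (\<Pi>\<^sub>M t\<in>{0..}. borel) borel"
      by measurable
  qed
  then have ind: "indep_vars (\<lambda>_. borel) (\<lambda>j \<omega>. exp (c j * of_real (W j s \<omega>))) UNIV"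
    using assms(2) by simp
  note exp_W = expectation_exp_W[OF assms(2)]
  have "integrable M (\<lambda>\<omega>. \<Prod>j\<in>UNIV. exp (c j * of_real (W j s \<omega>)))"
    by (rule indep_vars_integrable[OF _ ind exp_W(1)]) simp
  then show "integrable M (\<lambda>\<omega>. exp (\<Sum>j\<in>UNIV. c j * of_real (W j s \<omega>)))"
    by (simp add: exp_sum)
  have "expectation (\<lambda>\<omega>. \<Prod>j\<in>UNIV. exp (c j * of_real (W j s \<omega>))) = (\<Prod>j\<in>UNIV. exp ((c j)\<^sup>2 * of_real s / 2))"
    by (subst indep_vars_lebesgue_integral[OF _ ind exp_W(1)]) (simp_all add: exp_W(2))
  also have "\<dots> = exp (of_real s * (\<Sum>j\<in>UNIV. (c j)\<^sup>2) / 2)"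
    by (simp add: exp_sum[symmetric] sum_distrib_left sum_divide_distrib mult.commute)
  finally show "expectation (\<lambda>\<omega>. exp (\<Sum>j\<in>UNIV. c j * of_real (W j s \<omega>))) = exp (of_real s * (\<Sum>j\<in>UNIV. (c j)\<^sup>2) / 2)"
    by (simp add: exp_sum)
qed

end

text \<open>Serves the drift part of the driver, whose trapezoidal sums converge path by path. Only
  the oscillation at distances below \<delta> enters, so the error is uniform over
  partitions.\<close>

lemma trapezoid_sum_integral:
  fixes y :: "real \<Rightarrow> complex"
  assumes "continuous_on {0..s} y" "is_partition s n p" "\<forall>i<n. p (Suc i) - p i < \<delta>"
    and osc: "\<And>u v. u \<in> {0..s} \<Longrightarrow> v \<in> {0..s} \<Longrightarrow> \<bar>u - v\<bar> < \<delta> \<Longrightarrow> norm (y u - y v) \<le> \<kappa>"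
  shows "norm ((\<Sum>i<n. (y (p i) + y (p (Suc i))) / 2 * of_real (p (Suc i) - p i)) - integral {0..s} y) \<le> \<kappa> * s"
proof -
  have p: "p 0 = 0" "p n = s" "\<And>i. i < n \<Longrightarrow> p i \<le> p (Suc i)"
    using assms(2) by (auto simp: is_partition_def)
  have mono: "p i \<le> p j" if "i \<le> j" "j \<le> n" for i j
    using that
  proof (induction j rule: dec_induct)
    case (step j)
    then show ?case using p(3)[of j] by simp
  qed simp
  have pin: "p i \<in> {0..s}" if "i \<le> n" for i
    using mono[of 0 i] mono[of i n] that p(1,2) by simp
  have "norm ((\<Sum>i<k. (y (p i) + y (p (Suc i))) / 2 * of_real (p (Suc i) - p i)) - integral {0..p k} y) \<le> \<kappa> * p k" if "k \<le> n" for k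
    using that
  proof (induction k)
    case 0
    then show ?case using p by simp
  next
    case (Suc k)
    let ?m = "(y (p k) + y (p (Suc k))) / 2"
    have k: "p k \<in> {0..s}" "p (Suc k) \<in> {0..s}" "p k \<le> p (Suc k)" "p (Suc k) - p k < \<delta>"
      using Suc.prems pin p(3) assms(3) by auto
    have int: "y integrable_on {0..p (Suc k)}" "y integrable_on {p k..p (Suc k)}"
      using k by (auto intro!: integrable_continuous_interval continuous_on_subset[OF assms(1)])
    have split: "integral {0..p (Suc k)} y = integral {0..p k} y + integral {p k..p (Suc k)} y"
      by (rule Henstock_Kurzweil_Integration.integral_combine[symmetric]) (use k int in auto)
    have hi: "((\<lambda>u. y u - ?m) has_integral (integral {p k..p (Suc k)} y - (p (Suc k) - p k) *\<^sub>R ?m)) {p k..p (Suc k)}"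
      using has_integral_diff[OF integrable_integral[OF int(2)] has_integral_const_real[of ?m "p k" "p (Suc k)"]] k(3)
      by simp
    have bd: "norm (y u - ?m) \<le> \<kappa>" if "u \<in> {p k..p (Suc k)}" for u
    proof -
      have "norm (y u - y (p k)) \<le> \<kappa>" "norm (y u - y (p (Suc k))) \<le> \<kappa>"
        using that k by (auto intro!: osc)
      moreover have "y u - ?m = ((y u - y (p k)) + (y u - y (p (Suc k)))) / 2"
        by (simp add: field_simps)
      ultimately show ?thesis
        using norm_triangle_ineq[of "y u - y (p k)" "y u - y (p (Suc k))"] by (simp only: norm_divide) simp
    qed
    have "0 \<le> \<kappa>"
      using order_trans[OF norm_ge_zero bd[of "p k"]] k(3) by simp
    then have "norm (integral {p k..p (Suc k)} y - (p (Suc k) - p k) *\<^sub>R ?m) \<le> \<kappa> * measure lborel {p k..p (Suc k)}"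
      by (rule has_integral_bound_real[OF _ _ hi]) (use bd in auto)
    then have "norm (integral {p k..p (Suc k)} y - (p (Suc k) - p k) *\<^sub>R ?m) \<le> \<kappa> * (p (Suc k) - p k)"
      using k(3) by simp
    then have step: "norm (?m * of_real (p (Suc k) - p k) - integral {p k..p (Suc k)} y) \<le> \<kappa> * (p (Suc k) - p k)"
      by (simp add: norm_minus_commute scaleR_conv_of_real mult.commute)
    let ?S = "\<Sum>i<k. (y (p i) + y (p (Suc i))) / 2 * of_real (p (Suc i) - p i)"
    have eq: "(\<Sum>i<Suc k. (y (p i) + y (p (Suc i))) / 2 * of_real (p (Suc i) - p i)) - integral {0..p (Suc k)} y =
      (?S - integral {0..p k} y) + (?m * of_real (p (Suc k) - p k) - integral {p k..p (Suc k)} y)"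
      unfolding split by simp
    have "norm (?S - integral {0..p k} y) \<le> \<kappa> * p k"
      using Suc by simp
    with step show ?case
      unfolding eq by (intro norm_triangle_le) (simp add: algebra_simps)
  qed
  from this[of n] show ?thesis using p by simp
qed

section \<open>Reduction to the scalar equation\<close>

text \<open>The rows of \<open>P\<close> as complex-valued functionals on real vectors. Being
  real-linear and bounded, they pass through sums, time integrals and Stratonovich sums.\<close>

definition eigen_coord :: "complex^'n^'n \<Rightarrow> 'n \<Rightarrow> real^'n \<Rightarrow> complex" where
  "eigen_coord P i v = (P *v complexify_vec v) $ i"

lemma bounded_linear_eigen_coord: "bounded_linear (eigen_coord P i)"
  unfolding linear_conv_bounded_linear[symmetric]
  by (rule linearI)
    (auto simp: eigen_coord_def complexify_vec_def matrix_vector_mult_def sum.distrib[symmetric]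
      scaleR_conv_of_real[where 'a = complex] sum_distrib_left algebra_simps intro!: sum.cong)

lemma complexify_vec_mult: "complexify_vec (A *v v) = complexify_mat A *v complexify_vec v"
  by (simp add: complexify_vec_def matrix_vector_mult_def map_matrix_def vec_eq_iff)

lemma matrix_inv_mult_left: "invertible P \<Longrightarrow> matrix_inv P ** P = mat 1"
  unfolding invertible_def matrix_inv_def by (rule someI2_ex) auto

lemma diag_matrix_mult: "(diag_matrix a *v w) $ i = a i * w $ i" for a :: "'n::finite \<Rightarrow> 'b::semiring_1"
proof -
  have "(diag_matrix a *v w) $ i = (\<Sum>k\<in>UNIV. if k = i then a i * w $ i else 0)"
    unfolding matrix_vector_mult_def diag_matrix_def vec_lambda_beta by (rule sum.cong) auto
  then show ?thesis by simp
qed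

text \<open>From P A = D P with D diagonal: each row of \<open>P\<close> is a left eigenvector of
  \<open>A\<close>.\<close>

lemma eigen_coord_mult:
  fixes P :: "complex^'n^'n" and A :: "real^'n^'n"
  assumes "invertible P" "P ** complexify_mat A ** matrix_inv P = diag_matrix \<alpha>"
  shows "eigen_coord P i (A *v v) = \<alpha> i * eigen_coord P i v"
proof -
  have "P ** complexify_mat A = diag_matrix \<alpha> ** P"
    unfolding assms(2)[symmetric] using matrix_inv_mult_left[OF assms(1)]
    by (simp add: matrix_mul_assoc[symmetric])
  then have "P *v (complexify_mat A *v complexify_vec v) = diag_matrix \<alpha> *v (P *v complexify_vec v)"
    by (simp add: matrix_vector_mul_assoc)
  then have "eigen_coord P i (A *v v) = (diag_matrix \<alpha> *v (P *v complexify_vec v)) $ i"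
    by (simp add: eigen_coord_def complexify_vec_mult)
  also have "\<dots> = \<alpha> i * eigen_coord P i v"
    by (simp add: diag_matrix_mult eigen_coord_def)
  finally show ?thesis by simp
qed

text \<open>v is \<open>matrix_inv P\<close> applied to its coordinates, so its squared norm is the
  Hermitian form of \<Gamma> in them.\<close>

lemma norm_sq_eigen_coord:
  fixes P :: "complex^'n^'n" and v :: "real^'n"
  assumes "invertible P"
  defines "\<Gamma> \<equiv> conjugate_transpose (matrix_inv P) ** matrix_inv P"
  shows "complex_of_real ((norm v)\<^sup>2) = (\<Sum>i\<in>UNIV. \<Sum>k\<in>UNIV. cnj (eigen_coord P i v) * \<Gamma> $ i $ k * eigen_coord P k v)"
proof -
  let ?Q = "matrix_inv P" and ?z = "\<lambda>i. eigen_coord P i v"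
  have Q: "?Q *v (P *v complexify_vec v) = complexify_vec v"
    using matrix_inv_mult_left[OF assms(1)] by (simp add: matrix_vector_mul_assoc)
  have v: "complex_of_real (v $ l) = (\<Sum>i\<in>UNIV. ?Q $ l $ i * ?z i)" for l
  proof -
    have "complex_of_real (v $ l) = complexify_vec v $ l" by (simp add: complexify_vec_def)
    also have "\<dots> = (?Q *v (P *v complexify_vec v)) $ l" by (simp only: Q)
    also have "\<dots> = (\<Sum>i\<in>UNIV. ?Q $ l $ i * ?z i)"
      unfolding matrix_vector_mult_def[of ?Q] eigen_coord_def by simp
    finally show ?thesis .
  qed
  \<comment> \<open>The entries of v are real; conjugating one factor prepares the sesquilinear
    expansion.\<close>
  have "complex_of_real ((norm v)\<^sup>2) = (\<Sum>l\<in>UNIV. cnj (complex_of_real (v $ l)) * complex_of_real (v $ l))"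
    unfolding power2_norm_eq_inner inner_vec_def by simp
  also have "\<dots> = (\<Sum>l\<in>UNIV. \<Sum>i\<in>UNIV. \<Sum>k\<in>UNIV. cnj (?z i) * (cnj (?Q $ l $ i) * ?Q $ l $ k) * ?z k)"
    unfolding v cnj_sum complex_cnj_mult sum_product by (simp add: mult.assoc mult.left_commute)
  also have "\<dots> = (\<Sum>i\<in>UNIV. \<Sum>k\<in>UNIV. \<Sum>l\<in>UNIV. cnj (?z i) * (cnj (?Q $ l $ i) * ?Q $ l $ k) * ?z k)"
    by (subst sum.swap) (intro sum.cong refl sum.swap)
  also have "\<dots> = (\<Sum>i\<in>UNIV. \<Sum>k\<in>UNIV. cnj (?z i) * \<Gamma> $ i $ k * ?z k)"
    by (simp add: \<Gamma>_def matrix_matrix_mult_def conjugate_transpose_def sum_distrib_left sum_distrib_right)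
  finally show ?thesis .
qed

section \<open>Projection of the vector equation onto one eigen-coordinate\<close>

context brownian_filtration
begin

text \<open>An eigenfunctional turns each matrix into its eigenvalue, so the vector sums and the
  trapezoidal drift sum assemble into a single sum against the driver.\<close>

lemma stratonovich_sum_eigen_coord:
  fixes X :: "real \<Rightarrow> 'a \<Rightarrow> real^'n"
  assumes A: "\<And>v. eigen_coord P i (A *v v) = \<alpha> * eigen_coord P i v"
    and B: "\<And>j v. eigen_coord P i (B j *v v) = \<beta> j * eigen_coord P i v"
  defines "Z \<equiv> \<lambda>s \<omega>. eigen_coord P i (X s \<omega>)"
  shows "(\<Sum>l<n. (Z (p l) \<omega> + Z (p (Suc l)) \<omega>) / 2 * (linear_driver \<alpha> \<beta> W (p (Suc l)) \<omega> - linear_driver \<alpha> \<beta> W (p l) \<omega>)) =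
    \<alpha> * (\<Sum>l<n. (Z (p l) \<omega> + Z (p (Suc l)) \<omega>) / 2 * of_real (p (Suc l) - p l)) +
    (\<Sum>j\<in>UNIV. eigen_coord P i (stratonovich_sum (\<lambda>s \<omega>. B j *v X s \<omega>) (W j) n p \<omega>))"
proof -
  interpret L: bounded_linear "eigen_coord P i" by (rule bounded_linear_eigen_coord)
  let ?m = "\<lambda>l. (Z (p l) \<omega> + Z (p (Suc l)) \<omega>) / 2"
  have S: "eigen_coord P i (stratonovich_sum (\<lambda>s \<omega>. B j *v X s \<omega>) (W j) n p \<omega>) =
      (\<Sum>l<n. ?m l * (\<beta> j * of_real (W j (p (Suc l)) \<omega> - W j (p l) \<omega>)))" for j
    unfolding stratonovich_sum_def L.sum L.scaleR L.add B
    by (intro sum.cong refl) (simp add: Z_def scaleR_conv_of_real field_simps)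
  have d: "linear_driver \<alpha> \<beta> W (p (Suc l)) \<omega> - linear_driver \<alpha> \<beta> W (p l) \<omega> =
      \<alpha> * of_real (p (Suc l) - p l) + (\<Sum>j\<in>UNIV. \<beta> j * of_real (W j (p (Suc l)) \<omega> - W j (p l) \<omega>))" for l
    by (simp add: linear_driver_def algebra_simps sum_subtractf)
  have "(\<Sum>l<n. ?m l * (linear_driver \<alpha> \<beta> W (p (Suc l)) \<omega> - linear_driver \<alpha> \<beta> W (p l) \<omega>)) =
    (\<Sum>l<n. ?m l * (\<alpha> * of_real (p (Suc l) - p l))) +
    (\<Sum>l<n. \<Sum>j\<in>UNIV. ?m l * (\<beta> j * of_real (W j (p (Suc l)) \<omega> - W j (p l) \<omega>)))"
    unfolding d distrib_left sum.distrib sum_distrib_left ..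
  also have "(\<Sum>l<n. ?m l * (\<alpha> * of_real (p (Suc l) - p l))) = \<alpha> * (\<Sum>l<n. ?m l * of_real (p (Suc l) - p l))"
    unfolding sum_distrib_left by (intro sum.cong refl) (simp add: mult.left_commute)
  also have "(\<Sum>l<n. \<Sum>j\<in>UNIV. ?m l * (\<beta> j * of_real (W j (p (Suc l)) \<omega> - W j (p l) \<omega>))) =
      (\<Sum>j\<in>UNIV. eigen_coord P i (stratonovich_sum (\<lambda>s \<omega>. B j *v X s \<omega>) (W j) n p \<omega>))"
    unfolding S by (rule sum.swap)
  finally show ?thesis .
qed

text \<open>The integral is defined through \<open>measure\<close>, which is 0 on non-measurable
  sets; for that bound to say anything about the errors, the sums must be measurable.\<close>

lemma stratonovich_sum_measurable:
  fixes Y :: "real \<Rightarrow> 'a \<Rightarrow> 'c::euclidean_space"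
  assumes "is_partition s n p" "0 \<le> s" "\<And>u. 0 \<le> u \<Longrightarrow> Y u \<in> borel_measurable M"
  shows "stratonovich_sum Y (W j) n p \<in> borel_measurable M"
proof -
  have p0: "0 \<le> p l" if "l \<le> n" for l
    using that
  proof (induction l)
    case (Suc l)
    then have "0 \<le> p l" "p l \<le> p (Suc l)" using assms(1) by (auto simp: is_partition_def)
    then show ?case by linarith
  qed (use assms(1) in \<open>simp add: is_partition_def\<close>)
  show ?thesis
    unfolding stratonovich_sum_def[abs_def]
    using p0 by (intro borel_measurable_sum borel_measurable_scaleR borel_measurable_diff borel_measurable_add
      borel_measurable_const W_measurable assms(3)) auto
qed

lemma likely_stratonovich:
  fixes Y :: "real \<Rightarrow> 'a \<Rightarrow> 'c::euclidean_space"
  assumes "has_stratonovich_integral M Y (W j) s S" "0 \<le> s" "0 < \<epsilon>" "0 < \<eta>"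
    and Y: "\<And>u. 0 \<le> u \<Longrightarrow> Y u \<in> borel_measurable M"
  shows "\<exists>\<delta>>0. \<forall>n p. is_partition s n p \<and> (\<forall>l<n. p (Suc l) - p l < \<delta>) \<longrightarrow>
    likely \<eta> (\<lambda>\<omega>. norm (stratonovich_sum Y (W j) n p \<omega> - S \<omega>) \<le> \<epsilon>)"
proof -
  have [measurable]: "S \<in> borel_measurable M"
    using assms(1) by (simp add: has_stratonovich_integral_def)
  from assms(1)[unfolded has_stratonovich_integral_def, THEN conjunct2, rule_format, OF assms(3,4)]
  obtain \<delta> where \<delta>: "\<delta> > 0" "\<forall>n p. is_partition s n p \<and> (\<forall>l<n. p (Suc l) - p l < \<delta>) \<longrightarrow>
      prob {\<omega>\<in>space M. norm (stratonovich_sum Y (W j) n p \<omega> - S \<omega>) > \<epsilon>} < \<eta>"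
    by (elim exE conjE)
  show ?thesis
  proof (intro exI[of _ \<delta>] conjI \<delta>(1) allI impI)
    fix n p assume p: "is_partition s n p \<and> (\<forall>l<n. p (Suc l) - p l < \<delta>)"
    have [measurable]: "stratonovich_sum Y (W j) n p \<in> borel_measurable M"
      using p assms(2) Y by (intro stratonovich_sum_measurable[of s]) auto
    have "{\<omega>\<in>space M. \<not> norm (stratonovich_sum Y (W j) n p \<omega> - S \<omega>) \<le> \<epsilon>} \<in> events"
      by measurable
    moreover have "prob {\<omega>\<in>space M. \<not> norm (stratonovich_sum Y (W j) n p \<omega> - S \<omega>) \<le> \<epsilon>} \<le> \<eta>"
      using \<delta>(2)[THEN spec[of _ n], THEN spec[of _ p], THEN mp, OF p] by (simp add: not_le)
    ultimately show "likely \<eta> (\<lambda>\<omega>. norm (stratonovich_sum Y (W j) n p \<omega> - S \<omega>) \<le> \<epsilon>)"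
      by (rule likely_Collect)
  qed
qed

text \<open>Half of \<epsilon> and \<eta> pays for the noise, shared equally by the c drivers; the
  other half pays for the drift, whose mesh comes from a modulus of continuity of the projected
  path.\<close>

lemma scalar_linear_sde_eigen_coord:
  fixes P :: "complex^'n^'n"
  assumes sol: "strong_solution M F W A B x X" and "0 < t"
    and A: "\<And>v. eigen_coord P i (A *v v) = \<alpha> * eigen_coord P i v"
    and B: "\<And>j v. eigen_coord P i (B j *v v) = \<beta> j * eigen_coord P i v"
  shows "scalar_linear_sde M F W \<alpha> \<beta> (\<lambda>s \<omega>. eigen_coord P i (X s \<omega>)) t"
proof -
  interpret L: bounded_linear "eigen_coord P i" by (rule bounded_linear_eigen_coord)
  let ?Z = "\<lambda>s \<omega>. eigen_coord P i (X s \<omega>)" and ?H = "linear_driver \<alpha> \<beta> W"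
  have X_adapted: "X s \<in> borel_measurable (F s)" if "s \<ge> 0" for s
    using sol that by (simp add: strong_solution_def adapted_def)
  note X_measurable = measurable_filt[OF X_adapted]
  have X_continuous: "AE \<omega> in M. continuous_on {0..} (\<lambda>s. X s \<omega>)"
    using sol by (simp add: strong_solution_def continuous_paths_def)
  have L_borel: "eigen_coord P i \<in> borel_measurable borel"
    by (intro borel_measurable_continuous_onI L.continuous_on continuous_on_id)
  have Z_adapted: "?Z s \<in> borel_measurable (F s)" if "s \<ge> 0" for s
    by (rule measurable_compose[OF X_adapted[OF that] L_borel])
  have Z_continuous: "AE \<omega> in M. continuous_on {0..} (\<lambda>s. ?Z s \<omega>)"
    using X_continuous by eventually_elim (intro L.continuous_on)
  have "\<exists>\<delta>>0. \<forall>n p. is_partition s n p \<and> (\<forall>l<n. p (Suc l) - p l < \<delta>) \<longrightarrow>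
      likely \<eta> (\<lambda>\<omega>. norm ((\<Sum>l<n. (?Z (p l) \<omega> + ?Z (p (Suc l)) \<omega>) / 2 * (?H (p (Suc l)) \<omega> - ?H (p l) \<omega>)) - (?Z s \<omega> - ?Z 0 \<omega>)) \<le> \<epsilon>)"
    if s: "0 \<le> s" and "0 < \<epsilon>" "0 < \<eta>" for s \<epsilon> \<eta>
  proof -
    from sol s obtain S where S: "\<And>j. has_stratonovich_integral M (\<lambda>s \<omega>. B j *v X s \<omega>) (W j) s (S j)"
      and X_eq: "AE \<omega> in M. X s \<omega> = x + integral {0..s} (\<lambda>s. A *v X s \<omega>) + (\<Sum>j\<in>UNIV. S j \<omega>)"
      unfolding strong_solution_def by blast
    have X_0: "AE \<omega> in M. X 0 \<omega> = x" using sol by (simp add: strong_solution_def)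
    define c where "c = real CARD('l)"
    have "c > 0" by (simp add: c_def)
    obtain K where K: "K > 0" "\<And>v. norm (eigen_coord P i v) \<le> norm v * K"
      using L.pos_bounded by blast
    obtain \<epsilon>' where e: "\<epsilon>' > 0" "(c * K) * \<epsilon>' \<le> \<epsilon> / 2"
      using small_factor[of "c * K" "\<epsilon> / 2"] K \<open>c > 0\<close> \<open>0 < \<epsilon>\<close> by auto
    obtain \<kappa> where \<kappa>: "\<kappa> > 0" "(norm \<alpha> * s) * \<kappa> \<le> \<epsilon> / 2"
      using small_factor[of "norm \<alpha> * s" "\<epsilon> / 2"] s \<open>0 < \<epsilon>\<close> by auto
    have BX: "(\<lambda>\<omega>. B j *v X u \<omega>) \<in> borel_measurable M" if "0 \<le> u" for j u
    proof (rule measurable_compose[OF X_measurable[OF that]])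
      show "(*v) (B j) \<in> borel_measurable borel"
        by (intro borel_measurable_continuous_onI linear_continuous_on matrix_vector_mul_bounded_linear)
    qed
    have "\<eta> / (2 * c) > 0" using \<open>c > 0\<close> \<open>0 < \<eta>\<close> by simp
    define D where "D j \<delta> \<longleftrightarrow> \<delta> > 0 \<and> (\<forall>n p. is_partition s n p \<and> (\<forall>l<n. p (Suc l) - p l < \<delta>) \<longrightarrow>
      likely (\<eta> / (2 * c)) (\<lambda>\<omega>. norm (stratonovich_sum (\<lambda>s \<omega>. B j *v X s \<omega>) (W j) n p \<omega> - S j \<omega>) \<le> \<epsilon>'))" for j \<delta>
    have "\<exists>\<delta>. D j \<delta>" for j
      unfolding D_def by (rule likely_stratonovich[OF S s e(1) \<open>\<eta> / (2 * c) > 0\<close> BX])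
    then obtain \<delta> where D: "\<And>j. D j (\<delta> j)" by metis
    have \<delta>: "\<delta> j > 0" for j using D[of j] by (simp add: D_def)
    obtain \<delta>\<^sub>0 where \<delta>0: "\<delta>\<^sub>0 > 0" "likely (\<eta> / 2) (\<lambda>\<omega>. \<forall>u\<in>{0..s}. \<forall>v\<in>{0..s}. \<bar>u - v\<bar> < \<delta>\<^sub>0 \<longrightarrow> dist (?Z u \<omega>) (?Z v \<omega>) \<le> \<kappa>)"
      using likely_uniformly_continuous[of ?Z \<kappa> "\<eta> / 2" s, OF measurable_filt[OF Z_adapted] Z_continuous] \<kappa> s \<open>0 < \<eta>\<close> by auto
    \<comment> \<open>One mesh for the drift and all drivers, available because the drivers are
      finitely many.\<close>
    define \<delta>' where "\<delta>' = Min (insert \<delta>\<^sub>0 (range \<delta>))"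
    have \<delta>': "\<delta>' > 0" "\<delta>' \<le> \<delta>\<^sub>0" "\<And>j. \<delta>' \<le> \<delta> j"
      unfolding \<delta>'_def using \<delta> \<delta>0(1) by (auto simp del: Min_insert intro!: Min_le)
    show ?thesis
    proof (intro exI[of _ \<delta>'] conjI \<delta>'(1) allI impI)
      fix n p assume p: "is_partition s n p \<and> (\<forall>l<n. p (Suc l) - p l < \<delta>')"
      let ?S = "\<lambda>j. stratonovich_sum (\<lambda>s \<omega>. B j *v X s \<omega>) (W j) n p"
      have "likely (\<eta> / (2 * c)) (\<lambda>\<omega>. norm (?S j \<omega> - S j \<omega>) \<le> \<epsilon>')" for j
      proof -
        have "\<forall>l<n. p (Suc l) - p l < \<delta> j" using p \<delta>'(3)[of j] order.strict_trans2 by blast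
        with p have "is_partition s n p \<and> (\<forall>l<n. p (Suc l) - p l < \<delta> j)" by (intro conjI) simp_all
        from D[of j, unfolded D_def, THEN conjunct2, THEN spec[of _ n], THEN spec[of _ p], THEN mp, OF this]
        show ?thesis .
      qed
      then have all: "likely (c * (\<eta> / (2 * c))) (\<lambda>\<omega>. \<forall>j\<in>UNIV. norm (?S j \<omega> - S j \<omega>) \<le> \<epsilon>')"
        unfolding c_def by (intro likely_ball) auto
      have "AE \<omega> in M. continuous_on {0..} (\<lambda>s. X s \<omega>) \<and> X 0 \<omega> = x \<and>
          X s \<omega> = x + integral {0..s} (\<lambda>s. A *v X s \<omega>) + (\<Sum>j\<in>UNIV. S j \<omega>)"
        using X_continuous X_0 X_eq by eventually_elim simp
      from likely_conj[OF likely_AE[OF this order_refl] likely_conj[OF all \<delta>0(2)]]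
      show "likely \<eta> (\<lambda>\<omega>. norm ((\<Sum>l<n. (?Z (p l) \<omega> + ?Z (p (Suc l)) \<omega>) / 2 * (?H (p (Suc l)) \<omega> - ?H (p l) \<omega>)) - (?Z s \<omega> - ?Z 0 \<omega>)) \<le> \<epsilon>)"
      proof (rule likely_mono, elim conjE)
        fix \<omega>
        assume cont: "continuous_on {0..} (\<lambda>s. X s \<omega>)" and x0: "X 0 \<omega> = x"
          and eq: "X s \<omega> = x + integral {0..s} (\<lambda>s. A *v X s \<omega>) + (\<Sum>j\<in>UNIV. S j \<omega>)"
          and Sj: "\<forall>j\<in>UNIV. norm (?S j \<omega> - S j \<omega>) \<le> \<epsilon>'"
          and osc: "\<forall>u\<in>{0..s}. \<forall>v\<in>{0..s}. \<bar>u - v\<bar> < \<delta>\<^sub>0 \<longrightarrow> dist (?Z u \<omega>) (?Z v \<omega>) \<le> \<kappa>"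
        let ?T = "\<Sum>l<n. (?Z (p l) \<omega> + ?Z (p (Suc l)) \<omega>) / 2 * of_real (p (Suc l) - p l)"
        have cont': "continuous_on {0..s} (\<lambda>s. X s \<omega>)"
          using cont by (rule continuous_on_subset) auto
        have "norm (?T - integral {0..s} (\<lambda>u. ?Z u \<omega>)) \<le> \<kappa> * s"
        proof (rule trapezoid_sum_integral[where \<delta> = \<delta>'])
          show "continuous_on {0..s} (\<lambda>u. ?Z u \<omega>)" by (intro L.continuous_on cont')
          show "norm (?Z u \<omega> - ?Z v \<omega>) \<le> \<kappa>" if "u \<in> {0..s}" "v \<in> {0..s}" "\<bar>u - v\<bar> < \<delta>'" for u v
            using osc that \<delta>'(2) by (auto simp: dist_norm)
        qed (use p in auto)
        then have "norm (\<alpha> * (?T - integral {0..s} (\<lambda>u. ?Z u \<omega>))) \<le> norm \<alpha> * (\<kappa> * s)"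
          unfolding norm_mult by (intro mult_left_mono) auto
        moreover have "norm \<alpha> * (\<kappa> * s) \<le> \<epsilon> / 2"
          using \<kappa>(2) by (simp add: mult_ac)
        ultimately have T: "norm (\<alpha> * (?T - integral {0..s} (\<lambda>u. ?Z u \<omega>))) \<le> \<epsilon> / 2"
          by (rule order_trans)
        have "norm (\<Sum>j\<in>UNIV. eigen_coord P i (?S j \<omega> - S j \<omega>)) \<le> (\<Sum>j\<in>(UNIV :: 'l set). \<epsilon>' * K)"
          using Sj K(1) by (intro sum_norm_le order_trans[OF K(2)] mult_right_mono) auto
        then have D: "norm (\<Sum>j\<in>UNIV. eigen_coord P i (?S j \<omega> - S j \<omega>)) \<le> \<epsilon> / 2"
          using e(2) by (simp add: c_def mult.assoc mult.commute mult.left_commute)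
        have "continuous_on {0..s} (\<lambda>u. A *v X u \<omega>)"
          by (intro bounded_linear.continuous_on[OF matrix_vector_mul_bounded_linear] cont')
        then have "(\<lambda>u. A *v X u \<omega>) integrable_on {0..s}"
          by (rule integrable_continuous_interval)
        then have "eigen_coord P i (integral {0..s} (\<lambda>u. A *v X u \<omega>)) = integral {0..s} (\<lambda>u. \<alpha> * ?Z u \<omega>)"
          using integral_linear[OF _ bounded_linear_eigen_coord, of "\<lambda>u. A *v X u \<omega>" "{0..s}" P i]
          by (simp add: o_def A)
        then have "?Z s \<omega> - ?Z 0 \<omega> = \<alpha> * integral {0..s} (\<lambda>u. ?Z u \<omega>) + (\<Sum>j\<in>UNIV. eigen_coord P i (S j \<omega>))"
          unfolding eq x0 by (simp add: L.add L.sum)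
        then have "(\<Sum>l<n. (?Z (p l) \<omega> + ?Z (p (Suc l)) \<omega>) / 2 * (?H (p (Suc l)) \<omega> - ?H (p l) \<omega>)) - (?Z s \<omega> - ?Z 0 \<omega>) =
          \<alpha> * (?T - integral {0..s} (\<lambda>u. ?Z u \<omega>)) + (\<Sum>j\<in>UNIV. eigen_coord P i (?S j \<omega> - S j \<omega>))"
          unfolding stratonovich_sum_eigen_coord[of P i A \<alpha> B \<beta>, OF A B]
          by (simp add: L.diff sum_subtractf right_diff_distrib)
        then show "norm ((\<Sum>l<n. (?Z (p l) \<omega> + ?Z (p (Suc l)) \<omega>) / 2 * (?H (p (Suc l)) \<omega> - ?H (p l) \<omega>)) - (?Z s \<omega> - ?Z 0 \<omega>)) \<le> \<epsilon>"
          using norm_triangle_le[of "\<alpha> * (?T - integral {0..s} (\<lambda>u. ?Z u \<omega>))" "\<Sum>j\<in>UNIV. eigen_coord P i (?S j \<omega> - S j \<omega>)" \<epsilon>]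
            T D by simp
      qed (use \<open>c > 0\<close> in simp)
    qed
  qed
  then show ?thesis
    using Z_adapted Z_continuous \<open>0 < t\<close> by unfold_locales auto
qed

text \<open>The scalar theory assumes t > 0; at t = 0 both sides agree by the initial condition and
  because the driver starts at 0 almost surely.\<close>

lemma eigen_coord_solution:
  fixes P :: "complex^'n^'n"
  assumes sol: "strong_solution M F W A B x X" and "0 \<le> t"
    and A: "\<And>v. eigen_coord P i (A *v v) = \<alpha> * eigen_coord P i v"
    and B: "\<And>j v. eigen_coord P i (B j *v v) = \<beta> j * eigen_coord P i v"
  shows "AE \<omega> in M. eigen_coord P i (X t \<omega>) = eigen_coord P i x * exp (linear_driver \<alpha> \<beta> W t \<omega>)"
proof -
  have X_0: "AE \<omega> in M. X 0 \<omega> = x" using sol by (simp add: strong_solution_def)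
  have "AE \<omega> in M. \<forall>j\<in>UNIV. W j 0 \<omega> = 0"
    by (intro AE_finite_allI W_0) auto
  then have H_0: "AE \<omega> in M. linear_driver \<alpha> \<beta> W 0 \<omega> = 0"
    by eventually_elim (simp add: linear_driver_def)
  show ?thesis
  proof (cases "t = 0")
    case True
    show ?thesis
      unfolding True using X_0 H_0 by eventually_elim simp
  next
    case False
    then interpret Z: scalar_linear_sde M F W \<alpha> \<beta> "\<lambda>s \<omega>. eigen_coord P i (X s \<omega>)" t
      using scalar_linear_sde_eigen_coord[OF sol _ A B] \<open>0 \<le> t\<close> by simp
    show ?thesis
      using Z.scalar_solution X_0 H_0 by eventually_elim simp
  qed
qed

end

text \<open>Integrability is part of the conclusion because \<open>expectation\<close> is 0 by
  convention for non-integrable functions, so the formula alone would not assert a finite second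
  moment. The identity is stated in the complex numbers, as the single summands on the right need
  not be real.\<close>

theorem lemma2p10:
  fixes M :: "'a measure" and F :: "real \<Rightarrow> 'a measure"
    and W :: "'l::finite \<Rightarrow> real \<Rightarrow> 'a \<Rightarrow> real"
    and A :: "real^'n^'n" and B :: "'l \<Rightarrow> real^'n^'n"
    and X :: "real^'n \<Rightarrow> real \<Rightarrow> 'a \<Rightarrow> real^'n"
    and P :: "complex^'n^'n" and \<alpha> :: "'n \<Rightarrow> complex" and \<beta> :: "'n \<Rightarrow> 'l \<Rightarrow> complex"
    and x :: "real^'n" and t :: real
  assumes "prob_space M" and "usual_conditions M F"
    and "\<And>j. brownian_motion M F (W j)" and "indep_processes M W"
    and "\<And>x. strong_solution M F W A B x (X x)"
    and "invertible P"
    and "P ** complexify_mat A ** matrix_inv P = diag_matrix \<alpha>"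
    and "\<And>j. P ** complexify_mat (B j) ** matrix_inv P = diag_matrix (\<lambda>i. \<beta> i j)"
    and "t \<ge> 0"
  defines "\<Gamma> \<equiv> conjugate_transpose (matrix_inv P) ** matrix_inv P"
    and "y \<equiv> P *v complexify_vec x"
    and "R \<equiv> \<lambda>i k. Re (cnj (\<alpha> i) + \<alpha> k + 1/2 * (\<Sum>j\<in>UNIV. (cnj (\<beta> i j) + \<beta> k j)^2))"
    and "I \<equiv> \<lambda>i k. Im (cnj (\<alpha> i) + \<alpha> k + 1/2 * (\<Sum>j\<in>UNIV. (cnj (\<beta> i j) + \<beta> k j)^2))"
  shows "integrable M (\<lambda>\<omega>. (norm (X x t \<omega>))^2) \<and>
    complex_of_real (prob_space.expectation M (\<lambda>\<omega>. (norm (X x t \<omega>))^2)) =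
      (\<Sum>i\<in>UNIV. \<Sum>k\<in>UNIV. cnj (y $ i) * \<Gamma> $ i $ k * y $ k *
         complex_of_real (exp (t * R i k)) * exp (\<i> * complex_of_real t * complex_of_real (I i k)))"
proof -
  interpret brownian_filtration M F W
    using assms(1-3) unfolding brownian_filtration_def brownian_filtration_axioms_def
    by (auto simp: usual_conditions_def)
  define m where "m i k = cnj (\<alpha> i) + \<alpha> k + 1/2 * (\<Sum>j\<in>UNIV. (cnj (\<beta> i j) + \<beta> k j)\<^sup>2)" for i k
  \<comment> \<open>The product of the conjugated i-th and the k-th exponential solution, with the
    deterministic factor split off; what remains is a Gaussian exponential with coefficients cnj
    (\<beta> i j) + \<beta> k j.\<close>
  define G where "G i k \<omega> = exp (complex_of_real t * (cnj (\<alpha> i) + \<alpha> k)) *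
    exp (\<Sum>j\<in>UNIV. (cnj (\<beta> i j) + \<beta> k j) * of_real (W j t \<omega>))" for i k \<omega>
  let ?N = "\<lambda>\<omega>. (norm (X x t \<omega>))\<^sup>2"
  have X_measurable: "X x t \<in> borel_measurable M"
    using assms(5)[of x] \<open>t \<ge> 0\<close> by (auto simp: strong_solution_def adapted_def intro: measurable_filt)
  have "AE \<omega> in M. eigen_coord P i (X x t \<omega>) = y $ i * exp (linear_driver (\<alpha> i) (\<beta> i) W t \<omega>)" for i
    using eigen_coord_solution[OF assms(5)[of x] \<open>t \<ge> 0\<close> eigen_coord_mult[OF assms(6,7)] eigen_coord_mult[OF assms(6,8)]]
    by (simp add: y_def eigen_coord_def[of P _ x])
  then have "AE \<omega> in M. \<forall>i\<in>UNIV. eigen_coord P i (X x t \<omega>) = y $ i * exp (linear_driver (\<alpha> i) (\<beta> i) W t \<omega>)"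
    by (intro AE_finite_allI) auto
  then have AE_eq: "AE \<omega> in M. complex_of_real (?N \<omega>) = (\<Sum>i\<in>UNIV. \<Sum>k\<in>UNIV. cnj (y $ i) * \<Gamma> $ i $ k * y $ k * G i k \<omega>)"
  proof eventually_elim
    fix \<omega> assume *: "\<forall>i\<in>UNIV. eigen_coord P i (X x t \<omega>) = y $ i * exp (linear_driver (\<alpha> i) (\<beta> i) W t \<omega>)"
    have "cnj (exp (linear_driver (\<alpha> i) (\<beta> i) W t \<omega>)) * exp (linear_driver (\<alpha> k) (\<beta> k) W t \<omega>) = G i k \<omega>" for i k
      unfolding G_def linear_driver_def
      by (simp add: exp_cnj algebra_simps sum.distrib flip: exp_add)
    then show "complex_of_real (?N \<omega>) = (\<Sum>i\<in>UNIV. \<Sum>k\<in>UNIV. cnj (y $ i) * \<Gamma> $ i $ k * y $ k * G i k \<omega>)"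
      unfolding norm_sq_eigen_coord[OF assms(6)] \<Gamma>_def using *
      by (intro sum.cong refl) (simp add: mult.assoc mult.left_commute)
  qed
  have G: "integrable M (G i k)" "expectation (G i k) = exp (complex_of_real t * m i k)" for i k
  proof -
    note E = expectation_exp_sum_W[OF assms(4,9), of "\<lambda>j. cnj (\<beta> i j) + \<beta> k j"]
    show "integrable M (G i k)"
      unfolding G_def[abs_def] by (intro integrable_mult_right E)
    have "expectation (G i k) = exp (complex_of_real t * (cnj (\<alpha> i) + \<alpha> k)) *
        exp (of_real t * (\<Sum>j\<in>UNIV. (cnj (\<beta> i j) + \<beta> k j)\<^sup>2) / 2)"
      unfolding G_def[abs_def] by (simp add: E(2))
    then show "expectation (G i k) = exp (complex_of_real t * m i k)"
      by (simp add: m_def distrib_left flip: exp_add)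
  qed
  have intR: "integrable M (\<lambda>\<omega>. \<Sum>i\<in>UNIV. \<Sum>k\<in>UNIV. cnj (y $ i) * \<Gamma> $ i $ k * y $ k * G i k \<omega>)"
    using G(1) by (intro Bochner_Integration.integrable_sum integrable_mult_right)
  \<comment> \<open>Integrability is transported from the explicit sum, with which the measurable
    squared norm agrees almost surely.\<close>
  have "integrable M (\<lambda>\<omega>. complex_of_real (?N \<omega>))"
    using X_measurable by (intro integrable_cong_AE_imp[OF intR _ AE_symmetric[OF AE_eq]]) measurable
  then have "integrable M (\<lambda>\<omega>. Re (complex_of_real (?N \<omega>)))"
    by (rule integrable_Re)
  then have "integrable M ?N" by simp
  moreover have "complex_of_real (expectation ?N) =
    (\<Sum>i\<in>UNIV. \<Sum>k\<in>UNIV. cnj (y $ i) * \<Gamma> $ i $ k * y $ k * exp (complex_of_real t * m i k))"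
  proof -
    have "complex_of_real (expectation ?N) = expectation (\<lambda>\<omega>. complex_of_real (?N \<omega>))"
      by (rule integral_complex_of_real[symmetric])
    also have "\<dots> = expectation (\<lambda>\<omega>. \<Sum>i\<in>UNIV. \<Sum>k\<in>UNIV. cnj (y $ i) * \<Gamma> $ i $ k * y $ k * G i k \<omega>)"
      by (rule integral_cong_AE) (use X_measurable intR AE_eq in auto)
    also have "\<dots> = (\<Sum>i\<in>UNIV. \<Sum>k\<in>UNIV. cnj (y $ i) * \<Gamma> $ i $ k * y $ k * exp (complex_of_real t * m i k))"
      using G by (simp add: Bochner_Integration.integral_sum)
    finally show ?thesis .
  qed
  moreover have "exp (complex_of_real t * m i k) =
      complex_of_real (exp (t * R i k)) * exp (\<i> * complex_of_real t * complex_of_real (I i k))" for i k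
  proof -
    have "m i k = complex_of_real (R i k) + \<i> * complex_of_real (I i k)"
      unfolding R_def I_def m_def[symmetric] by (rule complex_eq)
    then show ?thesis
      by (simp add: distrib_left exp_add exp_of_real[symmetric] mult.assoc mult.left_commute)
  qed
  ultimately show ?thesis by (simp only: mult.assoc)
qed

end
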